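(* Let $D$ be a prime number, let $\mathcal{H}_1,\mathcal{H}_2$ be $D$-dimensional complex Hilbert spaces, and let $\{|\Psi_j\rangle\}_{j=0}^{N-1}\subset\mathcal{H}_1\otimes\mathcal{H}_2$ be a set of mutually orthogonal maximally entangled states. Then $\{|\Psi_j\rangle\}_{j=0}^{N-1}$ is locally copiable if and only if there exist unitary operators $V$ on $\mathcal{H}_1$ and $W$ on $\mathcal{H}_2$ (independent of $j$) such that, up to global phase factors of the individual states, $\{(V\otimes W)|\Psi_j\rangle\}_{j=0}^{N-1}$ is a simultaneously Schmidt decomposable subset of the set of canonical form Bell states $\{|\Psi_{nm}\rangle\}_{n,m=0}^{D-1}$.
   Context: A maximally entangled state in $\mathcal{H}_1\otimes\mathcal{H}_2$ (both of dimension $D$) is a unit vector of the form $\frac{1}{\sqrt D}\sum_{k=0}^{D-1}|e_k\rangle\otimes|f_k\rangle$ with $\{|e_k\rangle\}$, $\{|f_k\rangle\}$ orthonormal bases of $\mathcal{H}_1$, $\mathcal{H}_2$. Canonical form Bell states: fix orthonormal bases $\{|k\rangle\}_{k=0}^{D-1}$ of $\mathcal{H}_1$ and of $\mathcal{H}_2$, let $\oplus$ be addition modulo $D$, $\omega=e^{2\pi i/D}$, and on $\mathcal{H}_1$ let $Z=\sum_{k=0}^{D-1}\omega^k|k\rangle\langle k|$ and $X=\sum_{k=0}^{D-1}|k\rangle\langle k\oplus 1|$. Then $|\Psi_{00}\rangle=\frac{1}{\sqrt D}\sum_{k=0}^{D-1}|k\rangle\otimes|k\rangle$ and $|\Psi_{nm}\rangle=(Z^nX^m\otimes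 I)|\Psi_{00}\rangle$. Simultaneous Schmidt decomposability: a set of states $\{|\Psi_\alpha\rangle\}_{\alpha\in\Gamma}\subset\mathcal{H}_1\otimes\mathcal{H}_2$ is simultaneously Schmidt decomposable if there are orthonormal bases $\{|e_k\rangle\}_{k=0}^{D-1}$ of $\mathcal{H}_1$ and $\{|f_k\rangle\}_{k=0}^{D-1}$ of $\mathcal{H}_2$ and complex numbers $b_k^{(\alpha)}$ such that $|\Psi_\alpha\rangle=\sum_{k=0}^{D-1}b_k^{(\alpha)}|e_k\rangle\otimes|f_k\rangle$ for all $\alpha\in\Gamma$. Local copiability: let $\mathcal{H}_3\cong\mathcal{H}_1$ and $\mathcal{H}_4\cong\mathcal{H}_2$ be further copies (fixed identifications), so each is $D$-dimensional. Alice holds $\mathcal{H}_A=\mathcal{H}_1\otimes\mathcal{H}_3$ and Bob holds $\mathcal{H}_B=\mathcal{H}_2\otimes\mathcal{H}_4$. For $|\Psi_j\rangle\in\mathcal{H}_1\otimes\mathcal{H}_2$ write $|\Psi_j^{12}\rangle$ for this vector and $|\Psi_j^{34}\rangle$ for the corresponding vector in $\mathcal{H}_3\otimes\mathcal{H}_4$. A set $\{|\Psi_j\rangle\}_{j=0}^{N-1}$ is locally copiable if there exist a state (unit vector) $|b^{34}\rangle\in\mathcal{H}_3\otimes\mathcal{H}_4$ (the blank state) and a deterministic (trace-preserving) operation $\Lambda$ on $\mathcal{H}_A\otimes\mathcal{H}_B$ implementable by local operations and classical communication (LOCC) between Alice and Bob such that for all $j=0,\dots,N-1$ $$\Lambda\big(|\Psi_j^{12}\rangle\langle\Psi_j^{12}|\otimes|b^{34}\rangle\langle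 b^{34}|\big)=|\Psi_j^{12}\rangle\langle\Psi_j^{12}|\otimes|\Psi_j^{34}\rangle\langle\Psi_j^{34}|.$$ *)

theory Defs
  imports "Jordan_Normal_Form.Schur_Decomposition" "HOL-Computational_Algebra.Primes"
begin

text \<open>
  A \<open>d\<close>-dimensional complex Hilbert space is \<open>carrier_vec d\<close> with inner product \<open>\<bullet>c\<close>, and operators
  are complex matrices. The tensor product of spaces of dimensions \<open>m\<close> and \<open>n\<close> is
  \<open>carrier_vec (m * n)\<close>; the product basis vector of \<open>i < m\<close> and \<open>j < n\<close> has index \<open>i * n + j\<close>.
\<close>

definition tensor_vec :: "complex vec \<Rightarrow> complex vec \<Rightarrow> complex vec" (infixl \<open>\<otimes>\<^sub>v\<close> 72) where
  "v \<otimes>\<^sub>v w = vec (dim_vec v * dim_vec w) (\<lambda>i. v $ (i div dim_vec w) * w $ (i mod dim_vec w))"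

definition tensor_mat :: "complex mat \<Rightarrow> complex mat \<Rightarrow> complex mat" (infixl \<open>\<otimes>\<^sub>m\<close> 72) where
  "A \<otimes>\<^sub>m B = mat (dim_row A * dim_row B) (dim_col A * dim_col B)
     (\<lambda>(i, j). A $$ (i div dim_row B, j div dim_col B) * B $$ (i mod dim_row B, j mod dim_col B))"

text \<open>The operator \<open>|v\<rangle>\<langle>w|\<close>.\<close>

definition ketbra :: "complex vec \<Rightarrow> complex vec \<Rightarrow> complex mat" where
  "ketbra v w = mat (dim_vec v) (dim_vec w) (\<lambda>(i, j). v $ i * cnj (w $ j))"

abbreviation vec_sum :: "nat \<Rightarrow> ('k \<Rightarrow> complex vec) \<Rightarrow> 'k set \<Rightarrow> complex vec" where
  "vec_sum n \<equiv> finsum_vec TYPE(complex) n"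

definition mat_sum :: "nat \<Rightarrow> nat \<Rightarrow> ('k \<Rightarrow> complex mat) \<Rightarrow> 'k set \<Rightarrow> complex mat" where
  "mat_sum nr nc F S = mat nr nc (\<lambda>ij. \<Sum>k\<in>S. F k $$ ij)"

definition unit_state :: "nat \<Rightarrow> complex vec \<Rightarrow> bool" where
  "unit_state d \<psi> \<longleftrightarrow> \<psi> \<in> carrier_vec d \<and> \<psi> \<bullet>c \<psi> = 1"

definition unitary :: "nat \<Rightarrow> complex mat \<Rightarrow> bool" where
  "unitary d U \<longleftrightarrow> U \<in> carrier_mat d d \<and> mat_adjoint U * U = 1\<^sub>m d \<and> U * mat_adjoint U = 1\<^sub>m d"

text \<open>
  An orthonormal basis of \<open>carrier_vec d\<close> is a family indexed by \<open>{..<d}\<close>: \<open>d\<close> orthonormal vectors of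
  a \<open>d\<close>-dimensional space span it. Values at indices \<open>\<ge> d\<close> are irrelevant.
\<close>

definition onb :: "nat \<Rightarrow> (nat \<Rightarrow> complex vec) \<Rightarrow> bool" where
  "onb d e \<longleftrightarrow> (\<forall>k<d. e k \<in> carrier_vec d) \<and>
     (\<forall>k<d. \<forall>l<d. e k \<bullet>c e l = (if k = l then 1 else 0))"


section \<open>Maximally entangled states and canonical form Bell states\<close>

definition diag_state :: "nat \<Rightarrow> (nat \<Rightarrow> complex vec) \<Rightarrow> (nat \<Rightarrow> complex vec) \<Rightarrow> complex vec" where
  "diag_state D e f =
     complex_of_real (1 / sqrt (real D)) \<cdot>\<^sub>v vec_sum (D * D) (\<lambda>k. e k \<otimes>\<^sub>v f k) {..<D}"

definition max_entangled :: "nat \<Rightarrow> complex vec \<Rightarrow> bool" where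
  "max_entangled D \<psi> \<longleftrightarrow> unit_state (D * D) \<psi> \<and> (\<exists>e f. onb D e \<and> onb D f \<and> \<psi> = diag_state D e f)"

definition root_unity :: "nat \<Rightarrow> complex" where
  "root_unity D = exp (2 * complex_of_real pi * \<i> / of_nat D)"

definition Z_op :: "nat \<Rightarrow> (nat \<Rightarrow> complex vec) \<Rightarrow> complex mat" where
  "Z_op D g = mat_sum D D (\<lambda>k. root_unity D ^ k \<cdot>\<^sub>m ketbra (g k) (g k)) {..<D}"

definition X_op :: "nat \<Rightarrow> (nat \<Rightarrow> complex vec) \<Rightarrow> complex mat" where
  "X_op D g = mat_sum D D (\<lambda>k. ketbra (g k) (g ((k + 1) mod D))) {..<D}"

text \<open>\<open>g\<close> and \<open>h\<close> are the fixed orthonormal bases \<open>|k\<rangle>\<close> of the first and of the second space.\<close>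

definition bell_state ::
  "nat \<Rightarrow> (nat \<Rightarrow> complex vec) \<Rightarrow> (nat \<Rightarrow> complex vec) \<Rightarrow> nat \<Rightarrow> nat \<Rightarrow> complex vec" where
  "bell_state D g h n m = ((Z_op D g ^\<^sub>m n * X_op D g ^\<^sub>m m) \<otimes>\<^sub>m 1\<^sub>m D) *\<^sub>v diag_state D g h"

definition sim_schmidt_decomposable :: "nat \<Rightarrow> complex vec set \<Rightarrow> bool" where
  "sim_schmidt_decomposable D S \<longleftrightarrow> (\<exists>e f. onb D e \<and> onb D f \<and>
     (\<forall>\<psi>\<in>S. \<exists>b :: nat \<Rightarrow> complex. \<psi> = vec_sum (D * D) (\<lambda>k. b k \<cdot>\<^sub>v (e k \<otimes>\<^sub>v f k)) {..<D}))"


section \<open>LOCC operations\<close>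

text \<open>The completely positive map with Kraus operators \<open>Ks\<close> and output dimension \<open>d\<close>.\<close>

definition kraus_map :: "nat \<Rightarrow> complex mat list \<Rightarrow> complex mat \<Rightarrow> complex mat" where
  "kraus_map d Ks \<rho> = mat_sum d d (\<lambda>i. Ks ! i * \<rho> * mat_adjoint (Ks ! i)) {..<length Ks}"

text \<open>
  A quantum instrument on a \<open>d\<close>-dimensional system with outcomes \<open>x < m\<close>. Outcome \<open>x\<close> leaves a
  system of dimension \<open>ds x\<close> (so ancillas may be added or discarded), transformed by the completely
  positive map with Kraus operators \<open>Es x\<close>; the sum of all these maps preserves the trace.
\<close>

definition instrument :: "nat \<Rightarrow> nat \<Rightarrow> (nat \<Rightarrow> nat) \<Rightarrow> (nat \<Rightarrow> complex mat list) \<Rightarrow> bool" where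
  "instrument d m ds Es \<longleftrightarrow> (\<forall>x<m. set (Es x) \<subseteq> carrier_mat (ds x) d) \<and>
     mat_sum d d (\<lambda>x. mat_sum d d (\<lambda>i. mat_adjoint (Es x ! i) * Es x ! i) {..<length (Es x)}) {..<m}
       = 1\<^sub>m d"

text \<open>
  \<open>locc dA' dB' dA dB \<Lambda>\<close>: \<open>\<Lambda>\<close> is implemented by a finite LOCC protocol that turns local systems of
  dimensions \<open>dA\<close> (Alice) and \<open>dB\<close> (Bob) into systems of dimensions \<open>dA'\<close> and \<open>dB'\<close>. In each round one
  party applies an instrument and announces the outcome \<open>x\<close>, after which both continue with a
  protocol that may depend on \<open>x\<close>. At the end, the outcomes are forgotten. By the normalization of
  instruments, every such \<open>\<Lambda>\<close> preserves the trace.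
\<close>

inductive locc :: "nat \<Rightarrow> nat \<Rightarrow> nat \<Rightarrow> nat \<Rightarrow> (complex mat \<Rightarrow> complex mat) \<Rightarrow> bool"
  for dA' dB' :: nat where
  finish: "locc dA' dB' dA' dB' (\<lambda>\<rho>. \<rho>)"
| alice: "instrument dA m ds Es \<Longrightarrow> (\<And>x. x < m \<Longrightarrow> locc dA' dB' (ds x) dB (\<Lambda> x)) \<Longrightarrow>
    locc dA' dB' dA dB (\<lambda>\<rho>. mat_sum (dA' * dB') (dA' * dB')
      (\<lambda>x. \<Lambda> x (kraus_map (ds x * dB) (map (\<lambda>E. E \<otimes>\<^sub>m 1\<^sub>m dB) (Es x)) \<rho>)) {..<m})"
| bob: "instrument dB m ds Es \<Longrightarrow> (\<And>x. x < m \<Longrightarrow> locc dA' dB' dA (ds x) (\<Lambda> x)) \<Longrightarrow>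
    locc dA' dB' dA dB (\<lambda>\<rho>. mat_sum (dA' * dB') (dA' * dB')
      (\<lambda>x. \<Lambda> x (kraus_map (dA * ds x) (map (\<lambda>E. 1\<^sub>m dA \<otimes>\<^sub>m E) (Es x)) \<rho>)) {..<m})"


section \<open>Local copiability\<close>

text \<open>
  For \<open>D\<close>-dimensional \<open>H1, ..., H4\<close>, the operator \<open>M\<close> on \<open>(H1 \<otimes> H2) \<otimes> (H3 \<otimes> H4)\<close> is viewed on
  \<open>HA \<otimes> HB = (H1 \<otimes> H3) \<otimes> (H2 \<otimes> H4)\<close>. The index with base-\<open>D\<close> digits \<open>i1 i3 i2 i4\<close> of the latter
  space corresponds to the index with digits \<open>i1 i2 i3 i4\<close> of the former.
\<close>

definition swap_mid :: "nat \<Rightarrow> nat \<Rightarrow> nat" where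
  "swap_mid D i = (let i1 = i div D ^ 3; i3 = i div D ^ 2 mod D; i2 = i div D mod D; i4 = i mod D
     in ((i1 * D + i2) * D + i3) * D + i4)"

definition regroup :: "nat \<Rightarrow> complex mat \<Rightarrow> complex mat" where
  "regroup D M = mat ((D * D) * (D * D)) ((D * D) * (D * D))
     (\<lambda>(i, j). M $$ (swap_mid D i, swap_mid D j))"

definition locally_copiable :: "nat \<Rightarrow> nat \<Rightarrow> (nat \<Rightarrow> complex vec) \<Rightarrow> bool" where
  "locally_copiable D N \<Psi> \<longleftrightarrow> (\<exists>b \<Lambda>. unit_state (D * D) b \<and>
     locc (D * D) (D * D) (D * D) (D * D) \<Lambda> \<and>
     (\<forall>j<N. \<Lambda> (regroup D (ketbra (\<Psi> j) (\<Psi> j) \<otimes>\<^sub>m ketbra b b)) =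
            regroup D (ketbra (\<Psi> j) (\<Psi> j) \<otimes>\<^sub>m ketbra (\<Psi> j) (\<Psi> j))))"

end

theory Submission
  imports Defs "HOL-Number_Theory.Cong"
begin

text \<open>
  A vector of \<open>H1 \<otimes> H2\<close> is identified with a matrix, and a maximally entangled one with a unitary \<open>U\<^sub>j\<close>
  up to the factor \<open>1 / sqrt D\<close>. LOCC operations are separable, so copying yields matrices \<open>A\<close>, \<open>B\<close> with
  \<open>A (U\<^sub>j \<otimes> b) B\<^sup>T\<close> proportional to \<open>U\<^sub>j \<otimes> U\<^sub>j\<close>. Dividing by the case \<open>j = 0\<close> shows that \<open>A\<close> is invertible
  and that \<open>W\<^sub>j = U\<^sub>j U\<^sub>0\<^sup>\<dagger>\<close> satisfies \<open>A (W\<^sub>j \<otimes> 1) = c (W\<^sub>j \<otimes> W\<^sub>j) A\<close>. The unitaries \<open>P\<close> with this property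
  (for varying \<open>c\<close>) form a group; comparing traces, \<open>D tr P = c (tr P)\<^sup>2\<close>, every element is traceless or
  scalar. For prime \<open>D\<close>, a nonscalar element of a unitary group with this dichotomy is, in a suitable
  basis, a multiple of the clock matrix, and commutators in the group are scalars. The copying
  relation forces these scalars to be \<open>1\<close>, so the \<open>W\<^sub>j\<close> commute and are, up to phases, powers of one
  clock matrix.

  Conversely, the Weyl group generated by clock and shift has the same trace dichotomy, and
  simultaneous Schmidt decomposability makes the \<open>W\<^sub>j\<close> commute; so they are again powers of one clock
  matrix, and a controlled shift in its eigenbasis copies them.
\<close>

section \<open>Unitary matrices and traces\<close>

text \<open>The operator \<open>A\<close> extracted from a protocol is one factor of a single Kraus
  operator. It turns out invertible but is not known to be unitary, so the modulus of the multiplier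
  \<open>c\<close> in the copying relation is unknown. It is eliminated by playing \<open>P\<close>
  against its adjoint: if \<open>tr P\<close> is nonzero, then \<open>n = c tr P\<close> and
  \<open>n = cnj (tr P) / c\<close>, whose product gives \<open>|tr P| = n\<close>, the extreme case
  of the triangle inequality. A whole group is needed rather than the \<open>W\<^sub>j\<close>
  alone, since the eigenvalues of \<open>P\<close> are read off from traces of its powers, and the
  relation of a second element \<open>Q\<close> to the clock matrix \<open>Z\<close> from traces of
  the words \<open>Z^i Q Z^j Q\<^sup>\<dagger>\<close>. Commutation in the copying group is a matter
  of degrees: a scalar \<open>k\<close> with \<open>Q P = k P Q\<close> enters the left side of the
  copying relation once and the right side twice, so \<open>k = k^2\<close>. The Weyl group obeys
  the trace dichotomy without being commutative, which is why Schmidt decomposability has to supply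
  commutation there. Primality enters twice: the common multiplicity of the eigenvalues divides
  \<open>n\<close>, and nonzero residues are invertible modulo \<open>n\<close>.\<close>

abbreviation adjoint :: "complex mat \<Rightarrow> complex mat" (\<open>_\<^sup>\<dagger>\<close> [1000] 1000) where
  "A\<^sup>\<dagger> \<equiv> mat_adjoint A"

lemma dim_adjoint [simp]: "dim_row A\<^sup>\<dagger> = dim_col A" "dim_col A\<^sup>\<dagger> = dim_row A"
  by (simp_all add: mat_adjoint_def)

lemma index_adjoint [simp]:
  "i < dim_col A \<Longrightarrow> j < dim_row A \<Longrightarrow> A\<^sup>\<dagger> $$ (i, j) = cnj (A $$ (j, i))"
  by (simp add: mat_adjoint_def mat_of_rows_def)

lemma adjoint_carrier [simp]: "A \<in> carrier_mat n m \<Longrightarrow> A\<^sup>\<dagger> \<in> carrier_mat m n"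
  by (intro carrier_matI) simp_all

lemma mult_assoc_dim:
  fixes A B C :: "complex mat"
  assumes "dim_col A = dim_row B" and "dim_col B = dim_row C"
  shows "(A * B) * C = A * (B * C)"
  using assms by (intro assoc_mult_mat[of _ "dim_row A" "dim_row B" _ "dim_row C" _ "dim_col C"]) auto

lemma smult_mult_left:
  fixes A B :: "complex mat"
  assumes "dim_col A = dim_row B"
  shows "(k \<cdot>\<^sub>m A) * B = k \<cdot>\<^sub>m (A * B)"
  using assms by (intro mult_smult_assoc_mat[of _ "dim_row A" "dim_row B" _ "dim_col B"]) auto

lemma smult_mult_right:
  fixes A B :: "complex mat"
  assumes "dim_col A = dim_row B"
  shows "A * (k \<cdot>\<^sub>m B) = k \<cdot>\<^sub>m (A * B)"
  using assms by (intro mult_smult_distrib[of _ "dim_row A" "dim_row B" _ "dim_col B"]) auto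

lemma smult_smult_mat: "k \<cdot>\<^sub>m (l \<cdot>\<^sub>m A) = (k * l) \<cdot>\<^sub>m (A :: complex mat)"
  by (intro eq_matI) auto

lemma one_smult_mat: "1 \<cdot>\<^sub>m A = (A :: complex mat)"
  by (intro eq_matI) auto

lemmas mat_simps = mult_assoc_dim smult_mult_left smult_mult_right smult_smult_mat one_smult_mat

lemma index_mult_sum:
  fixes A B :: "complex mat"
  assumes "i < dim_row A" "j < dim_col B" "dim_col A = n" "dim_row B = n"
  shows "(A * B) $$ (i, j) = (\<Sum>k<n. A $$ (i, k) * B $$ (k, j))"
  using assms by (simp add: scalar_prod_def lessThan_atLeast0)

lemma index_mult_mat_vec_sum:
  fixes A :: "complex mat"
  assumes "i < dim_row A" "dim_col A = n" "dim_vec v = n"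
  shows "(A *\<^sub>v v) $ i = (\<Sum>k<n. A $$ (i, k) * v $ k)"
  using assms by (simp add: scalar_prod_def lessThan_atLeast0)

lemma adjoint_mult:
  assumes "dim_col A = dim_row B"
  shows "(A * B)\<^sup>\<dagger> = B\<^sup>\<dagger> * A\<^sup>\<dagger>"
  by (intro eq_matI)
     (use assms in \<open>auto simp: index_mult_sum[of _ _ _ _ "dim_row B"] mult.commute
        simp del: index_mult_mat(1)\<close>)

lemma adjoint_adjoint [simp]: "A\<^sup>\<dagger>\<^sup>\<dagger> = A"
  by (intro eq_matI) auto

lemma adjoint_smult: "(k \<cdot>\<^sub>m A)\<^sup>\<dagger> = cnj k \<cdot>\<^sub>m A\<^sup>\<dagger>"
  by (intro eq_matI) auto

lemma adjoint_one [simp]: "(1\<^sub>m n)\<^sup>\<dagger> = 1\<^sub>m n"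
  by (intro eq_matI) auto

lemma unitaryD:
  assumes "unitary n U"
  shows "U \<in> carrier_mat n n" "dim_row U = n" "dim_col U = n" "U\<^sup>\<dagger> * U = 1\<^sub>m n" "U * U\<^sup>\<dagger> = 1\<^sub>m n"
  using assms by (auto simp: unitary_def)

lemma unitary_cancel:
  assumes "unitary n U" and "dim_row A = n"
  shows "U\<^sup>\<dagger> * (U * A) = A" "U * (U\<^sup>\<dagger> * A) = A"
  using assms unitaryD[OF assms(1)]
  by (simp_all flip: mult_assoc_dim)

lemma unitary_if_left_inverse:
  assumes "U \<in> carrier_mat n n" and "U\<^sup>\<dagger> * U = 1\<^sub>m n"
  shows "unitary n U"
  using assms mat_mult_left_right_inverse[of "U\<^sup>\<dagger>" n U] by (simp add: unitary_def)

lemma unitary_one: "unitary n (1\<^sub>m n)"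
  by (simp add: unitary_def)

lemma unitary_mult:
  assumes "unitary n U" and "unitary n V"
  shows "unitary n (U * V)"
  using unitaryD[OF assms(1)] unitaryD[OF assms(2)] assms
  by (intro unitary_if_left_inverse) (auto simp: adjoint_mult mult_assoc_dim unitary_cancel)

lemma unitary_adjoint: "unitary n U \<Longrightarrow> unitary n U\<^sup>\<dagger>"
  by (simp add: unitary_def)

lemma unitary_smult:
  assumes "unitary n U" and "cmod c = 1"
  shows "unitary n (c \<cdot>\<^sub>m U)"
proof -
  have "c * cnj c = 1"
    using assms(2) by (simp flip: complex_norm_square)
  then show ?thesis
    using unitaryD[OF assms(1)]
    by (intro unitary_if_left_inverse) (auto simp: adjoint_smult mat_simps)
qed

lemma unitary_transpose:
  assumes "unitary n U"
  shows "unitary n U\<^sup>T"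
proof (rule unitary_if_left_inverse)
  have "(U\<^sup>T)\<^sup>\<dagger> = (U\<^sup>\<dagger>)\<^sup>T"
    by (intro eq_matI) auto
  then have "(U\<^sup>T)\<^sup>\<dagger> * U\<^sup>T = (U * U\<^sup>\<dagger>)\<^sup>T"
    using unitaryD(1)[OF assms] transpose_mult[of U n n "U\<^sup>\<dagger>" n] by simp
  then show "(U\<^sup>T)\<^sup>\<dagger> * U\<^sup>T = 1\<^sub>m n"
    by (simp add: unitaryD[OF assms])
qed (use unitaryD[OF assms] in simp)

lemma unitary_row_norm:
  assumes "unitary n U" and "i < n"
  shows "(\<Sum>k<n. (cmod (U $$ (i, k)))\<^sup>2) = 1"
proof -
  have "complex_of_real (\<Sum>k<n. (cmod (U $$ (i, k)))\<^sup>2) = (U * U\<^sup>\<dagger>) $$ (i, i)"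
    using assms(2) unitaryD(1)[OF assms(1)]
    by (simp add: index_mult_sum[of _ _ _ _ n] complex_norm_square
          del: index_mult_mat(1) of_real_power)
  also have "\<dots> = of_real 1"
    using assms unitaryD(5)[OF assms(1)] by simp
  finally show ?thesis
    by (simp only: of_real_eq_iff)
qed

lemma unitary_row_nonzero:
  assumes "unitary n U" and "i < n"
  obtains k where "k < n" "U $$ (i, k) \<noteq> 0"
proof (rule ccontr)
  assume "\<not> thesis"
  then have "\<forall>k<n. U $$ (i, k) = 0" using that by blast
  then show False using unitary_row_norm[OF assms] by simp
qed

lemma unitary_col_nonzero:
  assumes "unitary n U" and "i < n"
  obtains k where "k < n" "U $$ (k, i) \<noteq> 0"
proof -
  obtain k where "k < n" "U\<^sup>T $$ (i, k) \<noteq> 0"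
    using unitary_row_nonzero[OF unitary_transpose[OF assms(1)] assms(2)] .
  with that show thesis
    using unitaryD[OF assms(1)] assms(2) by simp
qed

section \<open>Traces and the extreme case of the trace bound for unitary matrices\<close>

definition mtrace :: "complex mat \<Rightarrow> complex" where
  "mtrace A = (\<Sum>i<dim_row A. A $$ (i, i))"

lemma mtrace_comm:
  assumes "A \<in> carrier_mat n m" "B \<in> carrier_mat m n"
  shows "mtrace (A * B) = mtrace (B * A)"
proof -
  have "mtrace (A * B) = (\<Sum>i<n. \<Sum>k<m. A $$ (i, k) * B $$ (k, i))"
    using assms by (simp add: mtrace_def index_mult_sum[of _ _ _ _ m] del: index_mult_mat(1))
  also have "\<dots> = (\<Sum>k<m. \<Sum>i<n. B $$ (k, i) * A $$ (i, k))"
    by (subst sum.swap) (simp add: mult.commute)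
  also have "\<dots> = mtrace (B * A)"
    using assms by (simp add: mtrace_def index_mult_sum[of _ _ _ _ n] del: index_mult_mat(1))
  finally show ?thesis .
qed

lemma mtrace_smult: "A \<in> carrier_mat n n \<Longrightarrow> mtrace (c \<cdot>\<^sub>m A) = c * mtrace A"
  by (simp add: mtrace_def sum_distrib_left)

lemma mtrace_similar:
  assumes "A \<in> carrier_mat n n" "P \<in> carrier_mat n n" "Q \<in> carrier_mat n n" "Q * P = 1\<^sub>m n"
  shows "mtrace (P * A * Q) = mtrace A"
proof -
  have "mtrace (P * A * Q) = mtrace (Q * (P * A))"
    using assms by (intro mtrace_comm[of _ n n]) auto
  also have "Q * (P * A) = (Q * P) * A"
    using assms by (intro mult_assoc_dim[symmetric]) auto
  finally show ?thesis
    using assms by simp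
qed

lemma mtrace_adjoint: "A \<in> carrier_mat n n \<Longrightarrow> mtrace A\<^sup>\<dagger> = cnj (mtrace A)"
  by (simp add: mtrace_def)

lemma unitary_entry_le:
  assumes "unitary n U" and "i < n" and "j < n"
  shows "cmod (U $$ (i, j)) \<le> 1"
proof -
  have "(cmod (U $$ (i, j)))\<^sup>2 \<le> (\<Sum>k<n. (cmod (U $$ (i, k)))\<^sup>2)"
    using assms(3) by (intro member_le_sum) auto
  then show ?thesis
    using unitary_row_norm[OF assms(1,2)] by (simp add: power2_le_iff_abs_le abs_square_le_1)
qed

lemma eq_one_if_Re:
  assumes "cmod z \<le> 1" and "Re z = 1"
  shows "z = 1"
proof -
  have "(cmod z)\<^sup>2 \<le> 1"
    using assms(1) by (simp add: abs_square_le_1)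
  then have "Im z = 0"
    using assms(2) by (simp add: cmod_power2)
  with assms(2) show ?thesis
    by (intro complex_eqI) simp_all
qed

text \<open>Equality case of the triangle inequality: diagonal entries have modulus at most 1, so a
  trace of modulus \<open>n\<close> forces all of them to be the same phase, and unit rows then
  leave no room off the diagonal.\<close>

lemma unitary_scalar_if_mtrace:
  assumes U: "unitary n U" and tr: "cmod (mtrace U) = real n" and "n > 0"
  shows "\<exists>c. cmod c = 1 \<and> U = c \<cdot>\<^sub>m 1\<^sub>m n"
proof -
  define c where "c = mtrace U / of_nat n"
  have c: "cmod c = 1"
    using tr \<open>n > 0\<close> by (simp add: c_def norm_divide)
  have cc: "c * cnj c = 1"
    using c by (simp flip: complex_norm_square)
  \<comment> \<open>As \<open>cnj c\<close> is the inverse of \<open>c\<close>, the rotated diagonal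
    sums to exactly \<open>n\<close>, so bounds on real parts are enough.\<close>
  define z where "z i = cnj c * U $$ (i, i)" for i
  have z_le: "cmod (z i) \<le> 1" if "i < n" for i
    using unitary_entry_le[OF U that that] c by (simp add: z_def norm_mult)
  have Re_le: "Re (z i) \<le> 1" if "i < n" for i
    using z_le[OF that] complex_Re_le_cmod[of "z i"] by linarith
  have "(\<Sum>i<n. z i) = cnj c * mtrace U"
    using unitaryD(1)[OF U] by (simp add: z_def mtrace_def sum_distrib_left)
  also have "mtrace U = of_nat n * c"
    using \<open>n > 0\<close> by (simp add: c_def)
  also have "cnj c * (of_nat n * c) = of_nat n * (c * cnj c)"
    by (simp only: ac_simps)
  finally have "(\<Sum>i<n. 1 - Re (z i)) = 0"
    by (simp add: cc sum_subtractf flip: Re_sum)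
  then have "Re (z i) = 1" if "i < n" for i
    using Re_le that by (subst (asm) sum_nonneg_eq_0_iff) auto
  then have "z i = 1" if "i < n" for i
    using eq_one_if_Re z_le that by blast
  then have diag: "U $$ (i, i) = c" if "i < n" for i
    using cc that unfolding z_def by (metis mult.assoc mult.commute mult_1 mult_1_right)
  have off: "U $$ (i, j) = 0" if "i < n" "j < n" "i \<noteq> j" for i j
  proof -
    have "(\<Sum>k\<in>{i, j}. (cmod (U $$ (i, k)))\<^sup>2) \<le> (\<Sum>k<n. (cmod (U $$ (i, k)))\<^sup>2)"
      using that by (intro sum_mono2) auto
    then show ?thesis
      using that c by (simp add: unitary_row_norm[OF U] diag)
  qed
  have "U = c \<cdot>\<^sub>m 1\<^sub>m n"
    using unitaryD[OF U] by (intro eq_matI) (auto simp: diag off)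
  with c show ?thesis by blast
qed

section \<open>Tensor products and matrices of bipartite states\<close>

lemma sum_div_mod:
  fixes f :: "nat \<Rightarrow> nat \<Rightarrow> 'a::comm_monoid_add"
  shows "(\<Sum>k<n * m. f (k div m) (k mod m)) = (\<Sum>a<n. \<Sum>b<m. f a b)"
proof -
  have "(\<Sum>a<n. \<Sum>b<m. f a b) = (\<Sum>(a, b)\<in>{..<n} \<times> {..<m}. f a b)"
    by (simp add: sum.cartesian_product)
  also have "\<dots> = (\<Sum>k<n * m. f (k div m) (k mod m))"
  proof (rule sum.reindex_bij_witness[of _ "\<lambda>k. (k div m, k mod m)" "\<lambda>(a, b). a * m + b"])
    fix p assume "p \<in> {..<n} \<times> {..<m}"
    then obtain a b where p: "p = (a, b)" "a < n" "b < m" by auto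
    have "a * m + b < (a + 1) * m" using p by simp
    also have "\<dots> \<le> n * m" using p by (intro mult_right_mono) auto
    finally show "(case p of (a, b) \<Rightarrow> a * m + b) \<in> {..<n * m}" using p by simp
  next
    fix k assume "k \<in> {..<n * m}"
    then show "(k div m, k mod m) \<in> {..<n} \<times> {..<m}"
      by (cases "m = 0") (auto simp: less_mult_imp_div_less)
  qed auto
  finally show ?thesis ..
qed

lemma digits_less:
  fixes a b n m :: nat
  assumes "a < n" and "b < m"
  shows "a * m + b < n * m"
proof -
  have "a * m + b < (a + 1) * m" using assms by simp
  also have "\<dots> \<le> n * m" using assms by (intro mult_right_mono) auto
  finally show ?thesis .
qed

lemma div_mod_less:
  fixes i n m :: nat
  assumes "i < n * m"
  shows "i div m < n" "i mod m < m"
  using assms by (cases "m = 0"; simp add: less_mult_imp_div_less)+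

lemma dim_tensor_mat [simp]:
  "dim_row (A \<otimes>\<^sub>m B) = dim_row A * dim_row B" "dim_col (A \<otimes>\<^sub>m B) = dim_col A * dim_col B"
  by (simp_all add: tensor_mat_def)

lemma index_tensor_mat [simp]:
  "i < dim_row A * dim_row B \<Longrightarrow> j < dim_col A * dim_col B \<Longrightarrow>
    (A \<otimes>\<^sub>m B) $$ (i, j)
      = A $$ (i div dim_row B, j div dim_col B) * B $$ (i mod dim_row B, j mod dim_col B)"
  by (simp add: tensor_mat_def)

lemma tensor_carrier:
  "A \<in> carrier_mat n m \<Longrightarrow> B \<in> carrier_mat k l \<Longrightarrow> A \<otimes>\<^sub>m B \<in> carrier_mat (n * k) (m * l)"
  by (intro carrier_matI) auto

lemma tensor_mult:
  assumes "dim_col A = dim_row C" and "dim_col B = dim_row E"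
  shows "(A \<otimes>\<^sub>m B) * (C \<otimes>\<^sub>m E) = (A * C) \<otimes>\<^sub>m (B * E)"
proof (intro eq_matI)
  fix i j
  assume "i < dim_row ((A * C) \<otimes>\<^sub>m (B * E))" and "j < dim_col ((A * C) \<otimes>\<^sub>m (B * E))"
  then have ij: "i < dim_row A * dim_row B" "j < dim_col C * dim_col E" by auto
  let ?n = "dim_row C" and ?m = "dim_row E"
  have "((A \<otimes>\<^sub>m B) * (C \<otimes>\<^sub>m E)) $$ (i, j)
      = (\<Sum>k<?n * ?m. (A $$ (i div dim_row B, k div ?m) * B $$ (i mod dim_row B, k mod ?m))
          * (C $$ (k div ?m, j div dim_col E) * E $$ (k mod ?m, j mod dim_col E)))"
    using ij assms
    by (simp add: index_mult_sum[of _ _ _ _ "?n * ?m"] del: index_mult_mat(1))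
  also have "\<dots> = (\<Sum>a<?n. \<Sum>b<?m. (A $$ (i div dim_row B, a) * C $$ (a, j div dim_col E))
          * (B $$ (i mod dim_row B, b) * E $$ (b, j mod dim_col E)))"
    by (subst sum_div_mod[where f = "\<lambda>a b. (A $$ (i div dim_row B, a) * B $$ (i mod dim_row B, b))
          * (C $$ (a, j div dim_col E) * E $$ (b, j mod dim_col E))"])
       (simp only: ac_simps)
  also have "\<dots> = ((A * C) \<otimes>\<^sub>m (B * E)) $$ (i, j)"
    using ij assms div_mod_less[OF ij(1)] div_mod_less[OF ij(2)]
    by (simp add: index_mult_sum[of _ _ _ _ ?n] index_mult_sum[of _ _ _ _ ?m] sum_product
        del: index_mult_mat(1))
  finally show "((A \<otimes>\<^sub>m B) * (C \<otimes>\<^sub>m E)) $$ (i, j) = ((A * C) \<otimes>\<^sub>m (B * E)) $$ (i, j)" .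
qed (use assms in auto)

lemma tensor_one: "1\<^sub>m n \<otimes>\<^sub>m 1\<^sub>m m = 1\<^sub>m (n * m)"
proof (intro eq_matI)
  fix i j
  assume "i < dim_row (1\<^sub>m (n * m) :: complex mat)" and "j < dim_col (1\<^sub>m (n * m) :: complex mat)"
  then have ij: "i < n * m" "j < n * m" by auto
  then have "i = j \<longleftrightarrow> i div m = j div m \<and> i mod m = j mod m"
    by (metis div_mult_mod_eq)
  then show "(1\<^sub>m n \<otimes>\<^sub>m 1\<^sub>m m) $$ (i, j) = 1\<^sub>m (n * m) $$ (i, j)"
    using ij div_mod_less[OF ij(1)] div_mod_less[OF ij(2)] by auto
qed auto

lemma tensor_adjoint: "(A \<otimes>\<^sub>m B)\<^sup>\<dagger> = A\<^sup>\<dagger> \<otimes>\<^sub>m B\<^sup>\<dagger>"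
  by (intro eq_matI) (auto simp: div_mod_less)

lemma tensor_smult_left: "(k \<cdot>\<^sub>m A) \<otimes>\<^sub>m B = k \<cdot>\<^sub>m (A \<otimes>\<^sub>m B)"
  by (intro eq_matI) (auto simp: div_mod_less)

lemma tensor_smult_right: "A \<otimes>\<^sub>m (k \<cdot>\<^sub>m B) = k \<cdot>\<^sub>m (A \<otimes>\<^sub>m B)"
  by (intro eq_matI) (auto simp: div_mod_less)

lemma unitary_tensor:
  assumes "unitary n U" and "unitary m V"
  shows "unitary (n * m) (U \<otimes>\<^sub>m V)"
  using unitaryD[OF assms(1)] unitaryD[OF assms(2)]
  by (intro unitary_if_left_inverse) (auto simp: tensor_adjoint tensor_mult tensor_one tensor_carrier)

lemma mtrace_tensor:
  assumes "A \<in> carrier_mat n n" and "B \<in> carrier_mat m m"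
  shows "mtrace (A \<otimes>\<^sub>m B) = mtrace A * mtrace B"
  using assms sum_div_mod[where f = "\<lambda>a b. A $$ (a, a) * B $$ (b, b)" and n = n and m = m]
  by (simp add: mtrace_def sum_product)


section \<open>Coefficient matrices of bipartite vectors\<close>

definition vmat :: "nat \<Rightarrow> nat \<Rightarrow> complex vec \<Rightarrow> complex mat" where
  "vmat n m v = mat n m (\<lambda>(i, j). v $ (i * m + j))"

lemma vmat_carrier [simp]: "vmat n m v \<in> carrier_mat n m"
  by (simp add: vmat_def)

lemma dim_vmat [simp]: "dim_row (vmat n m v) = n" "dim_col (vmat n m v) = m"
  by (simp_all add: vmat_def)

lemma vmat_eqD:
  assumes eq: "vmat n m v = vmat n m w" and "v \<in> carrier_vec (n * m)" "w \<in> carrier_vec (n * m)"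
  shows "v = w"
proof (intro eq_vecI)
  fix i assume "i < dim_vec w"
  then have "i < n * m" using assms(3) by simp
  then have "i div m < n" "i mod m < m" by (auto simp: div_mod_less)
  then show "v $ i = w $ i"
    using arg_cong[OF eq, of "\<lambda>M. M $$ (i div m, i mod m)"] by (simp add: vmat_def)
qed (use assms in simp)

lemma vmat_smult:
  assumes "v \<in> carrier_vec (n * m)"
  shows "vmat n m (c \<cdot>\<^sub>v v) = c \<cdot>\<^sub>m vmat n m v"
  using assms by (intro eq_matI) (auto simp: vmat_def digits_less)

text \<open>The first party acts on the rows and the second on the columns of the coefficient
  matrix. The right factor is a transpose and not an adjoint because no conjugation is
  involved.\<close>

lemma vmat_tensor_apply:
  assumes A: "A \<in> carrier_mat n' n" and B: "B \<in> carrier_mat m' m" and v: "v \<in> carrier_vec (n * m)"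
  shows "vmat n' m' ((A \<otimes>\<^sub>m B) *\<^sub>v v) = A * vmat n m v * B\<^sup>T"
proof (intro eq_matI)
  fix i j
  assume "i < dim_row (A * vmat n m v * B\<^sup>T)" and "j < dim_col (A * vmat n m v * B\<^sup>T)"
  then have ij: "i < n'" "j < m'" using A B by auto
  have "vmat n' m' ((A \<otimes>\<^sub>m B) *\<^sub>v v) $$ (i, j)
      = (\<Sum>k<n * m. A $$ (i, k div m) * B $$ (j, k mod m) * v $ k)"
    using ij A B v by (simp add: vmat_def index_mult_mat_vec_sum[of _ _ "n * m"] digits_less
        del: index_mult_mat_vec)
  also have "\<dots> = (\<Sum>k<n * m. A $$ (i, k div m) * B $$ (j, k mod m)
      * vmat n m v $$ (k div m, k mod m))"
    by (intro sum.cong) (auto simp: vmat_def div_mod_less)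
  also have "\<dots> = (\<Sum>a<n. \<Sum>b<m. A $$ (i, a) * B $$ (j, b) * vmat n m v $$ (a, b))"
    by (rule sum_div_mod)
  also have "\<dots> = (\<Sum>b<m. \<Sum>a<n. A $$ (i, a) * B $$ (j, b) * vmat n m v $$ (a, b))"
    by (rule sum.swap)
  also have "\<dots> = (A * vmat n m v * B\<^sup>T) $$ (i, j)"
    using ij A B
    by (simp add: index_mult_sum[of _ _ _ _ m] index_mult_sum[of _ _ _ _ n] sum_distrib_right
        sum_distrib_left ac_simps del: index_mult_mat(1) assoc_mult_mat)
  finally show "vmat n' m' ((A \<otimes>\<^sub>m B) *\<^sub>v v) $$ (i, j) = (A * vmat n m v * B\<^sup>T) $$ (i, j)" .
qed (use A B in auto)

section \<open>Diagonal matrices, orthonormal bases and Schmidt decompositions\<close>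

definition dmat :: "nat \<Rightarrow> (nat \<Rightarrow> complex) \<Rightarrow> complex mat" where
  "dmat n b = mat n n (\<lambda>(i, j). if i = j then b i else 0)"

lemma dmat_carrier [simp]: "dmat n b \<in> carrier_mat n n"
  by (simp add: dmat_def)

lemma dim_dmat [simp]: "dim_row (dmat n b) = n" "dim_col (dmat n b) = n"
  by (simp_all add: dmat_def)

lemma index_dmat_mult:
  assumes "i < n" "j < dim_col A" "dim_row A = n"
  shows "(dmat n b * A) $$ (i, j) = b i * A $$ (i, j)"
  using assms
  by (simp add: index_mult_sum[of _ _ _ _ n] dmat_def if_distrib[of "\<lambda>x. x * _"] cong: if_cong
      del: index_mult_mat(1))

lemma index_mult_dmat:
  assumes "j < n" "i < dim_row A" "dim_col A = n"
  shows "(A * dmat n b) $$ (i, j) = A $$ (i, j) * b j"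
  using assms
  by (simp add: index_mult_sum[of _ _ _ _ n] dmat_def if_distrib[of "\<lambda>x. _ * x"] cong: if_cong
      del: index_mult_mat(1))

lemma dmat_mult: "dmat n a * dmat n b = dmat n (\<lambda>i. a i * b i)"
  by (intro eq_matI) (auto simp: index_dmat_mult simp del: index_mult_mat(1), auto simp: dmat_def)

lemma dmat_adjoint: "(dmat n a)\<^sup>\<dagger> = dmat n (\<lambda>i. cnj (a i))"
  by (intro eq_matI) (auto simp: dmat_def)

lemma dmat_const: "dmat n (\<lambda>_. c) = c \<cdot>\<^sub>m 1\<^sub>m n"
  by (intro eq_matI) (auto simp: dmat_def)

lemma dmat_smult: "c \<cdot>\<^sub>m dmat n a = dmat n (\<lambda>i. c * a i)"
  by (intro eq_matI) (auto simp: dmat_def)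

definition onb_mat :: "nat \<Rightarrow> (nat \<Rightarrow> complex vec) \<Rightarrow> complex mat" where
  "onb_mat n e = mat n n (\<lambda>(i, k). e k $ i)"

lemma onb_mat_carrier [simp]: "onb_mat n e \<in> carrier_mat n n"
  by (simp add: onb_mat_def)

lemma dim_onb_mat [simp]: "dim_row (onb_mat n e) = n" "dim_col (onb_mat n e) = n"
  by (simp_all add: onb_mat_def)

lemma unitary_onb_mat:
  assumes "onb n e"
  shows "unitary n (onb_mat n e)"
proof (rule unitary_if_left_inverse)
  show "(onb_mat n e)\<^sup>\<dagger> * onb_mat n e = 1\<^sub>m n"
  proof (intro eq_matI)
    fix k l assume "k < dim_row (1\<^sub>m n :: complex mat)" "l < dim_col (1\<^sub>m n :: complex mat)"
    then have kl: "k < n" "l < n" by auto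
    have dim: "dim_vec (e k) = n"
      using assms kl by (auto simp: onb_def)
    have "((onb_mat n e)\<^sup>\<dagger> * onb_mat n e) $$ (k, l) = (\<Sum>i<n. cnj (e k $ i) * e l $ i)"
      using kl by (simp add: index_mult_sum[of _ _ _ _ n] onb_mat_def del: index_mult_mat(1))
    also have "\<dots> = e l \<bullet>c e k"
      by (simp add: scalar_prod_def lessThan_atLeast0 mult.commute dim)
    finally show "((onb_mat n e)\<^sup>\<dagger> * onb_mat n e) $$ (k, l) = 1\<^sub>m n $$ (k, l)"
      using assms kl by (auto simp: onb_def)
  qed auto
qed simp

text \<open>The coefficient matrix of \<open>e k \<otimes>\<^sub>v f k\<close> is a column of one
  basis matrix times a transposed column of the other. Common Schmidt bases thus mean common outer
  factors, with only the diagonal middle factor depending on the state.\<close>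

lemma vmat_schmidt:
  assumes e: "onb n e" and f: "onb n f"
  shows "vec_sum (n * n) (\<lambda>k. b k \<cdot>\<^sub>v (e k \<otimes>\<^sub>v f k)) {..<n} \<in> carrier_vec (n * n)"
    and "vmat n n (vec_sum (n * n) (\<lambda>k. b k \<cdot>\<^sub>v (e k \<otimes>\<^sub>v f k)) {..<n})
      = onb_mat n e * dmat n b * (onb_mat n f)\<^sup>T"
proof -
  have dim: "dim_vec (e k) = n" "dim_vec (f k) = n" if "k < n" for k
    using e f that by (auto simp: onb_def)
  have c: "(\<lambda>k. b k \<cdot>\<^sub>v (e k \<otimes>\<^sub>v f k)) \<in> {..<n} \<rightarrow> carrier_vec (n * n)"
    by (auto intro!: carrier_vecI simp: tensor_vec_def dim)
  show "vec_sum (n * n) (\<lambda>k. b k \<cdot>\<^sub>v (e k \<otimes>\<^sub>v f k)) {..<n} \<in> carrier_vec (n * n)"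
    using c by (rule finsum_vec_closed)
  show "vmat n n (vec_sum (n * n) (\<lambda>k. b k \<cdot>\<^sub>v (e k \<otimes>\<^sub>v f k)) {..<n})
      = onb_mat n e * dmat n b * (onb_mat n f)\<^sup>T"
  proof (intro eq_matI)
    fix i j
    assume "i < dim_row (onb_mat n e * dmat n b * (onb_mat n f)\<^sup>T)"
      and "j < dim_col (onb_mat n e * dmat n b * (onb_mat n f)\<^sup>T)"
    then have ij: "i < n" "j < n" by auto
    have "vmat n n (vec_sum (n * n) (\<lambda>k. b k \<cdot>\<^sub>v (e k \<otimes>\<^sub>v f k)) {..<n}) $$ (i, j)
        = (\<Sum>k<n. (b k \<cdot>\<^sub>v (e k \<otimes>\<^sub>v f k)) $ (i * n + j))"
      using ij c by (simp add: vmat_def index_finsum_vec digits_less)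
    also have "\<dots> = (\<Sum>k<n. e k $ i * b k * f k $ j)"
      using ij by (intro sum.cong) (auto simp: tensor_vec_def dim digits_less)
    also have "\<dots> = (onb_mat n e * dmat n b * (onb_mat n f)\<^sup>T) $$ (i, j)"
      using ij by (simp add: index_mult_sum[of i "onb_mat n e * dmat n b" j _ n] index_mult_dmat
          del: index_mult_mat(1) assoc_mult_mat) (simp add: onb_mat_def)
    finally show "vmat n n (vec_sum (n * n) (\<lambda>k. b k \<cdot>\<^sub>v (e k \<otimes>\<^sub>v f k)) {..<n}) $$ (i, j)
      = (onb_mat n e * dmat n b * (onb_mat n f)\<^sup>T) $$ (i, j)" .
  qed auto
qed

lemma vmat_diag_state:
  assumes e: "onb n e" and f: "onb n f"
  shows "diag_state n e f \<in> carrier_vec (n * n)"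
    and "vmat n n (diag_state n e f)
      = complex_of_real (1 / sqrt (real n)) \<cdot>\<^sub>m (onb_mat n e * (onb_mat n f)\<^sup>T)"
proof -
  note s = vmat_schmidt[OF e f, of "\<lambda>_. 1", simplified]
  show "diag_state n e f \<in> carrier_vec (n * n)"
    unfolding diag_state_def using s(1) by simp
  have "dmat n (\<lambda>_. 1) = 1\<^sub>m n" by (simp add: dmat_const one_smult_mat)
  then show "vmat n n (diag_state n e f)
      = complex_of_real (1 / sqrt (real n)) \<cdot>\<^sub>m (onb_mat n e * (onb_mat n f)\<^sup>T)"
    unfolding diag_state_def using s by (simp add: vmat_smult)
qed

section \<open>Clock and shift matrices\<close>

lemma root_unity_eq_cis: "root_unity n = cis (2 * pi / real n)"
  by (simp add: root_unity_def cis_conv_exp ac_simps)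

lemma root_unity_power: "root_unity n ^ k = cis (2 * pi * real k / real n)"
  by (simp add: root_unity_eq_cis DeMoivre mult.commute)

lemma cmod_root_unity [simp]: "cmod (root_unity n) = 1"
  by (simp add: root_unity_eq_cis)

lemma root_unity_nonzero [simp]: "root_unity n \<noteq> 0"
  using cmod_root_unity[of n] by (metis norm_zero zero_neq_one)

lemma root_unity_power_self [simp]: "n > 0 \<Longrightarrow> root_unity n ^ n = 1"
  by (simp add: root_unity_power)

lemma root_unity_power_mod: "n > 0 \<Longrightarrow> root_unity n ^ (k mod n) = root_unity n ^ k"
  by (metis div_mult_mod_eq mult.commute mult_1 power_add power_mult power_one root_unity_power_self)

lemma root_unity_power_inj:
  assumes "n > 0" and "root_unity n ^ k = root_unity n ^ l"
  shows "k mod n = l mod n"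
proof -
  have "inj_on (\<lambda>k. root_unity n ^ k) {..<n}"
    using bij_betw_roots_unity[OF \<open>n > 0\<close>] by (simp add: root_unity_power bij_betw_def)
  moreover have "root_unity n ^ (k mod n) = root_unity n ^ (l mod n)"
    using assms by (simp add: root_unity_power_mod)
  ultimately show ?thesis
    using \<open>n > 0\<close> by (auto dest: inj_onD)
qed

lemma root_unity_power_eq_iff:
  "n > 0 \<Longrightarrow> root_unity n ^ k = root_unity n ^ l \<longleftrightarrow> k mod n = l mod n"
  using root_unity_power_inj root_unity_power_mod by metis

lemma bij_betw_root_unity:
  "n > 0 \<Longrightarrow> bij_betw (\<lambda>k. root_unity n ^ k) {..<n} {z. z ^ n = 1}"
  using bij_betw_roots_unity by (simp add: root_unity_power)

lemma sum_power_root_of_unity: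
  fixes z :: complex
  assumes "z ^ n = 1"
  shows "(\<Sum>i<n. z ^ i) = (if z = 1 then of_nat n else 0)"
  using assms by (auto simp: sum_gp_strict)

lemma sum_root_unity_power:
  assumes "n > 0"
  shows "(\<Sum>i<n. root_unity n ^ (i * k)) = (if n dvd k then of_nat n else 0)"
proof -
  have "(root_unity n ^ k) ^ n = 1"
    using assms by (metis mult.commute power_mult power_one root_unity_power_self)
  then have "(\<Sum>i<n. (root_unity n ^ k) ^ i) = (if root_unity n ^ k = 1 then of_nat n else 0)"
    by (rule sum_power_root_of_unity)
  moreover have "root_unity n ^ k = 1 \<longleftrightarrow> n dvd k"
    using root_unity_power_eq_iff[OF assms, of k 0] by (simp add: dvd_eq_mod_eq_0)
  ultimately show ?thesis
    by (simp add: power_mult[symmetric] mult.commute)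
qed

text \<open>The \<open>a\<close>-th power of \<open>Z\<close> in coordinates, see
  \<open>clock_power\<close>. The explicit exponent turns products and reduction modulo
  \<open>n\<close> into arithmetic.\<close>

definition clock :: "nat \<Rightarrow> nat \<Rightarrow> complex mat" where
  "clock n a = dmat n (\<lambda>k. root_unity n ^ (a * k))"

text \<open>The orientation is that of \<open>X\<close>: basis vector \<open>s k\<close> is sent to
  basis vector \<open>k\<close>, and multiplication from the left reads row
  \<open>s k\<close>.\<close>

definition permutation_mat :: "nat \<Rightarrow> (nat \<Rightarrow> nat) \<Rightarrow> complex mat" where
  "permutation_mat n s = mat n n (\<lambda>(k, l). if l = s k then 1 else 0)"

lemma permutation_mat_carrier [simp]: "permutation_mat n s \<in> carrier_mat n n"
  by (simp add: permutation_mat_def)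

lemma dim_permutation_mat [simp]:
  "dim_row (permutation_mat n s) = n" "dim_col (permutation_mat n s) = n"
  by (simp_all add: permutation_mat_def)

lemma index_permutation_mult:
  assumes "k < n" "l < dim_col A" "dim_row A = n" "s k < n"
  shows "(permutation_mat n s * A) $$ (k, l) = A $$ (s k, l)"
  using assms
  by (simp add: index_mult_sum[of _ _ _ _ n] permutation_mat_def if_distrib[of "\<lambda>x. x * _"]
      cong: if_cong del: index_mult_mat(1))

lemma unitary_permutation_mat:
  assumes inj: "inj_on s {..<n}" and into: "\<And>k. k < n \<Longrightarrow> s k < n"
  shows "unitary n (permutation_mat n s)"
proof -
  let ?P = "permutation_mat n s"
  have "?P * ?P\<^sup>\<dagger> = 1\<^sub>m n"
  proof (intro eq_matI)
    fix k l assume "k < dim_row (1\<^sub>m n :: complex mat)" "l < dim_col (1\<^sub>m n :: complex mat)"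
    then have kl: "k < n" "l < n" by auto
    have "(?P * ?P\<^sup>\<dagger>) $$ (k, l) = ?P\<^sup>\<dagger> $$ (s k, l)"
      using kl into by (intro index_permutation_mult) auto
    also have "\<dots> = (if s k = s l then 1 else 0)"
      using kl into by (simp add: permutation_mat_def)
    also have "s k = s l \<longleftrightarrow> k = l"
      using inj kl by (auto dest: inj_onD)
    finally show "(?P * ?P\<^sup>\<dagger>) $$ (k, l) = 1\<^sub>m n $$ (k, l)"
      using kl by simp
  qed auto
  then have "unitary n ?P\<^sup>\<dagger>"
    by (intro unitary_if_left_inverse) simp_all
  from unitary_adjoint[OF this] show ?thesis by simp
qed

definition shift :: "nat \<Rightarrow> nat \<Rightarrow> complex mat" where
  "shift n b = permutation_mat n (\<lambda>k. (k + b) mod n)"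

lemma shift_eq: "shift n b = mat n n (\<lambda>(k, l). if l = (k + b) mod n then 1 else 0)"
  by (simp add: shift_def permutation_mat_def)

lemma clock_carrier [simp]: "clock n a \<in> carrier_mat n n"
  by (simp add: clock_def)

lemma dim_clock [simp]: "dim_row (clock n a) = n" "dim_col (clock n a) = n"
  by (simp_all add: clock_def)

lemma shift_carrier [simp]: "shift n b \<in> carrier_mat n n"
  by (simp add: shift_def)

lemma dim_shift [simp]: "dim_row (shift n b) = n" "dim_col (shift n b) = n"
  by (simp_all add: shift_def)

lemma clock_mult: "clock n a * clock n b = clock n (a + b)"
  by (simp add: clock_def dmat_mult add_mult_distrib power_add)

lemma clock_0: "clock n 0 = 1\<^sub>m n"
  by (simp add: clock_def dmat_const one_smult_mat)

lemma clock_mod: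
  assumes "n > 0"
  shows "clock n (a mod n) = clock n a"
proof -
  have "root_unity n ^ (a mod n * k) = root_unity n ^ (a * k)" for k
    using assms by (simp add: root_unity_power_eq_iff mod_mult_left_eq)
  then show ?thesis by (simp add: clock_def)
qed

lemma shift_0: "shift n 0 = 1\<^sub>m n"
  by (intro eq_matI) (auto simp: shift_eq)

lemma index_shift_mult:
  assumes "k < n" "l < dim_col A" "dim_row A = n"
  shows "(shift n b * A) $$ (k, l) = A $$ ((k + b) mod n, l)"
  unfolding shift_def using assms by (intro index_permutation_mult) auto

lemma shift_mult: "shift n a * shift n b = shift n (a + b)"
  by (intro eq_matI) (auto simp: index_shift_mult mod_add_left_eq add.assoc simp del: index_mult_mat(1),
      auto simp: shift_eq mod_add_left_eq add.assoc)

lemma power_conj: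
  assumes "unitary n Y" and "A \<in> carrier_mat n n"
  shows "(Y * A * Y\<^sup>\<dagger>) ^\<^sub>m k = Y * A ^\<^sub>m k * Y\<^sup>\<dagger>"
  using assms unitaryD[OF assms(1)]
  by (intro similar_mat_wit_pow_id) (auto simp: similar_mat_wit_def Let_def)

lemma clock_power: "clock n 1 ^\<^sub>m a = clock n a"
  by (induction a) (simp_all add: clock_0 clock_mult)

lemma shift_power: "shift n 1 ^\<^sub>m a = shift n a"
  by (induction a) (simp_all add: shift_0 shift_mult)

lemma Z_op_eq:
  assumes "onb n g"
  shows "Z_op n g = onb_mat n g * clock n 1 * (onb_mat n g)\<^sup>\<dagger>"
proof (intro eq_matI)
  fix i j
  assume "i < dim_row (onb_mat n g * clock n 1 * (onb_mat n g)\<^sup>\<dagger>)"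
    and "j < dim_col (onb_mat n g * clock n 1 * (onb_mat n g)\<^sup>\<dagger>)"
  then have ij: "i < n" "j < n" by auto
  have dim: "dim_vec (g k) = n" if "k < n" for k
    using assms that by (auto simp: onb_def)
  have "Z_op n g $$ (i, j) = (\<Sum>k<n. g k $ i * root_unity n ^ k * cnj (g k $ j))"
    using ij by (simp add: Z_op_def mat_sum_def ketbra_def dim ac_simps)
  also have "\<dots> = (onb_mat n g * clock n 1 * (onb_mat n g)\<^sup>\<dagger>) $$ (i, j)"
    using ij unfolding clock_def
    by (simp add: index_mult_sum[of i "onb_mat n g * dmat n _" j _ n] index_mult_dmat
        del: index_mult_mat(1) assoc_mult_mat) (simp add: onb_mat_def)
  finally show "Z_op n g $$ (i, j) = (onb_mat n g * clock n 1 * (onb_mat n g)\<^sup>\<dagger>) $$ (i, j)" .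
qed (auto simp: Z_op_def mat_sum_def)

lemma X_op_eq:
  assumes "onb n g"
  shows "X_op n g = onb_mat n g * shift n 1 * (onb_mat n g)\<^sup>\<dagger>"
proof -
  have "X_op n g = onb_mat n g * (shift n 1 * (onb_mat n g)\<^sup>\<dagger>)"
  proof (intro eq_matI)
    fix i j
    assume "i < dim_row (onb_mat n g * (shift n 1 * (onb_mat n g)\<^sup>\<dagger>))"
      and "j < dim_col (onb_mat n g * (shift n 1 * (onb_mat n g)\<^sup>\<dagger>))"
    then have ij: "i < n" "j < n" by auto
    have dim: "dim_vec (g k) = n" if "k < n" for k
      using assms that by (auto simp: onb_def)
    have "X_op n g $$ (i, j) = (\<Sum>k<n. g k $ i * cnj (g ((k + 1) mod n) $ j))"
      using ij by (simp add: X_op_def mat_sum_def ketbra_def dim)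
    also have "\<dots> = (onb_mat n g * (shift n 1 * (onb_mat n g)\<^sup>\<dagger>)) $$ (i, j)"
      using ij by (simp add: index_mult_sum[of i "onb_mat n g" j _ n] index_shift_mult
          del: index_mult_mat(1)) (simp add: onb_mat_def)
    finally show "X_op n g $$ (i, j) = (onb_mat n g * (shift n 1 * (onb_mat n g)\<^sup>\<dagger>)) $$ (i, j)" .
  qed (auto simp: X_op_def mat_sum_def)
  then show ?thesis
    by (simp add: mult_assoc_dim)
qed

text \<open>\<open>Z^a X^b\<close> acts on the first factor only, hence multiplies the coefficient
  matrix of \<open>diag_state\<close> from the left. The change of basis to \<open>g\<close> cancels
  against the factor \<open>onb_mat n g\<close> of that matrix.\<close>

lemma vmat_bell_state:
  assumes g: "onb n g" and h: "onb n h"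
  shows "bell_state n g h a b \<in> carrier_vec (n * n)"
    and "vmat n n (bell_state n g h a b) = complex_of_real (1 / sqrt (real n)) \<cdot>\<^sub>m
      (onb_mat n g * (clock n a * shift n b) * (onb_mat n h)\<^sup>T)"
proof -
  note Y = unitary_onb_mat[OF g]
  let ?Y = "onb_mat n g"
  have ZX: "Z_op n g ^\<^sub>m a * X_op n g ^\<^sub>m b = ?Y * (clock n a * shift n b) * ?Y\<^sup>\<dagger>"
    unfolding Z_op_eq[OF g] X_op_eq[OF g] power_conj[OF Y clock_carrier] power_conj[OF Y shift_carrier]
      clock_power shift_power
    by (simp add: mult_assoc_dim unitary_cancel[OF Y])
  have c: "?Y * (clock n a * shift n b) * ?Y\<^sup>\<dagger> \<in> carrier_mat n n"
    by (intro carrier_matI) auto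
  show "bell_state n g h a b \<in> carrier_vec (n * n)"
    unfolding bell_state_def ZX by (intro carrier_vecI) simp
  show "vmat n n (bell_state n g h a b) = complex_of_real (1 / sqrt (real n)) \<cdot>\<^sub>m
      (?Y * (clock n a * shift n b) * (onb_mat n h)\<^sup>T)"
    unfolding bell_state_def ZX
      vmat_tensor_apply[OF c one_carrier_mat vmat_diag_state(1)[OF g h]] vmat_diag_state(2)[OF g h]
    by (simp add: mult_assoc_dim smult_mult_right smult_mult_left unitary_cancel[OF Y])
qed

section \<open>Regrouping four tensor factors into those of Alice and those of Bob\<close>

definition regroup_vec :: "nat \<Rightarrow> complex vec \<Rightarrow> complex vec" where
  "regroup_vec n v = vec ((n * n) * (n * n)) (\<lambda>i. v $ swap_mid n i)"

lemma regroup_vec_carrier [simp]: "regroup_vec n v \<in> carrier_vec ((n * n) * (n * n))"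
  by (simp add: regroup_vec_def)

lemma swap_mid_digits:
  assumes "i1 < n" "i2 < n" "i3 < n" "i4 < n"
  shows "swap_mid n ((i1 * n + i3) * (n * n) + (i2 * n + i4)) = (i1 * n + i2) * (n * n) + (i3 * n + i4)"
proof -
  let ?i = "(i1 * n + i3) * (n * n) + (i2 * n + i4)"
  have eq: "?i = ((i1 * n + i3) * n + i2) * n + i4"
    by (simp add: algebra_simps)
  have n: "n > 0" using assms by simp
  have 1: "?i div n = (i1 * n + i3) * n + i2" "?i mod n = i4"
    unfolding eq using assms by auto
  have m: "((i1 * n + i3) * n + i2) mod n = i2" "(i1 * n + i3) mod n = i3"
    using assms by auto
  have 2: "?i div n ^ 2 = i1 * n + i3" "?i div n ^ 3 = i1"
    using 1 assms by (auto simp: power2_eq_square power3_eq_cube div_mult2_eq)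
  show ?thesis
    unfolding swap_mid_def Let_def 2 1 m by (simp add: algebra_simps)
qed

lemma swap_mid_less:
  assumes "i < (n * n) * (n * n)"
  shows "swap_mid n i < (n * n) * (n * n)"
proof -
  let ?r = "i div (n * n)" and ?c = "i mod (n * n)"
  have rc: "?r < n * n" "?c < n * n" using div_mod_less[OF assms] by auto
  have d: "?r div n < n" "?r mod n < n" "?c div n < n" "?c mod n < n"
    using div_mod_less[OF rc(1)] div_mod_less[OF rc(2)] by auto
  have "swap_mid n i = swap_mid n ((?r div n * n + ?r mod n) * (n * n) + (?c div n * n + ?c mod n))"
    by (simp only: div_mult_mod_eq)
  also have "\<dots> = (?r div n * n + ?c div n) * (n * n) + (?r mod n * n + ?c mod n)"
    by (rule swap_mid_digits) (rule d)+
  also have "\<dots> < (n * n) * (n * n)"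
    by (intro digits_less d)
  finally show ?thesis .
qed

lemma regroup_ketbra:
  assumes "v \<in> carrier_vec (n * n)" and "w \<in> carrier_vec (n * n)"
  shows "regroup n (ketbra v v \<otimes>\<^sub>m ketbra w w)
    = ketbra (regroup_vec n (v \<otimes>\<^sub>v w)) (regroup_vec n (v \<otimes>\<^sub>v w))"
proof -
  have d: "dim_vec v = n * n" "dim_vec w = n * n" using assms by auto
  have "swap_mid n i div (n * n) < n * n" "swap_mid n i mod (n * n) < n * n"
    if "i < (n * n) * (n * n)" for i
    using div_mod_less[OF swap_mid_less[OF that]] by auto
  then show ?thesis
    by (intro eq_matI) (auto simp: regroup_def regroup_vec_def ketbra_def tensor_vec_def d
        swap_mid_less)
qed

text \<open>After regrouping, the digits \<open>i1 i3\<close> of Alice form the row and the digits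
  \<open>i2 i4\<close> of Bob the column, which is the index pattern of a Kronecker product. Copying
  thereby becomes an equation between tensor products of coefficient matrices.\<close>

lemma vmat_regroup_vec:
  assumes "v \<in> carrier_vec (n * n)" and "w \<in> carrier_vec (n * n)"
  shows "vmat (n * n) (n * n) (regroup_vec n (v \<otimes>\<^sub>v w)) = vmat n n v \<otimes>\<^sub>m vmat n n w"
proof (intro eq_matI)
  fix r c assume "r < dim_row (vmat n n v \<otimes>\<^sub>m vmat n n w)" "c < dim_col (vmat n n v \<otimes>\<^sub>m vmat n n w)"
  then have rc: "r < n * n" "c < n * n" by auto
  then have d: "r div n < n" "r mod n < n" "c div n < n" "c mod n < n"
    using div_mod_less[OF rc(1)] div_mod_less[OF rc(2)] by auto
  let ?k = "(r div n * n + c div n) * (n * n) + (r mod n * n + c mod n)"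
  have k: "?k < (n * n) * (n * n)"
    by (intro digits_less d)
  have nn: "n * n \<noteq> 0" using rc(1) by (metis less_nat_zero_code)
  have k2: "?k div (n * n) = r div n * n + c div n" "?k mod (n * n) = r mod n * n + c mod n"
    using digits_less[OF d(2,4)] unfolding div_mult_self3[OF nn] mod_mult_self3 by auto
  have "vmat (n * n) (n * n) (regroup_vec n (v \<otimes>\<^sub>v w)) $$ (r, c)
      = (v \<otimes>\<^sub>v w) $ swap_mid n (r * (n * n) + c)"
    using rc by (simp add: vmat_def regroup_vec_def digits_less)
  also have "r * (n * n) + c = (r div n * n + r mod n) * (n * n) + (c div n * n + c mod n)"
    by simp
  also have "swap_mid n \<dots> = ?k"
    by (rule swap_mid_digits) (rule d)+
  also have "(v \<otimes>\<^sub>v w) $ ?k = v $ (?k div (n * n)) * w $ (?k mod (n * n))"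
    using assms k by (simp add: tensor_vec_def)
  also have "\<dots> = (vmat n n v \<otimes>\<^sub>m vmat n n w) $$ (r, c)"
    unfolding k2 using rc d by (simp add: vmat_def)
  finally show "vmat (n * n) (n * n) (regroup_vec n (v \<otimes>\<^sub>v w)) $$ (r, c)
      = (vmat n n v \<otimes>\<^sub>m vmat n n w) $$ (r, c)" .
qed auto

section \<open>Unitary groups with sparse traces\<close>

lemma unitary_inner:
  assumes U: "unitary n U" and v: "v \<in> carrier_vec n" and w: "w \<in> carrier_vec n"
  shows "(U *\<^sub>v v) \<bullet>c (U *\<^sub>v w) = v \<bullet>c w"
proof -
  have UU: "(\<Sum>i<n. cnj (U $$ (i, l)) * U $$ (i, k)) = (if l = k then 1 else 0)"
    if "k < n" "l < n" for k l
  proof -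
    have "(U\<^sup>\<dagger> * U) $$ (l, k) = (\<Sum>i<n. cnj (U $$ (i, l)) * U $$ (i, k))"
      using that unitaryD(1)[OF U]
      by (simp add: index_mult_sum[of _ _ _ _ n] del: index_mult_mat(1))
    then show ?thesis
      using that unitaryD(4)[OF U] by simp
  qed
  have "(U *\<^sub>v v) \<bullet>c (U *\<^sub>v w)
      = (\<Sum>i<n. (\<Sum>k<n. U $$ (i, k) * v $ k) * cnj (\<Sum>l<n. U $$ (i, l) * w $ l))"
    using unitaryD(1)[OF U] v w
    by (simp add: scalar_prod_def lessThan_atLeast0)
  also have "\<dots> = (\<Sum>i<n. \<Sum>k<n. \<Sum>l<n. v $ k * cnj (w $ l) * (cnj (U $$ (i, l)) * U $$ (i, k)))"
    by (simp add: sum_product ac_simps)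
  also have "\<dots> = (\<Sum>k<n. \<Sum>i<n. \<Sum>l<n. v $ k * cnj (w $ l) * (cnj (U $$ (i, l)) * U $$ (i, k)))"
    by (rule sum.swap)
  also have "\<dots> = (\<Sum>k<n. \<Sum>l<n. v $ k * cnj (w $ l) * (\<Sum>i<n. cnj (U $$ (i, l)) * U $$ (i, k)))"
    by (rule sum.cong[OF refl], subst sum.swap) (simp add: sum_distrib_left)
  also have "\<dots> = (\<Sum>k<n. \<Sum>l<n. v $ k * cnj (w $ l) * (if l = k then 1 else 0))"
    by (intro sum.cong refl) (simp add: UU)
  also have "\<dots> = v \<bullet>c w"
    using v w by (simp add: scalar_prod_def lessThan_atLeast0 if_distrib cong: if_cong)
  finally show ?thesis .
qed

lemma cinner_self:
  "(v :: complex vec) \<bullet>c v = complex_of_real (\<Sum>i<dim_vec v. (cmod (v $ i))\<^sup>2)"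
  by (simp add: scalar_prod_def lessThan_atLeast0 complex_norm_square del: of_real_power)

lemma cinner_smult:
  fixes v w :: "complex vec"
  assumes "dim_vec v = dim_vec w"
  shows "(a \<cdot>\<^sub>v v) \<bullet>c (b \<cdot>\<^sub>v w) = a * cnj b * (v \<bullet>c w)"
  using assms by (simp add: scalar_prod_def sum_distrib_left ac_simps)

lemma normalize_vec:
  fixes v :: "complex vec"
  assumes "v \<in> carrier_vec n" and "v \<noteq> 0\<^sub>v n"
  obtains r where "r \<noteq> 0" "(r \<cdot>\<^sub>v v) \<bullet>c (r \<cdot>\<^sub>v v) = 1"
proof -
  define s where "s = (\<Sum>i<dim_vec v. (cmod (v $ i))\<^sup>2)"
  have vv: "v \<bullet>c v = complex_of_real s"
    unfolding s_def by (rule cinner_self)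
  have "s \<noteq> 0"
    using vv assms by (metis conjugate_square_eq_0_vec of_real_0)
  moreover have "s \<ge> 0"
    unfolding s_def by (intro sum_nonneg) auto
  ultimately have s: "s > 0" by simp
  define r where "r = complex_of_real (1 / sqrt s)"
  have "r * cnj r * complex_of_real s = 1"
    using s by (simp add: r_def flip: of_real_mult)
  then have "(r \<cdot>\<^sub>v v) \<bullet>c (r \<cdot>\<^sub>v v) = 1"
    by (simp only: cinner_smult[OF refl] vv)
  moreover have "r \<noteq> 0" using s by (simp add: r_def)
  ultimately show thesis using that by blast
qed

text \<open>The inner product is preserved, yet also multiplied by \<open>a * cnj b\<close>. The
  condition is not \<open>a \<noteq> b\<close>, so that the case \<open>v = w\<close> can show that
  eigenvalues are unimodular.\<close>

lemma unitary_eigenvector_orthogonal: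
  assumes U: "unitary n U" and v: "v \<in> carrier_vec n" and w: "w \<in> carrier_vec n"
    and eig: "U *\<^sub>v v = a \<cdot>\<^sub>v v" "U *\<^sub>v w = b \<cdot>\<^sub>v w" and ne: "a * cnj b \<noteq> 1"
  shows "v \<bullet>c w = 0"
proof -
  have "v \<bullet>c w = a * cnj b * (v \<bullet>c w)"
    using unitary_inner[OF U v w] v w unfolding eig by (simp only: cinner_smult carrier_vecD)
  with ne show ?thesis by simp
qed

lemma unitary_eigenvalue_norm:
  assumes U: "unitary n U" and "eigenvalue U a"
  shows "cmod a = 1"
proof -
  obtain v where v: "v \<in> carrier_vec n" "v \<noteq> 0\<^sub>v n" and eig: "U *\<^sub>v v = a \<cdot>\<^sub>v v"
    using assms unitaryD[OF U] by (auto simp: eigenvalue_def eigenvector_def)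
  have "a * cnj a = 1"
    using unitary_eigenvector_orthogonal[OF U v(1) v(1) eig eig] v conjugate_square_eq_0_vec
    by blast
  then have "(cmod a)\<^sup>2 = 1"
    by (metis complex_norm_square of_real_eq_1_iff)
  then show ?thesis
    using norm_ge_zero[of a] unfolding power2_eq_1_iff by linarith
qed

lemma upper_triangular_mult:
  fixes A B :: "complex mat"
  assumes A: "A \<in> carrier_mat n n" "upper_triangular A" and B: "B \<in> carrier_mat n n" "upper_triangular B"
  shows "upper_triangular (A * B)" and "i < n \<Longrightarrow> (A * B) $$ (i, i) = A $$ (i, i) * B $$ (i, i)"
proof -
  have A0: "A $$ (i, j) = 0" if "j < i" "i < n" for i j
    using A that by auto
  have B0: "B $$ (i, j) = 0" if "j < i" "i < n" for i j
    using B that by auto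
  have AB: "(A * B) $$ (i, j) = (\<Sum>k<n. A $$ (i, k) * B $$ (k, j))" if "i < n" "j < n" for i j
    using A B that by (intro index_mult_sum) auto
  show "upper_triangular (A * B)"
  proof (intro upper_triangularI)
    fix i j assume ij: "j < i" "i < dim_row (A * B)"
    then have "i < n" "j < n" using A by auto
    moreover have "A $$ (i, k) * B $$ (k, j) = 0" if "k < n" for k
      using A0[of k i] B0[of j k] ij \<open>i < n\<close> that by (cases "k < i") auto
    ultimately show "(A * B) $$ (i, j) = 0"
      by (simp only: AB) (auto intro!: sum.neutral)
  qed
  show "(A * B) $$ (i, i) = A $$ (i, i) * B $$ (i, i)" if "i < n"
  proof -
    have "A $$ (i, k) * B $$ (k, i) = (if k = i then A $$ (i, i) * B $$ (i, i) else 0)"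
      if "k < n" for k
      using A0[of k i] B0[of i k] \<open>i < n\<close> that by (cases k i rule: linorder_cases) auto
    then have "(A * B) $$ (i, i) = (\<Sum>k<n. if k = i then A $$ (i, i) * B $$ (i, i) else 0)"
      unfolding AB[OF that that] by (intro sum.cong) auto
    then show ?thesis
      using that by (simp del: index_mult_mat)
  qed
qed

text \<open>Turns traces of powers of a Schur form into power sums of its diagonal.\<close>

lemma upper_triangular_power:
  fixes A :: "complex mat"
  assumes A: "A \<in> carrier_mat n n" "upper_triangular A"
  shows "upper_triangular (A ^\<^sub>m k)" and "i < n \<Longrightarrow> (A ^\<^sub>m k) $$ (i, i) = (A $$ (i, i)) ^ k"
proof -
  have "upper_triangular (A ^\<^sub>m k) \<and> (\<forall>i<n. (A ^\<^sub>m k) $$ (i, i) = (A $$ (i, i)) ^ k)"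
  proof (induction k)
    case 0
    then show ?case using A by auto
  next
    case (Suc k)
    then show ?case
      using upper_triangular_mult[OF pow_carrier_mat[OF A(1), of k] _ A]
      by (auto simp: mult.commute)
  qed
  then show "upper_triangular (A ^\<^sub>m k)" and "i < n \<Longrightarrow> (A ^\<^sub>m k) $$ (i, i) = (A $$ (i, i)) ^ k"
    by auto
qed

text \<open>Let \<open>p\<close> be the monic polynomial with roots \<open>x i\<close>. Summing
  \<open>p (x i) = 0\<close> over \<open>i\<close> gives a combination of power sums; if those of
  positive degree vanished, only \<open>n * p 0\<close> would remain, which is nonzero. For
  eigenvalues this yields a power with nonzero trace.\<close>

lemma ex_power_sum_nonzero:
  fixes x :: "nat \<Rightarrow> complex"
  assumes "n > 0" and "\<And>i. i < n \<Longrightarrow> x i \<noteq> 0"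
  shows "\<exists>k>0. (\<Sum>i<n. x i ^ k) \<noteq> 0"
proof (rule ccontr)
  assume "\<not> ?thesis"
  then have zero: "(\<Sum>i<n. x i ^ k) = 0" if "k > 0" for k
    using that by blast
  define p where "p = (\<Prod>i<n. [:- x i, 1:])"
  have "(\<Sum>i<n. poly p (x i)) = 0"
    using assms(1) by (intro sum.neutral) (auto simp: p_def poly_prod)
  moreover have "(\<Sum>i<n. poly p (x i)) = (\<Sum>k\<le>degree p. coeff p k * (\<Sum>i<n. x i ^ k))"
    unfolding poly_altdef by (subst sum.swap) (simp add: sum_distrib_left)
  moreover have "\<dots> = coeff p 0 * of_nat n"
  proof -
    have "(\<Sum>k\<le>degree p. coeff p k * (\<Sum>i<n. x i ^ k))
        = (\<Sum>k\<in>{0}. coeff p k * (\<Sum>i<n. x i ^ k))"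
      by (rule sum.mono_neutral_right) (use zero in auto)
    then show ?thesis by simp
  qed
  moreover have "coeff p 0 = (\<Prod>i<n. - x i)"
    by (simp add: p_def poly_prod flip: poly_0_coeff_0)
  ultimately show False
    using assms by simp
qed

lemma eq_if_mult_cnj_eq_one:
  assumes "x * cnj y = 1" and "cmod y = 1"
  shows "x = y"
proof -
  have "y * cnj y = 1"
    using assms(2) by (simp flip: complex_norm_square)
  then have "x = x * cnj y * y"
    by (simp add: mult.commute mult.assoc)
  then show ?thesis using assms(1) by simp
qed

text \<open>The common abstraction of \<open>copy_group\<close> and \<open>weyl_group\<close>, so
  that the structure theory serves both directions. Closure under phases allows normalizing an
  element that is only a multiple of a clock matrix. The last assumption is the trace
  dichotomy.\<close>

locale trace_group =
  fixes n :: nat and G :: "complex mat set"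
  assumes prime: "prime n"
    and unitary: "P \<in> G \<Longrightarrow> unitary n P"
    and one: "1\<^sub>m n \<in> G"
    and mult: "P \<in> G \<Longrightarrow> Q \<in> G \<Longrightarrow> P * Q \<in> G"
    and adjoint: "P \<in> G \<Longrightarrow> P\<^sup>\<dagger> \<in> G"
    and smult: "P \<in> G \<Longrightarrow> cmod c = 1 \<Longrightarrow> c \<cdot>\<^sub>m P \<in> G"
    and mtrace: "P \<in> G \<Longrightarrow> mtrace P \<noteq> 0 \<Longrightarrow> \<exists>c. cmod c = 1 \<and> P = c \<cdot>\<^sub>m 1\<^sub>m n"
begin

lemma n_pos: "n > 0"
  using prime by (rule prime_gt_0_nat)

lemma G_carrier: "P \<in> G \<Longrightarrow> P \<in> carrier_mat n n" "P \<in> G \<Longrightarrow> dim_row P = n" "P \<in> G \<Longrightarrow> dim_col P = n"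
  using unitary unitaryD by blast+

lemma power: "P \<in> G \<Longrightarrow> P ^\<^sub>m k \<in> G"
  by (induction k) (auto simp: G_carrier one mult)

text \<open>The assumptions do not depend on the basis, so one nonscalar element may be brought into
  clock form without losing the others.\<close>

lemma conj_trace_group:
  assumes X: "unitary n X"
  shows "trace_group n ((\<lambda>P. X\<^sup>\<dagger> * P * X) ` G)"
proof
  note XD = unitaryD[OF X]
  note c = G_carrier
  show "prime n" by (rule prime)
  show "unitary n P" if "P \<in> (\<lambda>P. X\<^sup>\<dagger> * P * X) ` G" for P
    using that X unitary by (auto intro!: unitary_mult unitary_adjoint)
  show "1\<^sub>m n \<in> (\<lambda>P. X\<^sup>\<dagger> * P * X) ` G"
    using one XD by (auto intro!: image_eqI[of _ _ "1\<^sub>m n"])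
  show "P * Q \<in> (\<lambda>P. X\<^sup>\<dagger> * P * X) ` G"
    if asm: "P \<in> (\<lambda>P. X\<^sup>\<dagger> * P * X) ` G" "Q \<in> (\<lambda>P. X\<^sup>\<dagger> * P * X) ` G" for P Q
  proof -
    obtain P' Q' where PQ: "P' \<in> G" "Q' \<in> G" "P = X\<^sup>\<dagger> * P' * X" "Q = X\<^sup>\<dagger> * Q' * X"
      using asm by blast
    then have "P * Q = X\<^sup>\<dagger> * (P' * Q') * X"
      using XD(1-3) by (simp add: mult_assoc_dim c unitary_cancel[OF X])
    then show ?thesis using mult[OF PQ(1,2)] by blast
  qed
  show "P\<^sup>\<dagger> \<in> (\<lambda>P. X\<^sup>\<dagger> * P * X) ` G" if asm: "P \<in> (\<lambda>P. X\<^sup>\<dagger> * P * X) ` G" for P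
  proof -
    obtain P' where P: "P' \<in> G" "P = X\<^sup>\<dagger> * P' * X" using asm by blast
    then have "P\<^sup>\<dagger> = X\<^sup>\<dagger> * P'\<^sup>\<dagger> * X"
      using XD(1-3) by (simp add: mult_assoc_dim c adjoint_mult)
    then show ?thesis using adjoint[OF P(1)] by blast
  qed
  show "a \<cdot>\<^sub>m P \<in> (\<lambda>P. X\<^sup>\<dagger> * P * X) ` G" if asm: "P \<in> (\<lambda>P. X\<^sup>\<dagger> * P * X) ` G" "cmod a = 1" for P a
  proof -
    obtain P' where P: "P' \<in> G" "P = X\<^sup>\<dagger> * P' * X" using asm by blast
    then have "a \<cdot>\<^sub>m P = X\<^sup>\<dagger> * (a \<cdot>\<^sub>m P') * X"
      using XD(1-3) by (simp add: mat_simps c)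
    then show ?thesis using smult[OF P(1) asm(2)] by blast
  qed
  show "\<exists>a. cmod a = 1 \<and> P = a \<cdot>\<^sub>m 1\<^sub>m n" if asm: "P \<in> (\<lambda>P. X\<^sup>\<dagger> * P * X) ` G" "mtrace P \<noteq> 0" for P
  proof -
    obtain P' where P: "P' \<in> G" "P = X\<^sup>\<dagger> * P' * X" using asm by blast
    have "mtrace P = mtrace P'"
      unfolding P(2) using XD P(1) by (intro mtrace_similar[of _ n]) (auto simp: c)
    then obtain a where "cmod a = 1" "P' = a \<cdot>\<^sub>m 1\<^sub>m n"
      using mtrace[OF P(1)] asm(2) by auto
    then show ?thesis
      using P(2) XD by (auto simp: mat_simps)
  qed
qed

text \<open>The eigenvalues are pairwise distinct and have the same \<open>n\<close>-th power, so
  divided by any one of them they are exactly the \<open>n\<close>-th roots of unity. Eigenvectors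
  for distinct eigenvalues of a unitary are orthogonal and form \<open>X\<close>; the phase
  \<open>c\<close> is the eigenvalue \<open>es ! 0\<close>.\<close>

lemma ex_eigenbasis:
  assumes P: "P \<in> G" and nonscalar: "\<And>c. P \<noteq> c \<cdot>\<^sub>m 1\<^sub>m n"
  obtains X c where "unitary n X" "cmod c = 1" "P = c \<cdot>\<^sub>m (X * clock n 1 * X\<^sup>\<dagger>)"
proof -
  note U = unitary[OF P] and PC = G_carrier[OF P]
  \<comment> \<open>Triangular form is enough at this stage, since traces of powers see only the
    diagonal, where eigenvalues are listed with multiplicity.\<close>
  obtain es where es: "char_poly P = (\<Prod>a\<leftarrow>es. [:- a, 1:])" "length es = n"
    using char_poly_factorized[OF PC(1)] by blast
  obtain B S R where "schur_decomposition P es = (B, S, R)"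
    by (cases "schur_decomposition P es") auto
  from schur_decomposition[OF PC(1) es(1) this]
  have sim: "similar_mat_wit P B S R" and ut: "upper_triangular B" and diag: "diag_mat B = es"
    by auto
  note simD = similar_mat_witD2[OF PC(1) sim]
  have B_diag: "B $$ (i, i) = es ! i" if "i < n" for i
    using diag that simD by (auto simp: diag_mat_def)
  have ev: "eigenvalue P (es ! i)" if "i < n" for i
    unfolding eigenvalue_root_char_poly[OF PC(1)] es(1) poly_prod_list
    using that es(2) by (auto simp: prod_list_zero_iff)
  have norm1: "cmod (es ! i) = 1" if "i < n" for i
    using unitary_eigenvalue_norm[OF U ev[OF that]] .
  then have nz: "es ! i \<noteq> 0" if "i < n" for i
    using that by force
  have P_pow: "P ^\<^sub>m k = S * B ^\<^sub>m k * R" for k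
    by (rule similar_mat_wit_pow_id[OF sim])
  have tr: "mtrace (P ^\<^sub>m k) = (\<Sum>i<n. es ! i ^ k)" for k
  proof -
    have "mtrace (P ^\<^sub>m k) = mtrace (B ^\<^sub>m k)"
      unfolding P_pow using simD by (intro mtrace_similar[of _ n]) auto
    also have "\<dots> = (\<Sum>i<n. es ! i ^ k)"
      using simD by (simp add: mtrace_def upper_triangular_power(2)[OF _ ut, of n] B_diag)
    finally show ?thesis .
  qed
  txt \<open>\<open>m\<close> is the order of \<open>P\<close> modulo scalars. The traces of the lower powers vanish, so all eigenvalues
    have the same multiplicity \<open>n / m\<close>, and as \<open>n\<close> is prime they are distinct.\<close>
  define m where "m = (LEAST k. k > 0 \<and> (\<Sum>i<n. es ! i ^ k) \<noteq> 0)"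
  have ex: "\<exists>k. k > 0 \<and> (\<Sum>i<n. es ! i ^ k) \<noteq> 0"
    using ex_power_sum_nonzero[OF n_pos, of "\<lambda>i. es ! i"] nz by blast
  have m: "m > 0" "(\<Sum>i<n. es ! i ^ m) \<noteq> 0"
    using LeastI_ex[OF ex] by (auto simp: m_def)
  have below_m: "(\<Sum>i<n. es ! i ^ k) = 0" if "0 < k" "k < m" for k
    using not_less_Least[of k "\<lambda>k. k > 0 \<and> (\<Sum>i<n. es ! i ^ k) \<noteq> 0"] that by (auto simp: m_def)
  obtain d where d: "P ^\<^sub>m m = d \<cdot>\<^sub>m 1\<^sub>m n"
    using mtrace[OF power[OF P, of m]] m(2) tr by auto
  have "B ^\<^sub>m m = R * (P ^\<^sub>m m) * S"
  proof -
    have "R * (P ^\<^sub>m m) * S = R * (S * (B ^\<^sub>m m * (R * S)))"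
      unfolding P_pow using simD(5-7) by (simp add: mult_assoc_dim)
    also have "\<dots> = (R * S) * (B ^\<^sub>m m * (R * S))"
      using simD(5-7) by (intro mult_assoc_dim[symmetric]) auto
    finally show ?thesis using simD by simp
  qed
  then have Bm: "B ^\<^sub>m m = d \<cdot>\<^sub>m 1\<^sub>m n"
    unfolding d using simD by (simp add: mat_simps)
  have es_m: "es ! i ^ m = d" if "i < n" for i
    using upper_triangular_power(2)[OF _ ut, of n i m] simD that Bm B_diag by simp
  \<comment> \<open>Double counting of the sum of \<open>(es ! i / es ! j) ^ k\<close> over
    \<open>i < n\<close> and \<open>k < m\<close>. Summed over \<open>i\<close> first, only
    \<open>k = 0\<close> survives; summed over \<open>k\<close> first, each ratio is an
    \<open>m\<close>-th root of unity and contributes \<open>m\<close> or 0 according to whether it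
    is 1.\<close>
  have count: "n = m * card {i. i < n \<and> es ! i = es ! j}" if j: "j < n" for j
  proof -
    have "(\<Sum>k<m. \<Sum>i<n. (es ! i / es ! j) ^ k) = (\<Sum>k\<in>{0}. \<Sum>i<n. (es ! i / es ! j) ^ k)"
      using m(1) below_m
      by (intro sum.mono_neutral_right) (auto simp: power_divide simp flip: sum_divide_distrib)
    also have "\<dots> = of_nat n" by simp
    finally have "of_nat n = (\<Sum>i<n. \<Sum>k<m. (es ! i / es ! j) ^ k)"
      by (subst sum.swap) simp
    also have "\<dots> = (\<Sum>i<n. if es ! i = es ! j then of_nat m else 0)"
    proof (intro sum.cong refl)
      fix i assume "i \<in> {..<n}"
      then have "(es ! i / es ! j) ^ m = 1"
        using es_m j nz[OF j] by (auto simp: power_divide)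
      then show "(\<Sum>k<m. (es ! i / es ! j) ^ k) = (if es ! i = es ! j then of_nat m else 0)"
        using sum_power_root_of_unity nz[OF j] by auto
    qed
    also have "\<dots> = of_nat (m * card {i. i < n \<and> es ! i = es ! j})"
      by (simp add: sum.If_cases lessThan_def Int_def mult.commute)
    finally show ?thesis by (simp only: of_nat_eq_iff)
  qed
  have "m \<noteq> 1"
    using d nonscalar PC by auto
  then have "m = n"
    using count[of 0] n_pos prime by (metis dvd_triv_left prime_nat_iff)
  then have card1: "card {i. i < n \<and> es ! i = es ! j} = 1" if "j < n" for j
    using count[OF that] n_pos by simp
  have inj: "inj_on (\<lambda>i. es ! i / es ! 0) {..<n}"
  proof (rule inj_onI)
    fix i j assume ij: "i \<in> {..<n}" "j \<in> {..<n}" "es ! i / es ! 0 = es ! j / es ! 0"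
    then have eq: "i < n" "j < n" "es ! i = es ! j"
      using nz[OF n_pos] by auto
    obtain x where x: "{i. i < n \<and> es ! i = es ! j} = {x}"
      using card1[OF eq(2)] by (rule card_1_singletonE)
    have "i \<in> {x}" "j \<in> {x}"
      unfolding x[symmetric] using eq by simp_all
    then show "i = j" by simp
  qed
  have surj: "(\<lambda>i. es ! i / es ! 0) ` {..<n} = {z. z ^ n = 1}"
  proof (rule card_subset_eq)
    show "finite {z::complex. z ^ n = 1}"
      using bij_betw_finite[OF bij_betw_root_unity[OF n_pos]] by simp
    show "(\<lambda>i. es ! i / es ! 0) ` {..<n} \<subseteq> {z. z ^ n = 1}"
      using es_m n_pos nz[OF n_pos] \<open>m = n\<close> by (auto simp: power_divide)
    show "card ((\<lambda>i. es ! i / es ! 0) ` {..<n}) = card {z::complex. z ^ n = 1}"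
      using card_image[OF inj] bij_betw_same_card[OF bij_betw_root_unity[OF n_pos]] by simp
  qed
  have ex_i: "\<exists>i<n. es ! i = es ! 0 * root_unity n ^ k" if "k < n" for k
  proof -
    have "root_unity n ^ k \<in> {z. z ^ n = 1}"
      using bij_betw_root_unity[OF n_pos] that by (auto simp: bij_betw_def)
    then obtain i where "i < n" "root_unity n ^ k = es ! i / es ! 0"
      using surj by blast
    then show ?thesis using nz[OF n_pos] by auto
  qed
  \<comment> \<open>Eigenvectors are indexed by the exponent \<open>k\<close> and not by the
    position in \<open>es\<close>, so that the diagonal form is the clock matrix in its own
    order.\<close>
  have "\<exists>v \<in> carrier_vec n. v \<bullet>c v = 1 \<and> P *\<^sub>v v = (es ! 0 * root_unity n ^ k) \<cdot>\<^sub>v v" if k: "k < n" for k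
  proof -
    obtain i where "i < n" "es ! i = es ! 0 * root_unity n ^ k"
      using ex_i[OF k] by blast
    then have "eigenvalue P (es ! 0 * root_unity n ^ k)"
      using ev by metis
    then obtain v where v: "v \<in> carrier_vec n" "v \<noteq> 0\<^sub>v n"
      and eig: "P *\<^sub>v v = (es ! 0 * root_unity n ^ k) \<cdot>\<^sub>v v"
      using PC by (auto simp: eigenvalue_def eigenvector_def)
    obtain r where r: "(r \<cdot>\<^sub>v v) \<bullet>c (r \<cdot>\<^sub>v v) = 1"
      using normalize_vec[OF v] .
    have "P *\<^sub>v (r \<cdot>\<^sub>v v) = (es ! 0 * root_unity n ^ k) \<cdot>\<^sub>v (r \<cdot>\<^sub>v v)"
      using v PC eig by (simp add: mult_mat_vec[of _ n n] smult_smult_assoc mult.commute)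
    with r v show ?thesis by (intro bexI[of _ "r \<cdot>\<^sub>v v"]) auto
  qed
  then obtain e where e: "\<And>k. k < n \<Longrightarrow> e k \<in> carrier_vec n \<and> e k \<bullet>c e k = 1
      \<and> P *\<^sub>v e k = (es ! 0 * root_unity n ^ k) \<cdot>\<^sub>v e k"
    by metis
  have onb: "onb n e"
    unfolding onb_def
  proof (intro conjI allI impI)
    fix k l assume kl: "k < n" "l < n"
    show "e k \<bullet>c e l = (if k = l then 1 else 0)"
    proof (cases "k = l")
      case False
      have "es ! 0 * root_unity n ^ k * cnj (es ! 0 * root_unity n ^ l) \<noteq> 1"
      proof
        assume "es ! 0 * root_unity n ^ k * cnj (es ! 0 * root_unity n ^ l) = 1"
        then have "es ! 0 * root_unity n ^ k = es ! 0 * root_unity n ^ l"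
          by (rule eq_if_mult_cnj_eq_one) (simp add: norm_mult norm_power norm1[OF n_pos])
        then have "root_unity n ^ k = root_unity n ^ l"
          using nz[OF n_pos] by simp
        then show False
          using False kl by (simp add: root_unity_power_eq_iff[OF n_pos])
      qed
      then show ?thesis
        using False unitary_eigenvector_orthogonal[OF U] e kl by simp
    qed (use e kl in simp)
  qed (use e in simp)
  let ?X = "onb_mat n e"
  have X: "unitary n ?X" by (rule unitary_onb_mat[OF onb])
  have "P * ?X = es ! 0 \<cdot>\<^sub>m (?X * clock n 1)"
  proof (intro eq_matI)
    fix i k assume "i < dim_row (es ! 0 \<cdot>\<^sub>m (?X * clock n 1))" "k < dim_col (es ! 0 \<cdot>\<^sub>m (?X * clock n 1))"
    then have ik: "i < n" "k < n" by auto
    have e_dim: "dim_vec (e k) = n" and e_eig: "P *\<^sub>v e k = (es ! 0 * root_unity n ^ k) \<cdot>\<^sub>v e k"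
      using e[OF ik(2)] by auto
    have "(P * ?X) $$ (i, k) = (\<Sum>l<n. P $$ (i, l) * e k $ l)"
      using ik PC by (simp add: index_mult_sum[of _ _ _ _ n] onb_mat_def del: index_mult_mat(1))
    also have "\<dots> = (P *\<^sub>v e k) $ i"
      using ik PC e_dim by (simp add: index_mult_mat_vec_sum[of _ _ n] del: index_mult_mat_vec)
    also have "\<dots> = (es ! 0 * root_unity n ^ k) * e k $ i"
      using ik e_dim e_eig by simp
    also have "\<dots> = (es ! 0 \<cdot>\<^sub>m (?X * clock n 1)) $$ (i, k)"
      using ik unfolding clock_def by (simp add: index_mult_dmat del: index_mult_mat(1))
        (simp add: onb_mat_def)
    finally show "(P * ?X) $$ (i, k) = (es ! 0 \<cdot>\<^sub>m (?X * clock n 1)) $$ (i, k)" .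
  qed (use PC in auto)
  then have "(P * ?X) * ?X\<^sup>\<dagger> = es ! 0 \<cdot>\<^sub>m (?X * clock n 1 * ?X\<^sup>\<dagger>)"
    by (simp add: smult_mult_left)
  then have "P = es ! 0 \<cdot>\<^sub>m (?X * clock n 1 * ?X\<^sup>\<dagger>)"
    using unitaryD[OF X] PC by (simp add: mult_assoc_dim)
  with X norm1[OF n_pos] that show thesis by blast
qed

end

section \<open>Groups containing the clock matrix\<close>

lemma sum_nonzero_ex:
  fixes f :: "'a \<Rightarrow> 'b::comm_monoid_add"
  shows "sum f A \<noteq> 0 \<Longrightarrow> \<exists>x\<in>A. f x \<noteq> 0"
  using sum.not_neutral_contains_not_neutral by metis

lemma sum_rotate:
  "(\<Sum>i\<in>A. \<Sum>j\<in>B. \<Sum>k\<in>C. f i j k) = (\<Sum>k\<in>C. \<Sum>i\<in>A. \<Sum>j\<in>B. f i j k)"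
  by (rule trans[OF sum.cong[OF refl sum.swap] sum.swap])

locale clock_trace_group = trace_group +
  assumes clock1: "clock n 1 \<in> G"
begin

lemma clock: "clock n k \<in> G"
  using power[OF clock1, of k] unfolding clock_power .

text \<open>The traces of \<open>clock n i * Q\<close> are the discrete Fourier transform of the
  diagonal of \<open>Q\<close>. By Fourier inversion, a nonzero diagonal entry makes one of these
  traces nonzero; then \<open>clock n i * Q\<close> is scalar and \<open>Q\<close> is a multiple of
  the inverse clock.\<close>

lemma clock_multiple_if_diag:
  assumes Q: "Q \<in> G" and k: "k < n" and nz: "Q $$ (k, k) \<noteq> 0"
  shows "\<exists>i<n. \<exists>c. cmod c = 1 \<and> Q = c \<cdot>\<^sub>m clock n i"
proof -
  note QC = G_carrier[OF Q]
  have tr: "mtrace (clock n i * Q) = (\<Sum>l<n. root_unity n ^ (i * l) * Q $$ (l, l))" for i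
    using QC by (simp add: mtrace_def clock_def index_dmat_mult del: index_mult_mat(1))
  \<comment> \<open>Fourier inversion at \<open>k\<close>: the exponent \<open>n - k\<close> stands
    for \<open>- k\<close> modulo \<open>n\<close>.\<close>
  have "(\<Sum>i<n. root_unity n ^ (i * (n - k)) * mtrace (clock n i * Q))
      = (\<Sum>i<n. \<Sum>l<n. root_unity n ^ (i * (n - k + l)) * Q $$ (l, l))"
    by (simp add: tr sum_distrib_left mult.assoc[symmetric] power_add[symmetric] add_mult_distrib2)
  also have "\<dots> = (\<Sum>l<n. (\<Sum>i<n. root_unity n ^ (i * (n - k + l))) * Q $$ (l, l))"
    by (subst sum.swap) (simp add: sum_distrib_right)
  also have "\<dots> = (\<Sum>l<n. if l = k then of_nat n * Q $$ (k, k) else 0)"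
  proof (intro sum.cong refl)
    fix l assume "l \<in> {..<n}"
    then have l: "l < n" by simp
    \<comment> \<open>The number \<open>n - k + l\<close> lies strictly between 0 and
      \<open>2 * n\<close>, so \<open>n\<close> is its only possible multiple of
      \<open>n\<close>.\<close>
    have "n dvd n - k + l \<longleftrightarrow> l = k"
    proof
      assume "n dvd n - k + l"
      then obtain q where q: "n - k + l = n * q" by (auto elim: dvdE)
      moreover have "0 < n * q" "n * q < n * 2"
        unfolding q[symmetric] using k l by linarith+
      ultimately have "q = 1" by (cases q) auto
      then show "l = k" using q k by auto
    qed (use k in simp)
    then show "(\<Sum>i<n. root_unity n ^ (i * (n - k + l))) * Q $$ (l, l)
        = (if l = k then of_nat n * Q $$ (k, k) else 0)"
      by (simp add: sum_root_unity_power[OF n_pos])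
  qed
  also have "\<dots> = of_nat n * Q $$ (k, k)"
    using k by simp
  finally have "(\<Sum>i<n. root_unity n ^ (i * (n - k)) * mtrace (clock n i * Q)) \<noteq> 0"
    using nz n_pos by simp
  from sum_nonzero_ex[OF this] obtain i where i: "i < n" "mtrace (clock n i * Q) \<noteq> 0"
    by auto
  then obtain c where c: "cmod c = 1" "clock n i * Q = c \<cdot>\<^sub>m 1\<^sub>m n"
    using mtrace mult[OF clock Q] by blast
  have "clock n (n - i) * (clock n i * Q) = c \<cdot>\<^sub>m clock n (n - i)"
    unfolding c(2) by (simp add: mat_simps)
  moreover have "clock n (n - i) * (clock n i * Q) = clock n (n - i) * clock n i * Q"
    using QC by (intro mult_assoc_dim[symmetric]) auto
  moreover have "clock n (n - i) * clock n i = 1\<^sub>m n"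
    using i(1) clock_mod[OF n_pos, of n] by (simp add: clock_mult clock_0)
  \<comment> \<open>The reduction modulo \<open>n\<close> is needed for \<open>i = 0\<close>, where
    \<open>n - i\<close> is not below \<open>n\<close>.\<close>
  ultimately have "Q = c \<cdot>\<^sub>m clock n ((n - i) mod n)"
    using QC by (simp add: clock_mod[OF n_pos])
  with c(1) n_pos show ?thesis
    by (intro exI[of _ "(n - i) mod n"]) auto
qed

text \<open>With a nonzero diagonal entry, \<open>Q\<close> is a multiple of a clock power and
  commutes. Otherwise the support of \<open>Q\<close> lies on a line of constant
  \<open>l - k\<close> modulo \<open>n\<close>; there the column factor \<open>w^l\<close> and the
  row factor \<open>w^k\<close> differ by a constant, which is the scalar.\<close>

lemma clock_commutes_scalar:
  assumes Q: "Q \<in> G"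
  shows "\<exists>c. Q * clock n 1 = c \<cdot>\<^sub>m (clock n 1 * Q)"
proof (cases "\<exists>k<n. Q $$ (k, k) \<noteq> 0")
  case True
  then obtain i c where "Q = c \<cdot>\<^sub>m clock n i"
    using clock_multiple_if_diag[OF Q] by blast
  then show ?thesis
    by (intro exI[of _ 1]) (simp add: mat_simps clock_mult)
next
  case False
  then have diag: "Q $$ (k, k) = 0" if "k < n" for k
    using that by blast
  note QC = G_carrier[OF Q] and U = unitary[OF Q]
  txt \<open>Summing the traces of \<open>?M i j\<close> over all \<open>i\<close>, \<open>j\<close> gives \<open>n\<^sup>2 \<bar>Q $$ (0, 0)\<bar>\<^sup>2 = 0\<close>, so besides
    \<open>?M 0 0 = 1\<close> some other \<open>?M i j\<close> is a scalar. This confines the support of \<open>Q\<close> to a line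
    \<open>i k + j l = const\<close> modulo \<open>n\<close>, which misses the diagonal only if \<open>i + j = 0\<close>.\<close>
  let ?w = "root_unity n"
  let ?M = "\<lambda>i j. clock n i * Q * clock n j * Q\<^sup>\<dagger>"
  have M: "?M i j \<in> G" for i j
    by (intro mult clock adjoint Q)
  have entry: "(clock n i * Q * clock n j) $$ (k, l) = ?w ^ (i * k + j * l) * Q $$ (k, l)"
    if "k < n" "l < n" for i j k l
    using that QC unfolding clock_def
    by (simp add: index_mult_dmat index_dmat_mult power_add del: index_mult_mat(1) assoc_mult_mat)
  have tr: "mtrace (?M i j)
      = (\<Sum>k<n. \<Sum>l<n. ?w ^ (i * k) * ?w ^ (j * l) * (Q $$ (k, l) * cnj (Q $$ (k, l))))" for i j
  proof -
    have "mtrace (?M i j) = (\<Sum>k<n. \<Sum>l<n. (clock n i * Q * clock n j) $$ (k, l) * cnj (Q $$ (k, l)))"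
      unfolding mtrace_def using QC
      by (simp add: index_mult_sum[of _ "clock n i * Q * clock n j" _ "Q\<^sup>\<dagger>" n]
          del: index_mult_mat(1) assoc_mult_mat)
    then show ?thesis
      by (simp add: entry power_add mult.assoc del: index_mult_mat(1) assoc_mult_mat)
  qed
  have "(\<Sum>i<n. \<Sum>j<n. mtrace (?M i j)) = 0"
  proof -
    have *: "(\<Sum>i<n. ?w ^ (i * k)) = 0" if "k < n" "k \<noteq> 0" for k
      using that by (simp add: sum_root_unity_power[OF n_pos]) (auto dest: dvd_imp_le)
    have "(\<Sum>i<n. \<Sum>j<n. mtrace (?M i j)) = (\<Sum>k<n. \<Sum>l<n. \<Sum>i<n. \<Sum>j<n.
        ?w ^ (i * k) * ?w ^ (j * l) * (Q $$ (k, l) * cnj (Q $$ (k, l))))"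
      unfolding tr by (rule trans[OF sum_rotate]) (rule sum.cong[OF refl sum_rotate])
    also have "\<dots> = (\<Sum>k<n. \<Sum>l<n.
        (\<Sum>i<n. ?w ^ (i * k)) * (\<Sum>j<n. ?w ^ (j * l)) * (Q $$ (k, l) * cnj (Q $$ (k, l))))"
      unfolding sum_product unfolding sum_distrib_right ..
    also have "\<dots> = 0"
    proof (intro sum.neutral ballI)
      fix k l assume "k \<in> {..<n}" "l \<in> {..<n}"
      then show "(\<Sum>i<n. ?w ^ (i * k)) * (\<Sum>j<n. ?w ^ (j * l)) * (Q $$ (k, l) * cnj (Q $$ (k, l))) = 0"
        using *[of k] *[of l] diag[OF n_pos] by (cases "k = 0"; cases "l = 0") simp_all
    qed
    finally show ?thesis .
  qed
  moreover have "mtrace (?M 0 0) = of_nat n"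
    using QC unitaryD[OF U] by (simp add: clock_0 mtrace_def)
  ultimately obtain i j where ij: "i < n" "j < n" "i \<noteq> 0 \<or> j \<noteq> 0" "mtrace (?M i j) \<noteq> 0"
  proof -
    assume z: "(\<Sum>i<n. \<Sum>j<n. mtrace (?M i j)) = 0" and tr0: "mtrace (?M 0 0) = of_nat n"
    have "\<exists>i<n. \<exists>j<n. (i \<noteq> 0 \<or> j \<noteq> 0) \<and> mtrace (?M i j) \<noteq> 0"
    proof (rule ccontr)
      assume "\<not> ?thesis"
      then have "mtrace (?M i j) = (if i = 0 \<and> j = 0 then of_nat n else 0)" if "i < n" "j < n" for i j
        using that tr0 by auto
      then have "(\<Sum>i<n. \<Sum>j<n. mtrace (?M i j))
          = (\<Sum>i<n. \<Sum>j<n. if i = 0 \<and> j = 0 then of_nat n else 0)"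
        by (intro sum.cong refl) simp
      also have "\<dots> = (\<Sum>i<n. if i = 0 then (\<Sum>j<n. if j = 0 then of_nat n else 0) else (0 :: complex))"
        by (intro sum.cong) auto
      also have "\<dots> = of_nat n" using n_pos by simp
      finally show False using z n_pos by simp
    qed
    with that show thesis by blast
  qed
  obtain c where c: "cmod c = 1" "?M i j = c \<cdot>\<^sub>m 1\<^sub>m n"
    using mtrace[OF M ij(4)] by blast
  \<comment> \<open>Multiplying the scalar word by \<open>Q\<close> from the right removes the
    adjoint. Compared entrywise, the result ties the support of \<open>Q\<close> to a single value
    of \<open>w^(i k + j l)\<close>.\<close>
  have "clock n i * Q * clock n j = c \<cdot>\<^sub>m Q"
  proof -
    have "?M i j * Q = c \<cdot>\<^sub>m Q"
      unfolding c(2) using QC by (simp add: mat_simps)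
    then show ?thesis
      using QC unitaryD[OF U] by (simp add: mult_assoc_dim)
  qed
  then have entry_eq: "?w ^ (i * k + j * l) * Q $$ (k, l) = c * Q $$ (k, l)" if "k < n" "l < n" for k l
    using entry[OF that, of i j] that QC by auto
  have support: "?w ^ (i * k + j * l) = c" if "k < n" "l < n" "Q $$ (k, l) \<noteq> 0" for k l
    using entry_eq[OF that(1,2)] that(3) by simp
  have inverse_mod: "\<exists>b. [a * b = 1] (mod n)" if "a mod n \<noteq> 0" for a
  proof -
    have "coprime n a"
      using prime_imp_coprime[OF prime, of a] that by (simp add: dvd_eq_mod_eq_0)
    then show ?thesis
      using cong_solve_coprime_nat[of a n] by (simp add: coprime_commute)
  qed
  show ?thesis
  proof (cases "(i + j) mod n = 0")
    case True
    have "j mod n \<noteq> 0"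
      using True ij by (cases "j = 0") auto
    \<comment> \<open>As \<open>i + j\<close> vanishes modulo \<open>n\<close>, the inverse
      \<open>b\<close> of \<open>j\<close> satisfies \<open>i b = -1\<close>. The
      \<open>b\<close>-th power of the support equation then reads \<open>c^b = w^(l - k)\<close>,
      written below without subtraction.\<close>
    then obtain b where b: "[j * b = 1] (mod n)"
      using inverse_mod by blast
    have line: "?w ^ l = c ^ b * ?w ^ k" if kl: "k < n" "l < n" "Q $$ (k, l) \<noteq> 0" for k l
    proof -
      have "c ^ b * ?w ^ k = ?w ^ ((i * k + j * l) * b + k)"
        by (simp add: support[OF kl, symmetric] power_mult power_add)
      also have "\<dots> = ?w ^ l"
      proof -
        have "[i * b + 1 = i * b + j * b] (mod n)"
          using b by (intro cong_add cong_refl) (rule cong_sym)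
        also have "i * b + j * b = (i + j) * b" by (simp add: algebra_simps)
        also have "[(i + j) * b = 0 * b] (mod n)"
          using True by (intro cong_mult cong_refl) (simp add: cong_def)
        finally have 1: "[i * b + 1 = 0] (mod n)" by simp
        have "[k * (i * b + 1) + l * (j * b) = k * 0 + l * 1] (mod n)"
          using 1 b by (intro cong_add cong_mult cong_refl)
        moreover have eq: "(i * k + j * l) * b + k = k * (i * b + 1) + l * (j * b)"
          by (simp add: algebra_simps)
        ultimately show ?thesis
          unfolding eq root_unity_power_eq_iff[OF n_pos] cong_def by simp
      qed
      finally show ?thesis ..
    qed
    have "Q * clock n 1 = c ^ b \<cdot>\<^sub>m (clock n 1 * Q)"
    proof (intro eq_matI)
      fix k l assume "k < dim_row (c ^ b \<cdot>\<^sub>m (clock n 1 * Q))" "l < dim_col (c ^ b \<cdot>\<^sub>m (clock n 1 * Q))"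
      then have kl: "k < n" "l < n" using QC by auto
      have "Q $$ (k, l) * ?w ^ l = c ^ b * (?w ^ k * Q $$ (k, l))"
        using line[OF kl] by (cases "Q $$ (k, l) = 0") auto
      then show "(Q * clock n 1) $$ (k, l) = (c ^ b \<cdot>\<^sub>m (clock n 1 * Q)) $$ (k, l)"
        using kl QC unfolding clock_def
        by (simp add: index_mult_dmat index_dmat_mult del: index_mult_mat(1))
    qed (use QC in auto)
    then show ?thesis ..
  next
    case False
    then obtain b where b: "[(i + j) * b = 1] (mod n)"
      using inverse_mod by blast
    obtain l0 where l0: "l0 < n" "Q $$ (0, l0) \<noteq> 0"
      using unitary_row_nonzero[OF U n_pos] .
    \<comment> \<open>The diagonal point of the line: a support point \<open>(0, l0)\<close> in the
      first row fixes the constant \<open>j l0\<close>, and \<open>k0\<close> solves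
      \<open>(i + j) k0 = j l0\<close> modulo \<open>n\<close>.\<close>
    define k0 where "k0 = (j * l0 * b) mod n"
    have k0: "k0 < n" using n_pos by (simp add: k0_def)
    have c_k0: "c = ?w ^ (i * k0 + j * k0)"
    proof -
      have "[(i + j) * k0 = (i + j) * (j * l0 * b)] (mod n)"
        unfolding k0_def by (intro cong_mult cong_refl) (simp add: cong_def)
      also have "(i + j) * (j * l0 * b) = (i + j) * b * (j * l0)"
        by (simp add: ac_simps)
      also have "[\<dots> = 1 * (j * l0)] (mod n)"
        using b by (intro cong_mult cong_refl)
      finally have "[i * k0 + j * k0 = i * 0 + j * l0] (mod n)"
        by (simp add: add_mult_distrib)
      then show ?thesis
        using support[OF n_pos l0]
        by (metis cong_def root_unity_power_eq_iff[OF n_pos])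
    qed
    have cancel: "l = k0" if "l < n" "a mod n \<noteq> 0" "[a * l = a * k0] (mod n)" for a l
    proof -
      obtain b' where b': "[a * b' = 1] (mod n)" using inverse_mod \<open>a mod n \<noteq> 0\<close> by blast
      have eq: "[x = b' * (a * x)] (mod n)" for x
      proof -
        have "[1 * x = a * b' * x] (mod n)"
          using b' by (intro cong_mult cong_refl) (rule cong_sym)
        then show ?thesis by (simp add: ac_simps)
      qed
      have "[l = b' * (a * l)] (mod n)" by (rule eq)
      also have "[b' * (a * l) = b' * (a * k0)] (mod n)"
        by (rule cong_mult[OF cong_refl that(3)])
      also have "[b' * (a * k0) = k0] (mod n)" by (rule cong_sym[OF eq])
      finally show ?thesis using \<open>l < n\<close> k0 by (simp add: cong_def)
    qed
    have False
    \<comment> \<open>For \<open>j = 0\<close> the line is the row \<open>k0\<close>, so the nonzero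
      entry of column \<open>k0\<close> must lie on the diagonal. For \<open>j \<noteq> 0\<close>
      the line meets row \<open>k0\<close> only in column \<open>k0\<close>, and the nonzero entry
      of that row lies on the diagonal. Both contradict the vanishing diagonal.\<close>
    proof (cases "j = 0")
      case True
      obtain k where k: "k < n" "Q $$ (k, k0) \<noteq> 0"
        using unitary_col_nonzero[OF U k0] .
      have "?w ^ (i * k) = ?w ^ (i * k0)"
        using support[OF k(1) k0 k(2)] c_k0 True by simp
      then have "k = k0"
        using ij True k by (intro cancel[of k i]) (auto simp: root_unity_power_eq_iff[OF n_pos] cong_def)
      then show False using diag k by simp
    next
      case False
      obtain l where l: "l < n" "Q $$ (k0, l) \<noteq> 0"
        using unitary_row_nonzero[OF U k0] .
      have "?w ^ (i * k0) * ?w ^ (j * l) = ?w ^ (i * k0) * ?w ^ (j * k0)"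
        using support[OF k0 l] c_k0 by (simp add: power_add)
      then have "?w ^ (j * l) = ?w ^ (j * k0)"
        by simp
      then have "l = k0"
        using ij False l by (intro cancel[of l j]) (auto simp: root_unity_power_eq_iff[OF n_pos] cong_def)
      then show False using diag l by simp
    qed
    then show ?thesis ..
  qed
qed

end

section \<open>Commutators and commuting families\<close>

context trace_group
begin

text \<open>In the eigenbasis \<open>P\<close> becomes \<open>c\<close> times the clock matrix, and
  closure under phases removes \<open>c\<close>.\<close>

lemma clock_trace_group_conj:
  assumes X: "unitary n X" and c: "cmod c = 1" and P: "P \<in> G"
    and eq: "P = c \<cdot>\<^sub>m (X * clock n 1 * X\<^sup>\<dagger>)"
  shows "clock_trace_group n ((\<lambda>P. X\<^sup>\<dagger> * P * X) ` G)"
proof -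
  interpret conj: trace_group n "(\<lambda>P. X\<^sup>\<dagger> * P * X) ` G"
    by (rule conj_trace_group[OF X])
  have "X\<^sup>\<dagger> * P * X = c \<cdot>\<^sub>m clock n 1"
    using unitaryD[OF X] unfolding eq by (simp add: mat_simps unitary_cancel[OF X])
  then have "c \<cdot>\<^sub>m clock n 1 \<in> (\<lambda>P. X\<^sup>\<dagger> * P * X) ` G"
    using P by (metis image_eqI)
  then have "cnj c \<cdot>\<^sub>m (c \<cdot>\<^sub>m clock n 1) \<in> (\<lambda>P. X\<^sup>\<dagger> * P * X) ` G"
    by (rule conj.smult) (use c in simp)
  moreover have "cnj c * c = 1"
    using c by (simp add: mult.commute flip: complex_norm_square)
  then have "cnj c \<cdot>\<^sub>m (c \<cdot>\<^sub>m clock n 1) = clock n 1"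
    by (simp only: smult_smult_mat one_smult_mat)
  ultimately show ?thesis
    by unfold_locales (simp only:)
qed

text \<open>Commuting up to a scalar is insensitive to conjugation and to the phase of
  \<open>P\<close>, so a nonscalar \<open>P\<close> may be replaced by the clock matrix.\<close>

lemma commutator_scalar:
  assumes P: "P \<in> G" and Q: "Q \<in> G"
  shows "\<exists>c. Q * P = c \<cdot>\<^sub>m (P * Q)"
proof (cases "\<exists>c. P = c \<cdot>\<^sub>m 1\<^sub>m n")
  case True
  then show ?thesis
    using G_carrier[OF Q] by (intro exI[of _ 1]) (auto simp: mat_simps)
next
  case False
  then obtain X c where X: "unitary n X" and c: "cmod c = 1"
    and eq: "P = c \<cdot>\<^sub>m (X * clock n 1 * X\<^sup>\<dagger>)"
    using ex_eigenbasis[OF P] by blast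
  interpret conj: clock_trace_group n "(\<lambda>P. X\<^sup>\<dagger> * P * X) ` G"
    by (rule clock_trace_group_conj[OF X c P eq])
  note XD = unitaryD[OF X] and QC = G_carrier[OF Q]
  obtain d where d: "X\<^sup>\<dagger> * Q * X * clock n 1 = d \<cdot>\<^sub>m (clock n 1 * (X\<^sup>\<dagger> * Q * X))"
    using conj.clock_commutes_scalar[of "X\<^sup>\<dagger> * Q * X"] Q by blast
  have "Q * P = c \<cdot>\<^sub>m (X * (X\<^sup>\<dagger> * Q * X * clock n 1) * X\<^sup>\<dagger>)"
    unfolding eq using XD(1-3) QC by (simp add: mat_simps unitary_cancel[OF X])
  also have "\<dots> = d \<cdot>\<^sub>m (P * Q)"
    unfolding d eq using XD QC by (simp add: mat_simps unitary_cancel[OF X] mult.commute)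
  finally show ?thesis ..
qed

text \<open>If some member is traceless, it is nonscalar and may be taken as a clock matrix. The
  others commute with it, and since it has distinct diagonal entries, the nonzero entry in the first
  row of any of them must be diagonal; this is the situation of
  \<open>clock_multiple_if_diag\<close>. If no member is traceless, all are scalar and any basis
  works.\<close>

lemma commuting_family:
  assumes W: "\<And>j. j < N \<Longrightarrow> W j \<in> G"
    and comm: "\<And>i j. i < N \<Longrightarrow> j < N \<Longrightarrow> W i * W j = W j * W i"
  shows "\<exists>X. unitary n X \<and> (\<forall>j<N. \<exists>i<n. \<exists>c. cmod c = 1 \<and> W j = c \<cdot>\<^sub>m (X * clock n i * X\<^sup>\<dagger>))"
proof (cases "\<forall>j<N. mtrace (W j) \<noteq> 0")
  case True
  then have "\<exists>c. cmod c = 1 \<and> W j = c \<cdot>\<^sub>m 1\<^sub>m n" if "j < N" for j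
    using mtrace W that by blast
  moreover have "1\<^sub>m n * clock n 0 * (1\<^sub>m n)\<^sup>\<dagger> = 1\<^sub>m n"
    by (simp add: clock_0)
  ultimately show ?thesis
    using n_pos unitary_one[of n] by metis
next
  case False
  then obtain j0 where j0: "j0 < N" "mtrace (W j0) = 0" by blast
  have "W j0 \<noteq> c \<cdot>\<^sub>m 1\<^sub>m n" for c
  proof
    assume eq: "W j0 = c \<cdot>\<^sub>m 1\<^sub>m n"
    then have "c * of_nat n = 0"
      using j0(2) by (simp add: mtrace_def mult.commute)
    then have "c = 0" using n_pos by simp
    then show False
      using eq unitary_row_norm[OF unitary[OF W[OF j0(1)]] n_pos] by simp
  qed
  then obtain X c where X: "unitary n X" and c: "cmod c = 1"
    and eq: "W j0 = c \<cdot>\<^sub>m (X * clock n 1 * X\<^sup>\<dagger>)"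
    using ex_eigenbasis[OF W[OF j0(1)]] by blast
  interpret conj: clock_trace_group n "(\<lambda>P. X\<^sup>\<dagger> * P * X) ` G"
    by (rule clock_trace_group_conj[OF X c W[OF j0(1)] eq])
  note XD = unitaryD[OF X]
  have "\<exists>i<n. \<exists>c. cmod c = 1 \<and> W j = c \<cdot>\<^sub>m (X * clock n i * X\<^sup>\<dagger>)" if j: "j < N" for j
  proof -
    note WC = G_carrier[OF W[OF j]]
    let ?Q = "X\<^sup>\<dagger> * W j * X"
    have c0: "c \<noteq> 0" using c by auto
    have "c \<cdot>\<^sub>m (?Q * clock n 1) = X\<^sup>\<dagger> * (W j * W j0) * X"
      unfolding eq using XD WC by (simp add: mat_simps unitary_cancel[OF X])
    also have "W j * W j0 = W j0 * W j"
      by (rule comm[OF j j0(1)])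
    also have "X\<^sup>\<dagger> * (W j0 * W j) * X = c \<cdot>\<^sub>m (clock n 1 * ?Q)"
      unfolding eq using XD WC by (simp add: mat_simps unitary_cancel[OF X])
    finally have "(1 / c) \<cdot>\<^sub>m (c \<cdot>\<^sub>m (?Q * clock n 1)) = (1 / c) \<cdot>\<^sub>m (c \<cdot>\<^sub>m (clock n 1 * ?Q))"
      by simp
    then have comm_clock: "?Q * clock n 1 = clock n 1 * ?Q"
      using c0 by (simp add: smult_smult_mat one_smult_mat)
    have QG: "?Q \<in> (\<lambda>P. X\<^sup>\<dagger> * P * X) ` G" using W[OF j] by blast
    obtain l where l: "l < n" "?Q $$ (0, l) \<noteq> 0"
      using unitary_row_nonzero[OF conj.unitary[OF QG] n_pos] .
    have "(?Q * clock n 1) $$ (0, l) = ?Q $$ (0, l) * root_unity n ^ l"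
      using l XD(1-3) WC unfolding clock_def
      by (simp add: index_mult_dmat del: index_mult_mat(1) assoc_mult_mat)
    moreover have "(clock n 1 * ?Q) $$ (0, l) = ?Q $$ (0, l)"
      using l n_pos XD(1-3) WC unfolding clock_def
      by (simp add: index_dmat_mult del: index_mult_mat(1) assoc_mult_mat)
    ultimately have "root_unity n ^ l = root_unity n ^ 0"
      using comm_clock l by (simp del: assoc_mult_mat index_mult_mat(1))
    then have "l = 0"
      using l(1) root_unity_power_inj[OF n_pos, of l 0] by simp
    then obtain i d where i: "i < n" "cmod d = 1" "?Q = d \<cdot>\<^sub>m clock n i"
      using conj.clock_multiple_if_diag[OF QG n_pos] l by blast
    have "W j = X * ?Q * X\<^sup>\<dagger>"
      using XD WC by (simp add: mat_simps unitary_cancel[OF X])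
    also have "\<dots> = d \<cdot>\<^sub>m (X * clock n i * X\<^sup>\<dagger>)"
      unfolding i(3) using XD by (simp add: mat_simps)
    finally show ?thesis using i by blast
  qed
  with X show ?thesis by blast
qed

end

section \<open>The copying group and the Weyl group\<close>

lemma invertible_smult_eqD:
  fixes A B :: "complex mat"
  assumes "k \<cdot>\<^sub>m A = l \<cdot>\<^sub>m A" and "A * B = 1\<^sub>m n" and "dim_col A = dim_row B" and "n > 0"
  shows "k = l"
proof -
  have "k \<cdot>\<^sub>m (A * B) = l \<cdot>\<^sub>m (A * B)"
    using assms(1,3) by (metis smult_mult_left)
  then have "k \<cdot>\<^sub>m 1\<^sub>m n = (l \<cdot>\<^sub>m 1\<^sub>m n :: complex mat)"
    unfolding assms(2) .
  then have "(k \<cdot>\<^sub>m 1\<^sub>m n :: complex mat) $$ (0, 0) = (l \<cdot>\<^sub>m 1\<^sub>m n) $$ (0, 0)"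
    by simp
  then show ?thesis using \<open>n > 0\<close> by simp
qed

text \<open>The multiplier \<open>c\<close> may be any complex number: as \<open>A\<close> need not
  be unitary, nothing bounds its modulus in advance.\<close>

definition copy_group :: "nat \<Rightarrow> complex mat \<Rightarrow> complex mat set" where
  "copy_group n A = {P. unitary n P \<and> (\<exists>c. A * (P \<otimes>\<^sub>m 1\<^sub>m n) = c \<cdot>\<^sub>m ((P \<otimes>\<^sub>m P) * A))}"

locale copier =
  fixes n :: nat and A R :: "complex mat"
  assumes prime: "prime n"
    and A: "A \<in> carrier_mat (n * n) (n * n)" and R: "R \<in> carrier_mat (n * n) (n * n)"
    and AR: "A * R = 1\<^sub>m (n * n)" and RA: "R * A = 1\<^sub>m (n * n)"
begin

lemma n_pos: "n > 0"
  using prime by (rule prime_gt_0_nat)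

lemma dims: "dim_row A = n * n" "dim_col A = n * n" "dim_row R = n * n" "dim_col R = n * n"
  using A R by auto

lemma tensor_A_inverse:
  assumes "unitary n P" "unitary n Q"
  shows "((P \<otimes>\<^sub>m Q) * A) * (R * (P \<otimes>\<^sub>m Q)\<^sup>\<dagger>) = 1\<^sub>m (n * n)"
proof -
  note PQ = unitaryD[OF unitary_tensor[OF assms]]
  have "((P \<otimes>\<^sub>m Q) * A) * (R * (P \<otimes>\<^sub>m Q)\<^sup>\<dagger>) = (P \<otimes>\<^sub>m Q) * ((A * R) * (P \<otimes>\<^sub>m Q)\<^sup>\<dagger>)"
    using PQ(2,3) dims by (simp only: mult_assoc_dim dim_adjoint index_mult_mat)
  then show ?thesis
    unfolding AR using PQ by simp
qed

lemma copy_smult_eqD: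
  assumes "unitary n P" "unitary n Q" and "k \<cdot>\<^sub>m ((P \<otimes>\<^sub>m Q) * A) = l \<cdot>\<^sub>m ((P \<otimes>\<^sub>m Q) * A)"
  shows "k = l"
  using invertible_smult_eqD[OF assms(3) tensor_A_inverse[OF assms(1,2)]] dims n_pos by simp

text \<open>A vanishing multiplier would make the invertible matrix
  \<open>A * (P \<otimes>\<^sub>m 1\<^sub>m n)\<close> zero. This also excludes, after the fact, a
  Kraus operator that annihilates one of the input states.\<close>

lemma copy_factor_nonzero:
  assumes P: "unitary n P" and eq: "A * (P \<otimes>\<^sub>m 1\<^sub>m n) = c \<cdot>\<^sub>m B"
  shows "c \<noteq> 0"
proof
  assume "c = 0"
  note PD = unitaryD[OF P]
  have "(A * (P \<otimes>\<^sub>m 1\<^sub>m n)) * ((P \<otimes>\<^sub>m 1\<^sub>m n)\<^sup>\<dagger> * R) = 1\<^sub>m (n * n)"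
  proof -
    note U = unitaryD[OF unitary_tensor[OF P unitary_one[of n]]]
    have "(A * (P \<otimes>\<^sub>m 1\<^sub>m n)) * ((P \<otimes>\<^sub>m 1\<^sub>m n)\<^sup>\<dagger> * R)
        = A * (((P \<otimes>\<^sub>m 1\<^sub>m n) * (P \<otimes>\<^sub>m 1\<^sub>m n)\<^sup>\<dagger>) * R)"
      using U(2,3) dims by (simp only: mult_assoc_dim dim_adjoint index_mult_mat)
    then show ?thesis unfolding U(5) using AR dims by simp
  qed
  moreover have "1 \<cdot>\<^sub>m (A * (P \<otimes>\<^sub>m 1\<^sub>m n)) = 0 \<cdot>\<^sub>m (A * (P \<otimes>\<^sub>m 1\<^sub>m n))"
    unfolding eq \<open>c = 0\<close> by (simp add: smult_smult_mat)
  ultimately have "(1::complex) = 0"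
    using unitaryD(2,3)[OF P] dims n_pos
    by (intro invertible_smult_eqD[of 1 "A * (P \<otimes>\<^sub>m 1\<^sub>m n)" 0 "(P \<otimes>\<^sub>m 1\<^sub>m n)\<^sup>\<dagger> * R" "n * n"]) auto
  then show False by simp
qed

lemma copy_mult:
  assumes P: "unitary n P" and Q: "unitary n Q"
    and p: "A * (P \<otimes>\<^sub>m 1\<^sub>m n) = c \<cdot>\<^sub>m ((P \<otimes>\<^sub>m P) * A)" and q: "A * (Q \<otimes>\<^sub>m 1\<^sub>m n) = d \<cdot>\<^sub>m ((Q \<otimes>\<^sub>m Q) * A)"
  shows "A * ((P * Q) \<otimes>\<^sub>m 1\<^sub>m n) = (c * d) \<cdot>\<^sub>m (((P * Q) \<otimes>\<^sub>m (P * Q)) * A)"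
proof -
  note PD = unitaryD(2,3)[OF P] and QD = unitaryD(2,3)[OF Q]
  have "A * ((P * Q) \<otimes>\<^sub>m 1\<^sub>m n) = A * ((P \<otimes>\<^sub>m 1\<^sub>m n) * (Q \<otimes>\<^sub>m 1\<^sub>m n))"
    using PD QD by (simp add: tensor_mult)
  also have "\<dots> = (A * (P \<otimes>\<^sub>m 1\<^sub>m n)) * (Q \<otimes>\<^sub>m 1\<^sub>m n)"
    using PD QD dims by (intro mult_assoc_dim[symmetric]) auto
  also have "\<dots> = c \<cdot>\<^sub>m ((P \<otimes>\<^sub>m P) * (A * (Q \<otimes>\<^sub>m 1\<^sub>m n)))"
    unfolding p using PD QD dims by (simp add: mat_simps)
  also have "\<dots> = (c * d) \<cdot>\<^sub>m (((P \<otimes>\<^sub>m P) * (Q \<otimes>\<^sub>m Q)) * A)"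
    unfolding q using PD QD dims by (simp add: mat_simps)
  also have "(P \<otimes>\<^sub>m P) * (Q \<otimes>\<^sub>m Q) = (P * Q) \<otimes>\<^sub>m (P * Q)"
    using PD QD by (simp add: tensor_mult)
  finally show ?thesis .
qed

text \<open>The multiplier is inverted rather than conjugated. This is what lets the trace
  identities of \<open>P\<close> and of its adjoint eliminate the modulus of
  \<open>c\<close>.\<close>

lemma copy_adjoint:
  assumes P: "unitary n P" and p: "A * (P \<otimes>\<^sub>m 1\<^sub>m n) = c \<cdot>\<^sub>m ((P \<otimes>\<^sub>m P) * A)"
  shows "A * (P\<^sup>\<dagger> \<otimes>\<^sub>m 1\<^sub>m n) = (1 / c) \<cdot>\<^sub>m ((P\<^sup>\<dagger> \<otimes>\<^sub>m P\<^sup>\<dagger>) * A)"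
proof -
  note PP = unitary_tensor[OF P P] and P1 = unitary_tensor[OF P unitary_one[of n]]
  have c: "c \<noteq> 0" by (rule copy_factor_nonzero[OF P p])
  let ?PP = "P \<otimes>\<^sub>m P" and ?P1 = "P \<otimes>\<^sub>m 1\<^sub>m n"
  have "?PP\<^sup>\<dagger> * (A * ?P1) * ?P1\<^sup>\<dagger> = ?PP\<^sup>\<dagger> * (A * (?P1 * ?P1\<^sup>\<dagger>))"
    using unitaryD(2,3)[OF PP] unitaryD(2,3)[OF P1] dims
    by (simp only: mult_assoc_dim dim_adjoint index_mult_mat)
  also have "\<dots> = ?PP\<^sup>\<dagger> * A"
    unfolding unitaryD(5)[OF P1] using dims by simp
  finally have "?PP\<^sup>\<dagger> * A = ?PP\<^sup>\<dagger> * (A * ?P1) * ?P1\<^sup>\<dagger>" ..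
  also have "\<dots> = c \<cdot>\<^sub>m (?PP\<^sup>\<dagger> * (?PP * (A * ?P1\<^sup>\<dagger>)))"
    unfolding p using unitaryD(2,3)[OF P] dims by (simp add: mat_simps)
  also have "?PP\<^sup>\<dagger> * (?PP * (A * ?P1\<^sup>\<dagger>)) = A * ?P1\<^sup>\<dagger>"
    using dims by (intro unitary_cancel(1)[OF PP]) simp
  finally have "(1 / c) \<cdot>\<^sub>m (?PP\<^sup>\<dagger> * A) = (1 / c) \<cdot>\<^sub>m (c \<cdot>\<^sub>m (A * ?P1\<^sup>\<dagger>))"
    by simp
  then show ?thesis
    using c by (simp add: smult_smult_mat one_smult_mat tensor_adjoint)
qed

text \<open>Conjugation by \<open>A\<close> keeps the trace and turns
  \<open>P \<otimes>\<^sub>m 1\<^sub>m n\<close> into \<open>c\<close> times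
  \<open>P \<otimes>\<^sub>m P\<close>.\<close>

lemma copy_mtrace:
  assumes P: "unitary n P" and p: "A * (P \<otimes>\<^sub>m 1\<^sub>m n) = c \<cdot>\<^sub>m ((P \<otimes>\<^sub>m P) * A)"
  shows "of_nat n * mtrace P = c * (mtrace P * mtrace P)"
proof -
  note PD = unitaryD(1-3)[OF P]
  have P1: "P \<otimes>\<^sub>m 1\<^sub>m n \<in> carrier_mat (n * n) (n * n)" and PP: "P \<otimes>\<^sub>m P \<in> carrier_mat (n * n) (n * n)"
    using PD by (auto intro: tensor_carrier)
  have "mtrace (A * (P \<otimes>\<^sub>m 1\<^sub>m n) * R) = mtrace P * of_nat n"
    using mtrace_similar[OF P1 A R RA] mtrace_tensor[OF PD(1) one_carrier_mat[of n]]
    by (simp add: mtrace_def[of "1\<^sub>m n"])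
  moreover have "A * (P \<otimes>\<^sub>m 1\<^sub>m n) * R = c \<cdot>\<^sub>m ((P \<otimes>\<^sub>m P) * (A * R))"
    unfolding p using PD dims by (simp add: mat_simps)
  moreover have "mtrace (c \<cdot>\<^sub>m ((P \<otimes>\<^sub>m P) * (A * R))) = c * (mtrace P * mtrace P)"
    unfolding AR using PD mtrace_smult[OF PP] mtrace_tensor[OF PD(1,1)] by simp
  ultimately show ?thesis by (auto simp: mult.commute)
qed

sublocale trace_group n "copy_group n A"
proof
  show "prime n" by (rule prime)
  show "unitary n P" if "P \<in> copy_group n A" for P
    using that by (simp add: copy_group_def)
  show "1\<^sub>m n \<in> copy_group n A"
    using dims by (auto simp: copy_group_def unitary_one tensor_one intro!: exI[of _ 1])
  show "P * Q \<in> copy_group n A" if "P \<in> copy_group n A" "Q \<in> copy_group n A" for P Q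
    using that copy_mult by (auto simp: copy_group_def unitary_mult)
  show "P\<^sup>\<dagger> \<in> copy_group n A" if "P \<in> copy_group n A" for P
    using that copy_adjoint by (auto simp: copy_group_def unitary_adjoint)
  show "a \<cdot>\<^sub>m P \<in> copy_group n A" if P: "P \<in> copy_group n A" and a: "cmod a = 1" for P a
  proof -
    obtain c where U: "unitary n P" and c: "A * (P \<otimes>\<^sub>m 1\<^sub>m n) = c \<cdot>\<^sub>m ((P \<otimes>\<^sub>m P) * A)"
      using P by (auto simp: copy_group_def)
    have "a \<noteq> 0" using a by auto
    \<comment> \<open>The left side is linear in the phase and the right side quadratic, hence the
      new multiplier \<open>c / a\<close>.\<close>
    then have "A * ((a \<cdot>\<^sub>m P) \<otimes>\<^sub>m 1\<^sub>m n) = (c / a) \<cdot>\<^sub>m (((a \<cdot>\<^sub>m P) \<otimes>\<^sub>m (a \<cdot>\<^sub>m P)) * A)"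
      using unitaryD[OF U] dims
      by (simp add: tensor_smult_left tensor_smult_right mat_simps c mult.commute)
    then show ?thesis
      using U a by (auto simp: copy_group_def unitary_smult)
  qed
  show "\<exists>a. cmod a = 1 \<and> P = a \<cdot>\<^sub>m 1\<^sub>m n" if P: "P \<in> copy_group n A" and nz: "mtrace P \<noteq> 0" for P
  proof -
    obtain c where U: "unitary n P" and c: "A * (P \<otimes>\<^sub>m 1\<^sub>m n) = c \<cdot>\<^sub>m ((P \<otimes>\<^sub>m P) * A)"
      using P by (auto simp: copy_group_def)
    have "c \<noteq> 0" by (rule copy_factor_nonzero[OF U c])
    \<comment> \<open>A nonzero trace can be cancelled, here for \<open>P\<close> and below for its
      adjoint with \<open>1 / c\<close>; in the product of the two moduli \<open>cmod c\<close>
      drops out.\<close>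
    have "of_nat n = c * mtrace P"
      using copy_mtrace[OF U c] nz by simp
    then have 1: "real n = cmod c * cmod (mtrace P)"
      by (metis norm_mult norm_of_nat)
    have tr_adj: "mtrace P\<^sup>\<dagger> = cnj (mtrace P)"
      using unitaryD[OF U] by (intro mtrace_adjoint) auto
    have "of_nat n = 1 / c * mtrace P\<^sup>\<dagger>"
    proof -
      have "of_nat n * mtrace P\<^sup>\<dagger> = (1 / c * mtrace P\<^sup>\<dagger>) * mtrace P\<^sup>\<dagger>"
        using copy_mtrace[OF unitary_adjoint[OF U] copy_adjoint[OF U c]] by (simp only: mult.assoc)
      moreover have "mtrace P\<^sup>\<dagger> \<noteq> 0" using nz tr_adj by simp
      ultimately show ?thesis by (metis mult_right_cancel)
    qed
    then have "real n = cmod (1 / c * cnj (mtrace P))"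
      unfolding tr_adj by (metis norm_of_nat)
    then have 2: "real n = cmod (mtrace P) / cmod c"
      by (simp add: norm_mult norm_divide)
    have "real n * real n = (cmod c * cmod (mtrace P)) * (cmod (mtrace P) / cmod c)"
      by (simp only: 1[symmetric] 2[symmetric])
    also have "\<dots> = cmod (mtrace P) * cmod (mtrace P)"
      using \<open>c \<noteq> 0\<close> by simp
    finally have "(cmod (mtrace P))\<^sup>2 = (real n)\<^sup>2"
      unfolding power2_eq_square by (rule sym)
    then have "cmod (mtrace P) = real n"
      by (rule power2_eq_imp_eq) auto
    then show ?thesis
      by (rule unitary_scalar_if_mtrace[OF U _ n_pos])
  qed
qed

text \<open>Inserting \<open>Q * P = k \<cdot>\<^sub>m (P * Q)\<close> into the copying relation of
  \<open>Q * P\<close> gives \<open>k\<close> on the side with one tensor factor and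
  \<open>k * k\<close> on the side with two. As \<open>k\<close> is nonzero, it equals 1.\<close>

lemma copy_group_commute:
  assumes P: "P \<in> copy_group n A" and Q: "Q \<in> copy_group n A"
  shows "Q * P = P * Q"
proof -
  obtain k where k: "Q * P = k \<cdot>\<^sub>m (P * Q)"
    using commutator_scalar[OF P Q] by blast
  obtain c where U: "unitary n P" and c: "A * (P \<otimes>\<^sub>m 1\<^sub>m n) = c \<cdot>\<^sub>m ((P \<otimes>\<^sub>m P) * A)"
    using P by (auto simp: copy_group_def)
  obtain d where V: "unitary n Q" and d: "A * (Q \<otimes>\<^sub>m 1\<^sub>m n) = d \<cdot>\<^sub>m ((Q \<otimes>\<^sub>m Q) * A)"
    using Q by (auto simp: copy_group_def)
  note UV = unitary_mult[OF U V]
  let ?PQ = "P * Q"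
  have nz: "c \<noteq> 0" "d \<noteq> 0"
    using copy_factor_nonzero[OF U c] copy_factor_nonzero[OF V d] by auto
  have "k \<noteq> 0"
  proof
    assume "k = 0"
    then have "(Q * P) $$ (0, l) = 0" if "l < n" for l
      using that n_pos unitaryD[OF U] unitaryD[OF V] unfolding k by simp
    then show False
      using unitary_row_norm[OF unitary_mult[OF V U] n_pos] by simp
  qed
  have "(d * c) \<cdot>\<^sub>m (((Q * P) \<otimes>\<^sub>m (Q * P)) * A) = A * ((Q * P) \<otimes>\<^sub>m 1\<^sub>m n)"
    using copy_mult[OF V U d c] ..
  also have "\<dots> = k \<cdot>\<^sub>m (A * (?PQ \<otimes>\<^sub>m 1\<^sub>m n))"
    unfolding k using unitaryD[OF U] unitaryD[OF V] dims by (simp add: tensor_smult_left mat_simps)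
  also have "\<dots> = (k * (c * d)) \<cdot>\<^sub>m ((?PQ \<otimes>\<^sub>m ?PQ) * A)"
    unfolding copy_mult[OF U V c d] by (simp add: smult_smult_mat)
  also have "(d * c) \<cdot>\<^sub>m (((Q * P) \<otimes>\<^sub>m (Q * P)) * A) = (d * c * (k * k)) \<cdot>\<^sub>m ((?PQ \<otimes>\<^sub>m ?PQ) * A)"
    unfolding k using unitaryD[OF U] unitaryD[OF V] dims
    by (simp add: tensor_smult_left tensor_smult_right mat_simps)
  finally have "d * c * (k * k) = k * (c * d)"
    by (rule copy_smult_eqD[OF UV UV])
  then have "k = 1"
    using nz \<open>k \<noteq> 0\<close> by simp
  then show ?thesis
    using k by (simp add: one_smult_mat)
qed

end

section \<open>The Weyl group of clock and shift matrices\<close>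

lemma unitary_clock:
  assumes "n > 0"
  shows "unitary n (clock n a)"
proof (rule unitary_if_left_inverse)
  have "cnj (root_unity n ^ k) * root_unity n ^ k = 1" for k
    by (simp add: mult.commute norm_power flip: complex_norm_square complex_cnj_power)
  then show "(clock n a)\<^sup>\<dagger> * clock n a = 1\<^sub>m n"
    by (simp add: clock_def dmat_adjoint dmat_mult dmat_const one_smult_mat del: complex_cnj_power)
qed simp

lemma unitary_shift:
  assumes "n > 0"
  shows "unitary n (shift n b)"
proof -
  have "inj_on (\<lambda>k. (k + b) mod n) {..<n}"
    by (intro inj_onI) (metis cong_add_rcancel_nat cong_def lessThan_iff mod_less)
  then show ?thesis
    unfolding shift_def using assms by (intro unitary_permutation_mat) auto
qed

lemma unitary_inverse_unique:
  assumes U: "unitary n U" and V: "U * V = 1\<^sub>m n" "dim_row V = n"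
  shows "U\<^sup>\<dagger> = V"
  using unitary_cancel(1)[OF U V(2)] V unitaryD[OF U] by simp

lemma shift_mod: "shift n (b mod n) = shift n b"
  by (simp add: shift_eq mod_add_right_eq)

text \<open>Among natural exponents, \<open>(n - 1) * a\<close> represents \<open>- a\<close> modulo
  \<open>n\<close>.\<close>

lemma clock_adjoint:
  assumes "n > 0"
  shows "(clock n a)\<^sup>\<dagger> = clock n ((n - 1) * a)"
proof (rule unitary_inverse_unique[OF unitary_clock[OF assms]])
  have "a + (n - 1) * a = n * a"
    using assms by (cases n) auto
  then show "clock n a * clock n ((n - 1) * a) = 1\<^sub>m n"
    using clock_mod[OF assms, of "n * a"] by (simp add: clock_mult clock_0)
qed simp

lemma shift_adjoint:
  assumes "n > 0"
  shows "(shift n b)\<^sup>\<dagger> = shift n ((n - 1) * b)"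
proof (rule unitary_inverse_unique[OF unitary_shift[OF assms]])
  have "b + (n - 1) * b = n * b"
    using assms by (cases n) auto
  then show "shift n b * shift n ((n - 1) * b) = 1\<^sub>m n"
    using shift_mod[of n "n * b"] by (simp add: shift_mult shift_0)
qed simp

text \<open>The Weyl commutation relation: the shift reads row \<open>k + b\<close>, where the clock
  has gained the factor \<open>w^(a b)\<close> over row \<open>k\<close>.\<close>

lemma shift_clock:
  assumes "n > 0"
  shows "shift n b * clock n a = root_unity n ^ (a * b) \<cdot>\<^sub>m (clock n a * shift n b)"
proof (intro eq_matI)
  fix k l assume "k < dim_row (root_unity n ^ (a * b) \<cdot>\<^sub>m (clock n a * shift n b))"
    and "l < dim_col (root_unity n ^ (a * b) \<cdot>\<^sub>m (clock n a * shift n b))"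
  then have kl: "k < n" "l < n" by auto
  have "root_unity n ^ (a * ((k + b) mod n)) = root_unity n ^ (a * (k + b))"
    using assms by (simp add: root_unity_power_eq_iff mod_mult_right_eq)
  also have "\<dots> = root_unity n ^ (a * b) * root_unity n ^ (a * k)"
    by (simp add: add_mult_distrib2 power_add)
  finally show "(shift n b * clock n a) $$ (k, l)
      = (root_unity n ^ (a * b) \<cdot>\<^sub>m (clock n a * shift n b)) $$ (k, l)"
    using kl unfolding clock_def
    by (simp add: index_mult_dmat index_dmat_mult del: index_mult_mat(1)) (simp add: shift_eq)
qed auto

definition weyl_group :: "nat \<Rightarrow> complex mat set" where
  "weyl_group n = {c \<cdot>\<^sub>m (clock n a * shift n b) | c a b. cmod c = 1}"

lemma weyl_groupI: "cmod c = 1 \<Longrightarrow> c \<cdot>\<^sub>m (clock n a * shift n b) \<in> weyl_group n"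
  by (auto simp: weyl_group_def)

lemma clock_shift_in_weyl_group: "clock n a * shift n b \<in> weyl_group n"
  using weyl_groupI[of 1] by (simp add: one_smult_mat)

text \<open>A shift by a nonzero residue has empty diagonal; without a shift the trace is a
  character sum, which vanishes unless \<open>n\<close> divides \<open>a\<close>.\<close>

lemma mtrace_clock_shift:
  assumes "n > 0" and nz: "mtrace (clock n a * shift n b) \<noteq> 0"
  shows "clock n a * shift n b = 1\<^sub>m n"
proof -
  have tr: "mtrace (clock n a * shift n b)
      = (\<Sum>k<n. if k = (k + b) mod n then root_unity n ^ (a * k) else 0)"
    unfolding mtrace_def clock_def
    by (auto simp: index_dmat_mult shift_eq simp del: index_mult_mat(1) intro!: sum.cong)
  obtain k where k: "k \<in> {..<n}"
    and nz_k: "(if k = (k + b) mod n then root_unity n ^ (a * k) else 0) \<noteq> 0"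
    using sum_nonzero_ex[OF nz[unfolded tr]] by blast
  have "k = (k + b) mod n"
    using nz_k by (rule contrapos_np) simp
  with k have "[k + b = k + 0] (mod n)"
    by (simp add: cong_def)
  then have b: "b mod n = 0"
    by (simp only: cong_add_lcancel_nat) (simp add: cong_def)
  then have shift: "shift n b = 1\<^sub>m n"
    using shift_mod[of n b] by (simp add: shift_0)
  have "mtrace (clock n a * shift n b) = (\<Sum>k<n. root_unity n ^ (k * a))"
    unfolding shift by (simp add: mtrace_def clock_def dmat_def mult.commute)
  then have "n dvd a"
    using nz by (auto simp: sum_root_unity_power[OF assms(1)] split: if_splits)
  then have "clock n a = clock n 0"
    using clock_mod[OF assms(1), of a] by simp
  then show ?thesis
    unfolding shift by (simp add: clock_0)
qed

lemma trace_group_weyl: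
  assumes "prime n"
  shows "trace_group n (weyl_group n)"
proof
  have n: "n > 0" using assms by (rule prime_gt_0_nat)
  show "prime n" by fact
  show "unitary n P" if "P \<in> weyl_group n" for P
    using that n by (auto simp: weyl_group_def intro!: unitary_smult unitary_mult unitary_clock unitary_shift)
  show "1\<^sub>m n \<in> weyl_group n"
    using clock_shift_in_weyl_group[of n 0 0] by (simp add: clock_0 shift_0)
  show "a \<cdot>\<^sub>m P \<in> weyl_group n" if "P \<in> weyl_group n" "cmod a = 1" for P a
  proof -
    obtain c k l where "cmod c = 1" "P = c \<cdot>\<^sub>m (clock n k * shift n l)"
      using \<open>P \<in> weyl_group n\<close> by (auto simp: weyl_group_def)
    then show ?thesis
      using \<open>cmod a = 1\<close> by (simp add: smult_smult_mat weyl_groupI norm_mult)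
  qed
  show "P * Q \<in> weyl_group n" if PQ: "P \<in> weyl_group n" "Q \<in> weyl_group n" for P Q
  proof -
    obtain c a b where P: "cmod c = 1" "P = c \<cdot>\<^sub>m (clock n a * shift n b)"
      using PQ by (auto simp: weyl_group_def)
    obtain c' a' b' where Q: "cmod c' = 1" "Q = c' \<cdot>\<^sub>m (clock n a' * shift n b')"
      using PQ by (auto simp: weyl_group_def)
    have "P * Q = (c * c') \<cdot>\<^sub>m (clock n a * (shift n b * clock n a') * shift n b')"
      unfolding P Q by (simp add: mat_simps mult.commute)
    also have "\<dots> = (c * c' * root_unity n ^ (a' * b)) \<cdot>\<^sub>m ((clock n a * clock n a') * (shift n b * shift n b'))"
      unfolding shift_clock[OF n] by (simp add: mat_simps)
    finally show ?thesis
      unfolding clock_mult shift_mult using P Q by (simp add: weyl_groupI norm_mult norm_power)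
  qed
  show "P\<^sup>\<dagger> \<in> weyl_group n" if "P \<in> weyl_group n" for P
  proof -
    obtain c a b where P: "cmod c = 1" "P = c \<cdot>\<^sub>m (clock n a * shift n b)"
      using \<open>P \<in> weyl_group n\<close> by (auto simp: weyl_group_def)
    have "P\<^sup>\<dagger> = cnj c \<cdot>\<^sub>m (shift n ((n - 1) * b) * clock n ((n - 1) * a))"
      unfolding P by (simp add: adjoint_smult adjoint_mult clock_adjoint[OF n] shift_adjoint[OF n])
    then show ?thesis
      unfolding shift_clock[OF n] using P by (simp add: smult_smult_mat weyl_groupI norm_mult norm_power)
  qed
  show "\<exists>a. cmod a = 1 \<and> P = a \<cdot>\<^sub>m 1\<^sub>m n" if "P \<in> weyl_group n" "mtrace P \<noteq> 0" for P
  proof -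
    obtain c a b where P: "cmod c = 1" "P = c \<cdot>\<^sub>m (clock n a * shift n b)"
      using \<open>P \<in> weyl_group n\<close> by (auto simp: weyl_group_def)
    have "mtrace P = c * mtrace (clock n a * shift n b)"
      unfolding P by (intro mtrace_smult[of _ n]) (auto intro!: carrier_matI)
    then show ?thesis
      using P mtrace_clock_shift[OF n] \<open>mtrace P \<noteq> 0\<close> by auto
  qed
qed

section \<open>Separability of LOCC operations\<close>

lemma kraus_map_carrier [simp]: "kraus_map d Ks \<rho> \<in> carrier_mat d d"
  by (simp add: kraus_map_def mat_sum_def)

lemma dim_kraus_map [simp]: "dim_row (kraus_map d Ks \<rho>) = d" "dim_col (kraus_map d Ks \<rho>) = d"
  by (simp_all add: kraus_map_def mat_sum_def)

lemma index_kraus_map: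
  assumes "i < d" "j < d"
  shows "kraus_map d Ks \<rho> $$ (i, j) = (\<Sum>K\<leftarrow>Ks. (K * \<rho> * K\<^sup>\<dagger>) $$ (i, j))"
  using assms
  by (simp add: kraus_map_def mat_sum_def sum_list_sum_nth atLeast0LessThan del: index_mult_mat(1) assoc_mult_mat)

lemma kraus_map_Nil: "kraus_map d [] \<rho> = 0\<^sub>m d d"
  by (intro eq_matI) (auto simp: index_kraus_map)

lemma kraus_map_Cons:
  assumes "K \<in> carrier_mat d d'"
  shows "kraus_map d (K # Ks) \<rho> = K * \<rho> * K\<^sup>\<dagger> + kraus_map d Ks \<rho>"
  using assms by (intro eq_matI) (auto simp: index_kraus_map simp del: index_mult_mat(1) assoc_mult_mat)

lemma kraus_map_append:
  "kraus_map d (Ks @ Ls) \<rho> = kraus_map d Ks \<rho> + kraus_map d Ls \<rho>"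
  by (intro eq_matI) (auto simp: index_kraus_map simp del: index_mult_mat(1) assoc_mult_mat)

lemma kraus_map_single:
  assumes "K \<in> carrier_mat d d'"
  shows "kraus_map d [K] \<rho> = K * \<rho> * K\<^sup>\<dagger>"
  using assms by (intro eq_matI) (auto simp: index_kraus_map simp del: index_mult_mat(1) assoc_mult_mat)

lemma conj_kraus_map:
  assumes L: "L \<in> carrier_mat d'' d'" and Ks: "set Ks \<subseteq> carrier_mat d' d" and \<rho>: "\<rho> \<in> carrier_mat d d"
  shows "L * kraus_map d' Ks \<rho> * L\<^sup>\<dagger> = kraus_map d'' (map (\<lambda>K. L * K) Ks) \<rho>"
  using Ks
proof (induction Ks)
  case Nil
  then show ?case using L by (simp add: kraus_map_Nil)
next
  case (Cons K Ks)
  then have K: "K \<in> carrier_mat d' d" by simp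
  have "L * kraus_map d' (K # Ks) \<rho> * L\<^sup>\<dagger>
      = L * (K * \<rho> * K\<^sup>\<dagger>) * L\<^sup>\<dagger> + L * kraus_map d' Ks \<rho> * L\<^sup>\<dagger>"
  proof -
    have KK: "K * \<rho> * K\<^sup>\<dagger> \<in> carrier_mat d' d'"
      using K by (intro carrier_matI) auto
    have "L * (K * \<rho> * K\<^sup>\<dagger> + kraus_map d' Ks \<rho>) = L * (K * \<rho> * K\<^sup>\<dagger>) + L * kraus_map d' Ks \<rho>"
      by (rule mult_add_distrib_mat[OF L KK kraus_map_carrier])
    moreover have "(L * (K * \<rho> * K\<^sup>\<dagger>) + L * kraus_map d' Ks \<rho>) * L\<^sup>\<dagger>
        = L * (K * \<rho> * K\<^sup>\<dagger>) * L\<^sup>\<dagger> + L * kraus_map d' Ks \<rho> * L\<^sup>\<dagger>"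
      by (rule add_mult_distrib_mat[of _ d'' d' _ _ d'']) (use L KK in \<open>auto intro!: carrier_matI\<close>)
    ultimately show ?thesis
      unfolding kraus_map_Cons[OF K] by simp
  qed
  also have "L * (K * \<rho> * K\<^sup>\<dagger>) * L\<^sup>\<dagger> = (L * K) * \<rho> * (L * K)\<^sup>\<dagger>"
    using L K \<rho> by (simp add: adjoint_mult mult_assoc_dim)
  also have "L * kraus_map d' Ks \<rho> * L\<^sup>\<dagger> = kraus_map d'' (map (\<lambda>K. L * K) Ks) \<rho>"
    using Cons by simp
  finally show ?case
    using L K by (simp add: kraus_map_Cons[of "L * K" d'' d])
qed

lemma kraus_map_comp:
  assumes "set Ls \<subseteq> carrier_mat d'' d'" and "set Ks \<subseteq> carrier_mat d' d" and "\<rho> \<in> carrier_mat d d"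
  shows "kraus_map d'' Ls (kraus_map d' Ks \<rho>) = kraus_map d'' (concat (map (\<lambda>L. map (\<lambda>K. L * K) Ks) Ls)) \<rho>"
  using assms(1)
proof (induction Ls)
  case (Cons L Ls)
  then have "L \<in> carrier_mat d'' d'" by simp
  then show ?case
    using Cons by (simp add: kraus_map_Cons[of L d'' d'] kraus_map_append conj_kraus_map[OF _ assms(2,3)]
        del: assoc_mult_mat)
qed (simp add: kraus_map_Nil)

lemma mat_sum_kraus_map:
  "mat_sum d d (\<lambda>x. kraus_map d (Ks x) \<rho>) {..<m} = kraus_map d (concat (map Ks [0..<m])) \<rho>"
proof (induction m)
  case 0
  show ?case by (intro eq_matI) (auto simp: mat_sum_def kraus_map_Nil)
next
  case (Suc m)
  have "mat_sum d d (\<lambda>x. kraus_map d (Ks x) \<rho>) {..<Suc m}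
      = mat_sum d d (\<lambda>x. kraus_map d (Ks x) \<rho>) {..<m} + kraus_map d (Ks m) \<rho>"
    by (intro eq_matI) (auto simp: mat_sum_def)
  then show ?case
    using Suc by (simp add: kraus_map_append)
qed

abbreviation tensor_list :: "(complex mat \<times> complex mat) list \<Rightarrow> complex mat list" where
  "tensor_list Ks \<equiv> map (\<lambda>(A, B). A \<otimes>\<^sub>m B) Ks"

text \<open>Forgetting the outcome adds the maps, which amounts to joining their lists of product
  Kraus operators.\<close>

lemma separable_sum:
  fixes m :: nat
  assumes "\<And>x. x < m \<Longrightarrow> \<exists>Ks. set Ks \<subseteq> carrier_mat a' a \<times> carrier_mat b' b \<and>
      F x = kraus_map (a' * b') (tensor_list Ks)"
  shows "\<exists>Ks. set Ks \<subseteq> carrier_mat a' a \<times> carrier_mat b' b \<and>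
    (\<lambda>\<rho>. mat_sum (a' * b') (a' * b') (\<lambda>x. F x \<rho>) {..<m}) = kraus_map (a' * b') (tensor_list Ks)"
proof -
  obtain Ks where Ks: "\<And>x. x < m \<Longrightarrow> set (Ks x) \<subseteq> carrier_mat a' a \<times> carrier_mat b' b \<and>
      F x = kraus_map (a' * b') (tensor_list (Ks x))"
    using assms by metis
  have "mat_sum (a' * b') (a' * b') (\<lambda>x. F x \<rho>) {..<m}
      = mat_sum (a' * b') (a' * b') (\<lambda>x. kraus_map (a' * b') (tensor_list (Ks x)) \<rho>) {..<m}" for \<rho>
    using Ks by (simp add: mat_sum_def)
  then have "mat_sum (a' * b') (a' * b') (\<lambda>x. F x \<rho>) {..<m}
      = kraus_map (a' * b') (tensor_list (concat (map Ks [0..<m]))) \<rho>" for \<rho>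
    by (simp add: mat_sum_kraus_map[where Ks = "\<lambda>x. tensor_list (Ks x)"] map_concat comp_def)
  moreover have "set (concat (map Ks [0..<m])) \<subseteq> carrier_mat a' a \<times> carrier_mat b' b"
    using Ks by fastforce
  ultimately show ?thesis by blast
qed

text \<open>Each round multiplies only one tensor factor of every Kraus operator, so product form
  survives the induction over the protocol. Inputs are restricted to \<open>carrier_mat\<close>
  since the identity map of \<open>finish\<close> agrees with a Kraus map only on matrices of the
  right size.\<close>

lemma locc_separable:
  assumes "locc a' b' a b \<Lambda>"
  shows "\<exists>Ks. set Ks \<subseteq> carrier_mat a' a \<times> carrier_mat b' b \<and>
    (\<forall>\<rho>\<in>carrier_mat (a * b) (a * b). \<Lambda> \<rho> = kraus_map (a' * b') (tensor_list Ks) \<rho>)"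
  using assms
proof (induction rule: locc.induct)
  case finish
  have "kraus_map (a' * b') (tensor_list [(1\<^sub>m a', 1\<^sub>m b')]) \<rho> = \<rho>"
    if "\<rho> \<in> carrier_mat (a' * b') (a' * b')" for \<rho>
    using that by (simp add: tensor_one kraus_map_single[of _ _ "a' * b'"])
  then show ?case by (intro exI[of _ "[(1\<^sub>m a', 1\<^sub>m b')]"]) auto
next
  case (alice a m ds Es b \<Lambda>)
  then obtain Ks where Ks: "\<And>x. x < m \<Longrightarrow> set (Ks x) \<subseteq> carrier_mat a' (ds x) \<times> carrier_mat b' b \<and>
      (\<forall>\<rho>\<in>carrier_mat (ds x * b) (ds x * b). \<Lambda> x \<rho> = kraus_map (a' * b') (tensor_list (Ks x)) \<rho>)"
    by metis
  \<comment> \<open>A product operator of the continuation, composed with the step of Alice: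
    \<open>(A \<otimes>\<^sub>m B) * (E \<otimes>\<^sub>m 1\<^sub>m b) = (A * E) \<otimes>\<^sub>m
    B\<close>.\<close>
  define Ls where "Ls x = concat (map (\<lambda>(A, B). map (\<lambda>E. (A * E, B)) (Es x)) (Ks x))" for x
  have Es: "set (Es x) \<subseteq> carrier_mat (ds x) a" if "x < m" for x
    using alice(1) that by (simp add: instrument_def)
  have Ls: "set (Ls x) \<subseteq> carrier_mat a' a \<times> carrier_mat b' b" if "x < m" for x
    using Ks[OF that] Es[OF that] by (fastforce simp: Ls_def)
  have step: "\<Lambda> x (kraus_map (ds x * b) (map (\<lambda>E. E \<otimes>\<^sub>m 1\<^sub>m b) (Es x)) \<rho>)
      = kraus_map (a' * b') (tensor_list (Ls x)) \<rho>"
    if x: "x < m" and \<rho>: "\<rho> \<in> carrier_mat (a * b) (a * b)" for x \<rho>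
  proof -
    have "concat (map (\<lambda>L. map (\<lambda>K. L * K) (map (\<lambda>E. E \<otimes>\<^sub>m 1\<^sub>m b) (Es x))) (tensor_list (Ks x)))
        = tensor_list (Ls x)"
      using Ks[OF x] Es[OF x]
      by (force simp: Ls_def map_concat comp_def tensor_mult intro!: arg_cong[of _ _ concat])
    moreover have "set (tensor_list (Ks x)) \<subseteq> carrier_mat (a' * b') (ds x * b)"
      using Ks[OF x] by (auto intro: tensor_carrier)
    moreover have "set (map (\<lambda>E. E \<otimes>\<^sub>m 1\<^sub>m b) (Es x)) \<subseteq> carrier_mat (ds x * b) (a * b)"
      using Es[OF x] by (auto intro: tensor_carrier)
    ultimately show ?thesis
      using Ks[OF x] kraus_map_comp[OF _ _ \<rho>] by simp
  qed
  obtain Ks' where Ks': "set Ks' \<subseteq> carrier_mat a' a \<times> carrier_mat b' b"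
    "(\<lambda>\<rho>. mat_sum (a' * b') (a' * b') (\<lambda>x. kraus_map (a' * b') (tensor_list (Ls x)) \<rho>) {..<m})
      = kraus_map (a' * b') (tensor_list Ks')"
    using separable_sum[of m a' a b' b "\<lambda>x. kraus_map (a' * b') (tensor_list (Ls x))"] Ls by blast
  have "mat_sum (a' * b') (a' * b')
      (\<lambda>x. \<Lambda> x (kraus_map (ds x * b) (map (\<lambda>E. E \<otimes>\<^sub>m 1\<^sub>m b) (Es x)) \<rho>)) {..<m}
      = kraus_map (a' * b') (tensor_list Ks') \<rho>" if "\<rho> \<in> carrier_mat (a * b) (a * b)" for \<rho>
    using fun_cong[OF Ks'(2), of \<rho>] step[OF _ that] by (simp add: mat_sum_def cong: sum.cong_simp)
  then show ?case using Ks'(1) by blast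
next
  case (bob b m ds Es a \<Lambda>)
  then obtain Ks where Ks: "\<And>x. x < m \<Longrightarrow> set (Ks x) \<subseteq> carrier_mat a' a \<times> carrier_mat b' (ds x) \<and>
      (\<forall>\<rho>\<in>carrier_mat (a * ds x) (a * ds x). \<Lambda> x \<rho> = kraus_map (a' * b') (tensor_list (Ks x)) \<rho>)"
    by metis
  define Ls where "Ls x = concat (map (\<lambda>(A, B). map (\<lambda>E. (A, B * E)) (Es x)) (Ks x))" for x
  have Es: "set (Es x) \<subseteq> carrier_mat (ds x) b" if "x < m" for x
    using bob(1) that by (simp add: instrument_def)
  have Ls: "set (Ls x) \<subseteq> carrier_mat a' a \<times> carrier_mat b' b" if "x < m" for x
    using Ks[OF that] Es[OF that] by (fastforce simp: Ls_def)
  have step: "\<Lambda> x (kraus_map (a * ds x) (map (\<lambda>E. 1\<^sub>m a \<otimes>\<^sub>m E) (Es x)) \<rho>)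
      = kraus_map (a' * b') (tensor_list (Ls x)) \<rho>"
    if x: "x < m" and \<rho>: "\<rho> \<in> carrier_mat (a * b) (a * b)" for x \<rho>
  proof -
    have "concat (map (\<lambda>L. map (\<lambda>K. L * K) (map (\<lambda>E. 1\<^sub>m a \<otimes>\<^sub>m E) (Es x))) (tensor_list (Ks x)))
        = tensor_list (Ls x)"
      using Ks[OF x] Es[OF x]
      by (force simp: Ls_def map_concat comp_def tensor_mult intro!: arg_cong[of _ _ concat])
    moreover have "set (tensor_list (Ks x)) \<subseteq> carrier_mat (a' * b') (a * ds x)"
      using Ks[OF x] by (auto intro: tensor_carrier)
    moreover have "set (map (\<lambda>E. 1\<^sub>m a \<otimes>\<^sub>m E) (Es x)) \<subseteq> carrier_mat (a * ds x) (a * b)"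
      using Es[OF x] by (auto intro: tensor_carrier)
    ultimately show ?thesis
      using Ks[OF x] kraus_map_comp[OF _ _ \<rho>] by simp
  qed
  obtain Ks' where Ks': "set Ks' \<subseteq> carrier_mat a' a \<times> carrier_mat b' b"
    "(\<lambda>\<rho>. mat_sum (a' * b') (a' * b') (\<lambda>x. kraus_map (a' * b') (tensor_list (Ls x)) \<rho>) {..<m})
      = kraus_map (a' * b') (tensor_list Ks')"
    using separable_sum[of m a' a b' b "\<lambda>x. kraus_map (a' * b') (tensor_list (Ls x))"] Ls by blast
  have "mat_sum (a' * b') (a' * b')
      (\<lambda>x. \<Lambda> x (kraus_map (a * ds x) (map (\<lambda>E. 1\<^sub>m a \<otimes>\<^sub>m E) (Es x)) \<rho>)) {..<m}
      = kraus_map (a' * b') (tensor_list Ks') \<rho>" if "\<rho> \<in> carrier_mat (a * b) (a * b)" for \<rho>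
    using fun_cong[OF Ks'(2), of \<rho>] step[OF _ that] by (simp add: mat_sum_def cong: sum.cong_simp)
  then show ?case using Ks'(1) by blast
qed

section \<open>Separable maps between pure states\<close>

lemma ketbra_carrier [simp]: "v \<in> carrier_vec n \<Longrightarrow> w \<in> carrier_vec m \<Longrightarrow> ketbra v w \<in> carrier_mat n m"
  by (simp add: ketbra_def)

lemma conj_ketbra:
  assumes K: "K \<in> carrier_mat m n" and v: "v \<in> carrier_vec n"
  shows "K * ketbra v v * K\<^sup>\<dagger> = ketbra (K *\<^sub>v v) (K *\<^sub>v v)"
proof (intro eq_matI)
  fix i j assume "i < dim_row (ketbra (K *\<^sub>v v) (K *\<^sub>v v))" "j < dim_col (ketbra (K *\<^sub>v v) (K *\<^sub>v v))"
  then have ij: "i < m" "j < m" using K by (auto simp: ketbra_def)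
  have "(K * ketbra v v * K\<^sup>\<dagger>) $$ (i, j)
      = (\<Sum>l<n. (\<Sum>k<n. K $$ (i, k) * (v $ k * cnj (v $ l))) * cnj (K $$ (j, l)))"
    using ij K v by (simp add: index_mult_sum[of _ _ _ _ n] ketbra_def del: index_mult_mat(1) assoc_mult_mat)
  also have "\<dots> = (\<Sum>l<n. (\<Sum>k<n. K $$ (i, k) * v $ k) * (cnj (K $$ (j, l)) * cnj (v $ l)))"
    by (simp add: sum_distrib_left sum_distrib_right ac_simps)
  also have "\<dots> = (\<Sum>k<n. K $$ (i, k) * v $ k) * cnj (\<Sum>l<n. K $$ (j, l) * v $ l)"
    by (simp add: sum_distrib_left)
  also have "\<dots> = ketbra (K *\<^sub>v v) (K *\<^sub>v v) $$ (i, j)"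
    using ij K v by (simp add: ketbra_def index_mult_mat_vec_sum[of _ _ n] del: index_mult_mat_vec)
  finally show "(K * ketbra v v * K\<^sup>\<dagger>) $$ (i, j) = ketbra (K *\<^sub>v v) (K *\<^sub>v v) $$ (i, j)" .
qed (use K in \<open>auto simp: ketbra_def\<close>)

lemma sum_list_norm_zero:
  assumes "(\<Sum>x\<leftarrow>xs. f x * cnj (f x)) = 0" and "x \<in> set xs"
  shows "f x = 0"
proof -
  have "(\<Sum>x\<leftarrow>xs. f x * cnj (f x)) = complex_of_real (\<Sum>x\<leftarrow>xs. (cmod (f x))\<^sup>2)"
    by (induction xs) (simp_all add: complex_norm_square del: of_real_power)
  then have "(\<Sum>x\<leftarrow>xs. (cmod (f x))\<^sup>2) = 0"
    using assms(1) by simp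
  then show ?thesis
    using assms(2) by (subst (asm) sum_list_nonneg_eq_0_iff) auto
qed

text \<open>A decomposition of a pure state is trivial, since
  \<open>\<Sum>\<^sub>k \<bar>u\<^sub>q w\<^sub>k\<^sub>p - u\<^sub>p w\<^sub>k\<^sub>q\<bar>\<^sup>2 = 0\<close> whenever \<open>\<Sum>\<^sub>k |w\<^sub>k\<rangle>\<langle>w\<^sub>k| = |u\<rangle>\<langle>u|\<close>.\<close>

lemma pure_decomposition:
  assumes w: "\<And>x. x \<in> set xs \<Longrightarrow> w x \<in> carrier_vec d" and u: "u \<in> carrier_vec d"
    and eq: "\<And>i j. i < d \<Longrightarrow> j < d \<Longrightarrow> (\<Sum>x\<leftarrow>xs. w x $ i * cnj (w x $ j)) = u $ i * cnj (u $ j)"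
    and q: "q < d" "u $ q \<noteq> 0"
  shows "x \<in> set xs \<Longrightarrow> w x = (w x $ q / u $ q) \<cdot>\<^sub>v u" and "\<exists>x\<in>set xs. w x $ q \<noteq> 0"
proof -
  have minor: "u $ q * w x $ p - u $ p * w x $ q = 0" if x: "x \<in> set xs" and p: "p < d" for x p
  proof (rule sum_list_norm_zero[OF _ x])
    let ?a = "u $ q" and ?b = "u $ p"
    have "(\<Sum>x\<leftarrow>xs. (?a * w x $ p - ?b * w x $ q) * cnj (?a * w x $ p - ?b * w x $ q))
      = ?a * cnj ?a * (\<Sum>x\<leftarrow>xs. w x $ p * cnj (w x $ p))
        - ?a * cnj ?b * (\<Sum>x\<leftarrow>xs. w x $ p * cnj (w x $ q))
        - ?b * cnj ?a * (\<Sum>x\<leftarrow>xs. w x $ q * cnj (w x $ p))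
        + ?b * cnj ?b * (\<Sum>x\<leftarrow>xs. w x $ q * cnj (w x $ q))"
      by (induction xs) (simp_all add: algebra_simps)
    also have "\<dots> = 0"
      unfolding eq[OF p p] eq[OF p q(1)] eq[OF q(1) p] eq[OF q(1) q(1)] by (simp add: algebra_simps)
    finally show "(\<Sum>x\<leftarrow>xs. (?a * w x $ p - ?b * w x $ q) * cnj (?a * w x $ p - ?b * w x $ q)) = 0" .
  qed
  show "w x = (w x $ q / u $ q) \<cdot>\<^sub>v u" if "x \<in> set xs"
  proof (intro eq_vecI)
    fix p assume "p < dim_vec ((w x $ q / u $ q) \<cdot>\<^sub>v u)"
    then have "p < d" using u by simp
    then show "w x $ p = ((w x $ q / u $ q) \<cdot>\<^sub>v u) $ p"
      using minor[OF that] q u by (simp add: field_simps)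
  qed (use w[OF that] u in simp)
  show "\<exists>x\<in>set xs. w x $ q \<noteq> 0"
  proof (rule ccontr)
    assume "\<not> ?thesis"
    then have "(\<Sum>x\<leftarrow>xs. w x $ q * cnj (w x $ q)) = (\<Sum>x\<leftarrow>xs. 0)"
      by (intro arg_cong[of _ _ sum_list] map_cong) auto
    then show False using eq[OF q(1) q(1)] q(2) by simp
  qed
qed

text \<open>Since each output is pure, every Kraus operator sends \<open>v j\<close> to a multiple
  of \<open>u j\<close>. One operator that does not annihilate \<open>v 0\<close> is kept for all
  \<open>j\<close>; the multiples for other \<open>j\<close> might still vanish, so only
  \<open>c 0\<close> is asserted to be nonzero.\<close>

lemma locc_pure_transform:
  assumes locc: "locc a' b' a b \<Lambda>"
    and v: "\<And>j. j < N \<Longrightarrow> v j \<in> carrier_vec (a * b)"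
    and u: "\<And>j. j < N \<Longrightarrow> u j \<in> carrier_vec (a' * b')" "\<And>j. j < N \<Longrightarrow> u j \<noteq> 0\<^sub>v (a' * b')"
    and eq: "\<And>j. j < N \<Longrightarrow> \<Lambda> (ketbra (v j) (v j)) = ketbra (u j) (u j)"
    and "0 < N"
  obtains A B c where "A \<in> carrier_mat a' a" "B \<in> carrier_mat b' b" "c 0 \<noteq> 0"
    "\<And>j. j < N \<Longrightarrow> (A \<otimes>\<^sub>m B) *\<^sub>v v j = c j \<cdot>\<^sub>v u j"
proof -
  obtain Ks where Ks: "set Ks \<subseteq> carrier_mat a' a \<times> carrier_mat b' b"
    and \<Lambda>: "\<And>\<rho>. \<rho> \<in> carrier_mat (a * b) (a * b) \<Longrightarrow> \<Lambda> \<rho> = kraus_map (a' * b') (tensor_list Ks) \<rho>"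
    using locc_separable[OF locc] by blast
  have T: "set (tensor_list Ks) \<subseteq> carrier_mat (a' * b') (a * b)"
    using Ks by (auto intro: tensor_carrier)
  have entries: "(\<Sum>K\<leftarrow>tensor_list Ks. (K *\<^sub>v v j) $ p * cnj ((K *\<^sub>v v j) $ q)) = u j $ p * cnj (u j $ q)"
    if j: "j < N" and p: "p < a' * b'" "q < a' * b'" for j p q
  proof -
    have "(\<Sum>K\<leftarrow>tensor_list Ks. (K *\<^sub>v v j) $ p * cnj ((K *\<^sub>v v j) $ q))
        = (\<Sum>K\<leftarrow>tensor_list Ks. (K * ketbra (v j) (v j) * K\<^sup>\<dagger>) $$ (p, q))"
    proof (intro arg_cong[of _ _ sum_list] map_cong refl)
      fix K assume "K \<in> set (tensor_list Ks)"
      then have K: "K \<in> carrier_mat (a' * b') (a * b)" using T by blast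
      show "(K *\<^sub>v v j) $ p * cnj ((K *\<^sub>v v j) $ q) = (K * ketbra (v j) (v j) * K\<^sup>\<dagger>) $$ (p, q)"
        unfolding conj_ketbra[OF K v[OF j]] using K p by (simp add: ketbra_def del: index_mult_mat_vec)
    qed
    also have "\<dots> = \<Lambda> (ketbra (v j) (v j)) $$ (p, q)"
      using v[OF j] p by (simp add: \<Lambda> index_kraus_map del: index_mult_mat(1) assoc_mult_mat)
    also have "\<dots> = u j $ p * cnj (u j $ q)"
      unfolding eq[OF j] using u(1)[OF j] p by (simp add: ketbra_def)
    finally show ?thesis .
  qed
  have nz: "\<exists>q. q < a' * b' \<and> u j $ q \<noteq> 0" if "j < N" for j
  proof (rule ccontr)
    assume "\<not> ?thesis"
    then have "u j = 0\<^sub>v (a' * b')"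
      using u(1)[OF that] by (intro eq_vecI) auto
    then show False using u(2)[OF that] by simp
  qed
  have w: "K *\<^sub>v v j \<in> carrier_vec (a' * b')" if "K \<in> set (tensor_list Ks)" for K j
    using T that by (intro carrier_vecI) auto
  have parallel: "\<exists>c. K *\<^sub>v v j = c \<cdot>\<^sub>v u j" if "j < N" "K \<in> set (tensor_list Ks)" for j K
    using nz[OF that(1)] pure_decomposition(1)[OF w u(1)[OF that(1)] entries[OF that(1)] _ _ that(2)]
    by blast
  obtain q where q: "q < a' * b'" "u 0 $ q \<noteq> 0" using nz[OF \<open>0 < N\<close>] by blast
  \<comment> \<open>The output has a nonzero diagonal entry at \<open>q\<close>, so some Kraus
    operator must contribute there.\<close>
  obtain K where K: "K \<in> set (tensor_list Ks)" "(K *\<^sub>v v 0) $ q \<noteq> 0"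
    using pure_decomposition(2)[OF w u(1)[OF \<open>0 < N\<close>] entries[OF \<open>0 < N\<close>] q] by blast
  then obtain A B where AB: "(A, B) \<in> set Ks" "K = A \<otimes>\<^sub>m B" by auto
  obtain c where c: "\<And>j. j < N \<Longrightarrow> K *\<^sub>v v j = c j \<cdot>\<^sub>v u j"
    using parallel[OF _ K(1)] by metis
  have "c 0 \<noteq> 0"
    using K(2) q u(1)[OF \<open>0 < N\<close>] unfolding c[OF \<open>0 < N\<close>] by auto
  with that[of A B c] AB Ks c show ?thesis by auto
qed

section \<open>Local unitaries as protocols\<close>

lemma instrument_unitary:
  assumes "unitary d U"
  shows "instrument d 1 (\<lambda>_. d) (\<lambda>_. [U])"
  using unitaryD[OF assms]
  by (auto simp: instrument_def mat_sum_def simp del: index_mult_mat(1) intro!: eq_matI)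

text \<open>One round for each party with a single outcome, so the announcements carry no
  information.\<close>

lemma locc_local_unitary:
  assumes A: "unitary a A" and B: "unitary b B"
  shows "\<exists>\<Lambda>. locc a b a b \<Lambda> \<and> (\<forall>v\<in>carrier_vec (a * b).
    \<Lambda> (ketbra v v) = ketbra ((A \<otimes>\<^sub>m B) *\<^sub>v v) ((A \<otimes>\<^sub>m B) *\<^sub>v v))"
proof -
  have single: "mat_sum d d (\<lambda>_. M) {..<Suc 0} = M" if "dim_row M = d" "dim_col M = d" for d M
    using that by (intro eq_matI) (auto simp: mat_sum_def)
  let ?\<Lambda>B = "\<lambda>\<rho>. mat_sum (a * b) (a * b) (\<lambda>_. kraus_map (a * b) (map (\<lambda>E. 1\<^sub>m a \<otimes>\<^sub>m E) [B]) \<rho>) {..<1::nat}"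
  let ?\<Lambda> = "\<lambda>\<rho>. mat_sum (a * b) (a * b)
    (\<lambda>_. ?\<Lambda>B (kraus_map (a * b) (map (\<lambda>E. E \<otimes>\<^sub>m 1\<^sub>m b) [A]) \<rho>)) {..<1::nat}"
  have "locc a b a b ?\<Lambda>B"
    using instrument_unitary[OF B] by (rule locc.bob) (rule locc.finish)
  with instrument_unitary[OF A] have "locc a b a b ?\<Lambda>"
    by (rule locc.alice)
  moreover have "?\<Lambda> (ketbra v v) = ketbra ((A \<otimes>\<^sub>m B) *\<^sub>v v) ((A \<otimes>\<^sub>m B) *\<^sub>v v)"
    if v: "v \<in> carrier_vec (a * b)" for v
  proof -
    note AC = unitaryD(1-3)[OF A] and BC = unitaryD(1-3)[OF B]
    have c: "A \<otimes>\<^sub>m 1\<^sub>m b \<in> carrier_mat (a * b) (a * b)" "1\<^sub>m a \<otimes>\<^sub>m B \<in> carrier_mat (a * b) (a * b)"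
      using AC BC by (auto intro: tensor_carrier)
    have "?\<Lambda> (ketbra v v) = (1\<^sub>m a \<otimes>\<^sub>m B) * ((A \<otimes>\<^sub>m 1\<^sub>m b) * ketbra v v * (A \<otimes>\<^sub>m 1\<^sub>m b)\<^sup>\<dagger>) * (1\<^sub>m a \<otimes>\<^sub>m B)\<^sup>\<dagger>"
      using c AC(2,3) BC(2,3) by (simp add: single kraus_map_single[of _ _ "a * b"] del: assoc_mult_mat)
    also have "\<dots> = ketbra ((1\<^sub>m a \<otimes>\<^sub>m B) *\<^sub>v ((A \<otimes>\<^sub>m 1\<^sub>m b) *\<^sub>v v)) ((1\<^sub>m a \<otimes>\<^sub>m B) *\<^sub>v ((A \<otimes>\<^sub>m 1\<^sub>m b) *\<^sub>v v))"
      unfolding conj_ketbra[OF c(1) v] using c v by (intro conj_ketbra) auto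
    also have "(1\<^sub>m a \<otimes>\<^sub>m B) *\<^sub>v ((A \<otimes>\<^sub>m 1\<^sub>m b) *\<^sub>v v) = ((1\<^sub>m a \<otimes>\<^sub>m B) * (A \<otimes>\<^sub>m 1\<^sub>m b)) *\<^sub>v v"
      using c v by (intro assoc_mult_mat_vec[symmetric]) auto
    also have "(1\<^sub>m a \<otimes>\<^sub>m B) * (A \<otimes>\<^sub>m 1\<^sub>m b) = A \<otimes>\<^sub>m B"
      using AC BC by (simp add: tensor_mult)
    finally show ?thesis .
  qed
  ultimately show ?thesis by blast
qed

section \<open>Clock form of locally copiable families\<close>

definition state_op :: "nat \<Rightarrow> complex vec \<Rightarrow> complex mat" where
  "state_op n \<psi> = complex_of_real (sqrt (real n)) \<cdot>\<^sub>m vmat n n \<psi>"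

lemma state_op_carrier [simp]: "state_op n \<psi> \<in> carrier_mat n n"
  by (simp add: state_op_def)

lemma dim_state_op [simp]: "dim_row (state_op n \<psi>) = n" "dim_col (state_op n \<psi>) = n"
  by (simp_all add: state_op_def)

lemma sqrt_cancel:
  assumes "n > 0"
  shows "complex_of_real (sqrt (real n)) * complex_of_real (1 / sqrt (real n)) = 1"
  using assms by (simp flip: of_real_mult)

lemma vmat_eq_state_op:
  assumes "n > 0"
  shows "vmat n n \<psi> = complex_of_real (1 / sqrt (real n)) \<cdot>\<^sub>m state_op n \<psi>"
  using sqrt_cancel[OF assms] by (simp add: state_op_def smult_smult_mat one_smult_mat mult.commute)

lemma state_op_eqD:
  assumes "n > 0" "state_op n \<psi> = state_op n \<phi>" "\<psi> \<in> carrier_vec (n * n)" "\<phi> \<in> carrier_vec (n * n)"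
  shows "\<psi> = \<phi>"
  using assms by (metis vmat_eqD vmat_eq_state_op)

lemma state_op_smult:
  assumes "\<psi> \<in> carrier_vec (n * n)"
  shows "state_op n (c \<cdot>\<^sub>v \<psi>) = c \<cdot>\<^sub>m state_op n \<psi>"
  using assms by (simp add: state_op_def vmat_smult smult_smult_mat mult.commute)

lemma state_op_apply:
  assumes "A \<in> carrier_mat n n" "B \<in> carrier_mat n n" "\<psi> \<in> carrier_vec (n * n)"
  shows "state_op n ((A \<otimes>\<^sub>m B) *\<^sub>v \<psi>) = A * state_op n \<psi> * B\<^sup>T"
  using assms by (simp add: state_op_def vmat_tensor_apply mat_simps)

lemma max_entangled_state_op:
  assumes "n > 0" and "max_entangled n \<psi>"
  shows "unitary n (state_op n \<psi>)" and "\<psi> \<in> carrier_vec (n * n)"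
proof -
  obtain e f where e: "onb n e" and f: "onb n f" and \<psi>: "\<psi> = diag_state n e f"
    using assms(2) by (auto simp: max_entangled_def)
  have "state_op n \<psi> = onb_mat n e * (onb_mat n f)\<^sup>T"
    unfolding state_op_def \<psi> vmat_diag_state(2)[OF e f]
    using sqrt_cancel[OF assms(1)] by (simp only: smult_smult_mat one_smult_mat)
  then show "unitary n (state_op n \<psi>)"
    using e f by (simp add: unitary_mult unitary_transpose unitary_onb_mat)
  show "\<psi> \<in> carrier_vec (n * n)"
    unfolding \<psi> by (rule vmat_diag_state(1)[OF e f])
qed

lemma bell_state_op:
  assumes "n > 0" and g: "onb n g" and h: "onb n h"
  shows "state_op n (bell_state n g h a b) = onb_mat n g * (clock n a * shift n b) * (onb_mat n h)\<^sup>T"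
  unfolding state_op_def vmat_bell_state(2)[OF g h]
  using sqrt_cancel[OF assms(1)] by (simp only: smult_smult_mat one_smult_mat)

text \<open>The algebraic content shared by both sides of the theorem.\<close>

definition clock_form :: "nat \<Rightarrow> nat \<Rightarrow> (nat \<Rightarrow> complex vec) \<Rightarrow> bool" where
  "clock_form n N \<Psi> \<longleftrightarrow> (\<exists>X. unitary n X \<and> (\<forall>j<N. \<exists>i<n. \<exists>c. cmod c = 1 \<and>
    state_op n (\<Psi> j) * (state_op n (\<Psi> 0))\<^sup>\<dagger> = c \<cdot>\<^sub>m (X * clock n i * X\<^sup>\<dagger>)))"

section \<open>From copying to clock form\<close>

lemma locally_copiable_imp_clock_form:
  assumes prime: "prime n" and N: "0 < N" and me: "\<forall>j<N. max_entangled n (\<Psi> j)"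
    and "locally_copiable n N \<Psi>"
  shows "clock_form n N \<Psi>"
proof -
  have n: "n > 0" using prime by (rule prime_gt_0_nat)
  define U where "U j = state_op n (\<Psi> j)" for j
  have U: "unitary n (U j)" and \<Psi>: "\<Psi> j \<in> carrier_vec (n * n)" if "j < N" for j
    using max_entangled_state_op[OF n me[rule_format, OF that]] by (auto simp: U_def)
  have U_carrier [simp]: "dim_row (U j) = n" "dim_col (U j) = n" "U j \<in> carrier_mat n n" for j
    by (simp_all add: U_def)
  obtain b \<Lambda> where b: "b \<in> carrier_vec (n * n)" and locc: "locc (n * n) (n * n) (n * n) (n * n) \<Lambda>"
    and copy: "\<And>j. j < N \<Longrightarrow> \<Lambda> (regroup n (ketbra (\<Psi> j) (\<Psi> j) \<otimes>\<^sub>m ketbra b b)) =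
            regroup n (ketbra (\<Psi> j) (\<Psi> j) \<otimes>\<^sub>m ketbra (\<Psi> j) (\<Psi> j))"
    using assms(4) by (auto simp: locally_copiable_def unit_state_def)
  define s where "s = complex_of_real (1 / sqrt (real n))"
  have s: "s \<noteq> 0" using n by (simp add: s_def)
  have vmat: "vmat n n (\<Psi> j) = s \<cdot>\<^sub>m U j" for j
    unfolding s_def U_def by (rule vmat_eq_state_op[OF n])
  define v where "v j = regroup_vec n (\<Psi> j \<otimes>\<^sub>v b)" for j
  define u where "u j = regroup_vec n (\<Psi> j \<otimes>\<^sub>v \<Psi> j)" for j
  have vmat_v: "vmat (n * n) (n * n) (v j) = s \<cdot>\<^sub>m (U j \<otimes>\<^sub>m vmat n n b)" if "j < N" for j
    unfolding v_def vmat_regroup_vec[OF \<Psi>[OF that] b] vmat by (rule tensor_smult_left)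
  have vmat_u: "vmat (n * n) (n * n) (u j) = (s * s) \<cdot>\<^sub>m (U j \<otimes>\<^sub>m U j)" if "j < N" for j
    unfolding u_def vmat_regroup_vec[OF \<Psi>[OF that] \<Psi>[OF that]] vmat
    by (simp add: tensor_smult_left tensor_smult_right smult_smult_mat)
  have u_nz: "u j \<noteq> 0\<^sub>v ((n * n) * (n * n))" if "j < N" for j
  proof
    assume "u j = 0\<^sub>v ((n * n) * (n * n))"
    then have "vmat (n * n) (n * n) (u j) = 0 \<cdot>\<^sub>m (U j \<otimes>\<^sub>m U j)"
      by (intro eq_matI) (auto simp: vmat_def digits_less)
    then have "s * s = 0"
      unfolding vmat_u[OF that]
      using unitaryD[OF unitary_tensor[OF U[OF that] U[OF that]]] n
      by (intro invertible_smult_eqD[of "s * s" "U j \<otimes>\<^sub>m U j" 0 "(U j \<otimes>\<^sub>m U j)\<^sup>\<dagger>" "n * n"]) auto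
    then show False using s by simp
  qed
  have transform: "\<Lambda> (ketbra (v j) (v j)) = ketbra (u j) (u j)" if "j < N" for j
    using copy[OF that] unfolding regroup_ketbra[OF \<Psi>[OF that] b] regroup_ketbra[OF \<Psi>[OF that] \<Psi>[OF that]]
    by (simp add: v_def u_def)
  obtain A B c where A: "A \<in> carrier_mat (n * n) (n * n)" and B: "B \<in> carrier_mat (n * n) (n * n)"
    and c0: "c 0 \<noteq> 0" and AB: "\<And>j. j < N \<Longrightarrow> (A \<otimes>\<^sub>m B) *\<^sub>v v j = c j \<cdot>\<^sub>v u j"
    using locc_pure_transform[OF locc, of N v u] u_nz transform N by (auto simp: v_def u_def)
  \<comment> \<open>The input has one factor \<open>s\<close> from \<open>\<Psi> j\<close> while the
    blank state is kept as it is, and the output has two; one \<open>s\<close> remains.\<close>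
  define d where "d j = c j * s" for j
  have key: "A * (U j \<otimes>\<^sub>m vmat n n b) * B\<^sup>T = d j \<cdot>\<^sub>m (U j \<otimes>\<^sub>m U j)" if j: "j < N" for j
  proof -
    have "A * vmat (n * n) (n * n) (v j) * B\<^sup>T = vmat (n * n) (n * n) ((A \<otimes>\<^sub>m B) *\<^sub>v v j)"
      using A B by (intro vmat_tensor_apply[symmetric]) (auto simp: v_def)
    also have "\<dots> = c j \<cdot>\<^sub>m vmat (n * n) (n * n) (u j)"
      unfolding AB[OF j] by (intro vmat_smult) (simp add: u_def)
    finally have "s \<cdot>\<^sub>m (A * (U j \<otimes>\<^sub>m vmat n n b) * B\<^sup>T) = (c j * (s * s)) \<cdot>\<^sub>m (U j \<otimes>\<^sub>m U j)"
      unfolding vmat_v[OF j] vmat_u[OF j] using A B by (simp add: mat_simps)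
    then have "(1 / s) \<cdot>\<^sub>m (s \<cdot>\<^sub>m (A * (U j \<otimes>\<^sub>m vmat n n b) * B\<^sup>T))
        = (1 / s) \<cdot>\<^sub>m ((c j * (s * s)) \<cdot>\<^sub>m (U j \<otimes>\<^sub>m U j))"
      by simp
    then show ?thesis
      using s by (simp add: smult_smult_mat one_smult_mat d_def del: assoc_mult_mat)
  qed
  have d0: "d 0 \<noteq> 0" using c0 s by (simp add: d_def)
  let ?UU = "U 0 \<otimes>\<^sub>m U 0"
  note UU = unitary_tensor[OF U[OF N] U[OF N]]
  \<comment> \<open>Chosen so that the copying equation for \<open>j = 0\<close>, multiplied by the
    inverse of \<open>U 0 \<otimes>\<^sub>m U 0\<close> and divided by \<open>d 0\<close>, becomes
    \<open>A * R = 1\<close>. The blank state and the operator of Bob are absorbed into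
    \<open>R\<close>, without any assumption that they are invertible.\<close>
  define C where "C = (1 / d 0) \<cdot>\<^sub>m (B\<^sup>T * ?UU\<^sup>\<dagger>)"
  have C_dim: "dim_row C = n * n" "dim_col C = n * n"
    using B by (auto simp: C_def)
  have keyC: "A * ((U j \<otimes>\<^sub>m vmat n n b) * C) = (d j / d 0) \<cdot>\<^sub>m ((U j \<otimes>\<^sub>m U j) * ?UU\<^sup>\<dagger>)" if "j < N" for j
  proof -
    have "A * ((U j \<otimes>\<^sub>m vmat n n b) * C) = (1 / d 0) \<cdot>\<^sub>m ((A * (U j \<otimes>\<^sub>m vmat n n b) * B\<^sup>T) * ?UU\<^sup>\<dagger>)"
      using A B by (simp add: C_def mat_simps)
    then show ?thesis
      unfolding key[OF that] by (simp add: mat_simps)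
  qed
  define R where "R = (U 0 \<otimes>\<^sub>m vmat n n b) * C"
  have R: "R \<in> carrier_mat (n * n) (n * n)"
    using C_dim by (intro carrier_matI) (auto simp: R_def)
  have AR: "A * R = 1\<^sub>m (n * n)"
    unfolding R_def keyC[OF N] unitaryD(5)[OF UU] using d0 by (simp add: one_smult_mat)
  interpret copier n A R
    using prime A R AR mat_mult_left_right_inverse[OF A R AR] by unfold_locales
  define W where "W j = U j * (U 0)\<^sup>\<dagger>" for j
  have W_dim [simp]: "dim_row (W j) = n" "dim_col (W j) = n" for j
    by (simp_all add: W_def)
  have W: "W j \<in> copy_group n A" if j: "j < N" for j
  proof -
    have WU: "W j * U 0 = U j"
      using unitaryD[OF U[OF N]] by (simp add: W_def mult_assoc_dim)
    \<comment> \<open>Writing \<open>U j\<close> as \<open>W j * U 0\<close> separates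
      \<open>W j \<otimes>\<^sub>m 1\<^sub>m n\<close> from \<open>R\<close>; multiplication by
      \<open>A\<close> from the right then removes \<open>R\<close>.\<close>
    have WR: "(W j \<otimes>\<^sub>m 1\<^sub>m n) * R = ((W j * U 0) \<otimes>\<^sub>m vmat n n b) * C"
      using C_dim by (simp add: R_def tensor_mult flip: mult_assoc_dim del: assoc_mult_mat)
    have WW: "(U j \<otimes>\<^sub>m U j) * ?UU\<^sup>\<dagger> = W j \<otimes>\<^sub>m W j"
      by (simp add: tensor_adjoint tensor_mult W_def)
    have "A * ((W j \<otimes>\<^sub>m 1\<^sub>m n) * R) = (d j / d 0) \<cdot>\<^sub>m (W j \<otimes>\<^sub>m W j)"
      unfolding WR WU keyC[OF j] WW ..
    then have "A * ((W j \<otimes>\<^sub>m 1\<^sub>m n) * R) * A = (d j / d 0) \<cdot>\<^sub>m ((W j \<otimes>\<^sub>m W j) * A)"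
      using dims by (simp add: smult_mult_left)
    moreover have "A * ((W j \<otimes>\<^sub>m 1\<^sub>m n) * R) * A = A * ((W j \<otimes>\<^sub>m 1\<^sub>m n) * (R * A))"
      using dims by (simp only: mult_assoc_dim index_mult_mat dim_tensor_mat W_dim index_one_mat)
    ultimately have "A * (W j \<otimes>\<^sub>m 1\<^sub>m n) = (d j / d 0) \<cdot>\<^sub>m ((W j \<otimes>\<^sub>m W j) * A)"
      unfolding RA by simp
    moreover have "unitary n (W j)"
      unfolding W_def by (intro unitary_mult unitary_adjoint U j N)
    ultimately show ?thesis by (auto simp: copy_group_def)
  qed
  have "W i * W j = W j * W i" if "i < N" "j < N" for i j
    by (rule copy_group_commute[OF W[OF that(2)] W[OF that(1)]])
  from commuting_family[of N W, OF W this] show ?thesis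
    unfolding clock_form_def W_def U_def .
qed

text \<open>The two hypotheses on the transformed states \<open>S j\<close> play separate roles.
  Being Bell states puts the relative operators \<open>Q j\<close> into a conjugate of the Weyl
  group, and common Schmidt bases make them all diagonal in the basis \<open>e\<close>, hence
  commuting. Together these are the assumptions of \<open>commuting_family\<close>.\<close>

lemma bell_imp_clock_form:
  assumes prime: "prime n" and N: "0 < N" and me: "\<forall>j<N. max_entangled n (\<Psi> j)"
    and g: "onb n g" and h: "onb n h" and V: "unitary n V" and W: "unitary n W"
    and c: "\<forall>j<N. cmod (c j) = 1"
    and bell: "\<forall>j<N. \<exists>k m. c j \<cdot>\<^sub>v ((V \<otimes>\<^sub>m W) *\<^sub>v \<Psi> j) = bell_state n g h k m"
    and schmidt: "sim_schmidt_decomposable n {c j \<cdot>\<^sub>v ((V \<otimes>\<^sub>m W) *\<^sub>v \<Psi> j) | j. j < N}"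
  shows "clock_form n N \<Psi>"
proof -
  have n: "n > 0" using prime by (rule prime_gt_0_nat)
  define U where "U j = state_op n (\<Psi> j)" for j
  have U: "unitary n (U j)" and \<Psi>: "\<Psi> j \<in> carrier_vec (n * n)" if "j < N" for j
    using max_entangled_state_op[OF n me[rule_format, OF that]] by (auto simp: U_def)
  have U_carrier [simp]: "dim_row (U j) = n" "dim_col (U j) = n" "U j \<in> carrier_mat n n" for j
    by (simp_all add: U_def)
  note VD = unitaryD[OF V] and WD = unitaryD[OF W] and WT = unitaryD[OF unitary_transpose[OF W]]
  define S where "S j = c j \<cdot>\<^sub>v ((V \<otimes>\<^sub>m W) *\<^sub>v \<Psi> j)" for j
  have S_carrier: "S j \<in> carrier_vec (n * n)" for j
    using VD WD by (intro carrier_vecI) (simp add: S_def)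
  have op_S: "state_op n (S j) = c j \<cdot>\<^sub>m (V * U j * W\<^sup>T)" if "j < N" for j
  proof -
    have "(V \<otimes>\<^sub>m W) *\<^sub>v \<Psi> j \<in> carrier_vec (n * n)"
      using VD WD by (intro carrier_vecI) simp
    then show ?thesis
      unfolding S_def U_def using state_op_apply[OF VD(1) WD(1) \<Psi>[OF that]]
      by (simp only: state_op_smult)
  qed
  \<comment> \<open>The unitary of the second party cancels in the quotient of two states, leaving a
    conjugation by \<open>V\<close>.\<close>
  have rel: "state_op n (S i) * (state_op n (S j))\<^sup>\<dagger>
      = (c i * cnj (c j)) \<cdot>\<^sub>m (V * (U i * (U j)\<^sup>\<dagger>) * V\<^sup>\<dagger>)" if "i < N" "j < N" for i j
    unfolding op_S[OF that(1)] op_S[OF that(2)]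
    using VD(1-3) WD(1-3) WT
    by (simp add: adjoint_smult adjoint_mult mat_simps unitary_cancel[OF unitary_transpose[OF W]]
        mult.commute)
  obtain e f where e: "onb n e" and f: "onb n f"
    and b0: "\<forall>j<N. \<exists>b. S j = vec_sum (n * n) (\<lambda>k. b k \<cdot>\<^sub>v (e k \<otimes>\<^sub>v f k)) {..<n}"
    using schmidt unfolding sim_schmidt_decomposable_def S_def by blast
  note E = unitary_onb_mat[OF e] and F = unitary_transpose[OF unitary_onb_mat[OF f]]
  have diag: "\<exists>b. state_op n (S j) = onb_mat n e * dmat n b * (onb_mat n f)\<^sup>T" if j: "j < N" for j
  proof -
    obtain b where b: "S j = vec_sum (n * n) (\<lambda>k. b k \<cdot>\<^sub>v (e k \<otimes>\<^sub>v f k)) {..<n}"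
      using b0 j by blast
    have "state_op n (S j)
        = onb_mat n e * (complex_of_real (sqrt (real n)) \<cdot>\<^sub>m dmat n b) * (onb_mat n f)\<^sup>T"
      unfolding state_op_def b vmat_schmidt(2)[OF e f] by (simp add: mat_simps)
    then show ?thesis unfolding dmat_smult by blast
  qed
  have rel_diag: "\<exists>b. state_op n (S i) * (state_op n (S j))\<^sup>\<dagger> = onb_mat n e * dmat n b * (onb_mat n e)\<^sup>\<dagger>"
    if ij: "i < N" "j < N" for i j
  proof -
    obtain a b where ab: "state_op n (S i) = onb_mat n e * dmat n a * (onb_mat n f)\<^sup>T"
      "state_op n (S j) = onb_mat n e * dmat n b * (onb_mat n f)\<^sup>T"
      using diag ij by blast
    have "state_op n (S i) * (state_op n (S j))\<^sup>\<dagger>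
        = onb_mat n e * (dmat n a * (dmat n b)\<^sup>\<dagger>) * (onb_mat n e)\<^sup>\<dagger>"
      unfolding ab by (simp add: adjoint_mult mult_assoc_dim unitary_cancel[OF F])
    then show ?thesis unfolding dmat_adjoint dmat_mult by blast
  qed
  define Q where "Q j = V * (U j * (U 0)\<^sup>\<dagger>) * V\<^sup>\<dagger>" for j
  have Q_dim [simp]: "dim_row (Q j) = n" "dim_col (Q j) = n" for j
    using VD by (auto simp: Q_def)
  have Q_eq: "Q j = (cnj (c j) * c 0) \<cdot>\<^sub>m (state_op n (S j) * (state_op n (S 0))\<^sup>\<dagger>)" if j: "j < N" for j
  proof -
    have "cnj (c j) * c j = 1" "cnj (c 0) * c 0 = 1"
      using c[rule_format, OF j] c[rule_format, OF N] by (simp_all add: mult.commute flip: complex_norm_square)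
    then have "cnj (c j) * c 0 * (c j * cnj (c 0)) = 1"
      by (metis mult.commute mult.left_commute mult_1)
    then show ?thesis
      unfolding rel[OF j N] Q_def by (simp only: smult_smult_mat one_smult_mat)
  qed
  have comm: "Q i * Q j = Q j * Q i" if ij: "i < N" "j < N" for i j
  proof -
    obtain a b where ab: "state_op n (S i) * (state_op n (S 0))\<^sup>\<dagger> = onb_mat n e * dmat n a * (onb_mat n e)\<^sup>\<dagger>"
      "state_op n (S j) * (state_op n (S 0))\<^sup>\<dagger> = onb_mat n e * dmat n b * (onb_mat n e)\<^sup>\<dagger>"
      using rel_diag ij N by blast
    have "dmat n a * dmat n b = dmat n b * dmat n a"
      by (simp add: dmat_mult mult.commute)
    then have "dmat n a * (dmat n b * M) = dmat n b * (dmat n a * M)" if "dim_row M = n" for M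
      using that by (metis dim_dmat mult_assoc_dim)
    then show ?thesis
      unfolding Q_eq[OF ij(1)] Q_eq[OF ij(2)] ab
      by (simp add: mat_simps unitary_cancel[OF E] mult.commute)
  qed
  interpret trace_group n "weyl_group n" by (rule trace_group_weyl[OF prime])
  define Y where "Y = onb_mat n g"
  have Y: "unitary n Y" unfolding Y_def by (rule unitary_onb_mat[OF g])
  \<comment> \<open>Conjugation in \<open>conj_trace_group\<close> has the adjoint on the left;
    using the adjoint of \<open>Y\<close> yields \<open>Y * P\<close> times the adjoint of
    \<open>Y\<close>, hence the double adjoint.\<close>
  interpret conj: trace_group n "(\<lambda>P. Y\<^sup>\<dagger>\<^sup>\<dagger> * P * Y\<^sup>\<dagger>) ` weyl_group n"
    by (rule conj_trace_group[OF unitary_adjoint[OF Y]])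
  note H = unitary_transpose[OF unitary_onb_mat[OF h]]
  have Q_mem: "Q j \<in> (\<lambda>P. Y\<^sup>\<dagger>\<^sup>\<dagger> * P * Y\<^sup>\<dagger>) ` weyl_group n" if j: "j < N" for j
  proof -
    obtain k m k' m' where km: "S j = bell_state n g h k m" "S 0 = bell_state n g h k' m'"
      using bell j N unfolding S_def by blast
    let ?T = "clock n k * shift n m" and ?T' = "clock n k' * shift n m'"
    have Q_T: "Q j = (cnj (c j) * c 0) \<cdot>\<^sub>m (Y * (?T * ?T'\<^sup>\<dagger>) * Y\<^sup>\<dagger>)"
      unfolding Q_eq[OF j] km bell_state_op[OF n g h] Y_def[symmetric] using unitaryD[OF Y]
      by (simp add: adjoint_mult mat_simps unitary_cancel[OF H])
    have "Y * (?T * ?T'\<^sup>\<dagger>) * Y\<^sup>\<dagger> \<in> (\<lambda>P. Y\<^sup>\<dagger>\<^sup>\<dagger> * P * Y\<^sup>\<dagger>) ` weyl_group n"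
      using mult[OF clock_shift_in_weyl_group adjoint[OF clock_shift_in_weyl_group]]
      by (intro image_eqI) auto
    then show ?thesis
      unfolding Q_T by (rule conj.smult) (simp add: norm_mult c[rule_format, OF j] c[rule_format, OF N])
  qed
  obtain X where X: "unitary n X"
    and clocks: "\<And>j. j < N \<Longrightarrow> \<exists>i<n. \<exists>a. cmod a = 1 \<and> Q j = a \<cdot>\<^sub>m (X * clock n i * X\<^sup>\<dagger>)"
    using conj.commuting_family[of N Q] Q_mem comm by blast
  note XD = unitaryD[OF X]
  \<comment> \<open>Undoing the conjugation by \<open>V\<close> moves the eigenbasis from
    \<open>X\<close> to the adjoint of \<open>V\<close> times \<open>X\<close>.\<close>
  have "\<exists>i<n. \<exists>a. cmod a = 1 \<and> U j * (U 0)\<^sup>\<dagger> = a \<cdot>\<^sub>m ((V\<^sup>\<dagger> * X) * clock n i * (V\<^sup>\<dagger> * X)\<^sup>\<dagger>)"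
    if j: "j < N" for j
  proof -
    obtain i a where i: "i < n" "cmod a = 1" "Q j = a \<cdot>\<^sub>m (X * clock n i * X\<^sup>\<dagger>)"
      using clocks[OF j] by blast
    have "U j * (U 0)\<^sup>\<dagger> = V\<^sup>\<dagger> * Q j * V"
      unfolding Q_def using VD by (simp add: mult_assoc_dim unitary_cancel[OF V])
    also have "\<dots> = a \<cdot>\<^sub>m ((V\<^sup>\<dagger> * X) * clock n i * (V\<^sup>\<dagger> * X)\<^sup>\<dagger>)"
      unfolding i(3) using VD XD by (simp add: mat_simps adjoint_mult)
    finally show ?thesis using i by blast
  qed
  moreover have "unitary n (V\<^sup>\<dagger> * X)"
    by (intro unitary_mult unitary_adjoint V X)
  ultimately show ?thesis
    unfolding clock_form_def U_def by blast
qed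

text \<open>Only Bell states with second index 0 are reached: they carry powers of \<open>Z\<close>
  alone, which makes their simultaneous Schmidt decomposition in the bases \<open>g\<close> and
  \<open>h\<close> immediate.\<close>

lemma clock_form_imp_bell:
  assumes prime: "prime n" and N: "0 < N" and me: "\<forall>j<N. max_entangled n (\<Psi> j)"
    and g: "onb n g" and h: "onb n h" and "clock_form n N \<Psi>"
  shows "\<exists>V W c. unitary n V \<and> unitary n W \<and> (\<forall>j<N. cmod (c j) = 1 \<and>
    (\<exists>i<n. c j \<cdot>\<^sub>v ((V \<otimes>\<^sub>m W) *\<^sub>v \<Psi> j) = bell_state n g h i 0))"
proof -
  have n: "n > 0" using prime by (rule prime_gt_0_nat)
  define U where "U j = state_op n (\<Psi> j)" for j
  have U: "unitary n (U j)" and \<Psi>: "\<Psi> j \<in> carrier_vec (n * n)" if "j < N" for j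
    using max_entangled_state_op[OF n me[rule_format, OF that]] by (auto simp: U_def)
  have U_dim [simp]: "dim_row (U j) = n" "dim_col (U j) = n" for j
    by (simp_all add: U_def)
  obtain X where X: "unitary n X" and clocks: "\<And>j. j < N \<Longrightarrow> \<exists>i<n. \<exists>c. cmod c = 1 \<and>
    U j * (U 0)\<^sup>\<dagger> = c \<cdot>\<^sub>m (X * clock n i * X\<^sup>\<dagger>)"
    using assms(6) unfolding clock_form_def U_def by blast
  define Yg where "Yg = onb_mat n g"
  define Yh where "Yh = (onb_mat n h)\<^sup>T"
  have Yg: "unitary n Yg" and Yh: "unitary n Yh"
    using unitary_onb_mat[OF g] unitary_transpose[OF unitary_onb_mat[OF h]] by (auto simp: Yg_def Yh_def)
  \<comment> \<open>\<open>V\<close> carries the eigenbasis \<open>X\<close> to \<open>g\<close>.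
    The transpose of \<open>W\<close> is chosen next so that
    \<open>V * U 0 * W\<^sup>T = Yg * Yh\<close>, which sends \<open>\<Psi> 0\<close> to the Bell
    state with both indices 0.\<close>
  define V where "V = Yg * X\<^sup>\<dagger>"
  define W where "W = ((U 0)\<^sup>\<dagger> * X * Yh)\<^sup>T"
  have V: "unitary n V"
    unfolding V_def by (intro unitary_mult unitary_adjoint Yg X)
  have W: "unitary n W"
    unfolding W_def by (intro unitary_mult unitary_adjoint unitary_transpose U[OF N] X Yh)
  note XD = unitaryD[OF X] and VD = unitaryD[OF V] and WD = unitaryD[OF W]
    and YgD = unitaryD(2,3)[OF Yg] and YhD = unitaryD(2,3)[OF Yh]
  have "\<exists>c. cmod c = 1 \<and> (\<exists>i<n. c \<cdot>\<^sub>v ((V \<otimes>\<^sub>m W) *\<^sub>v \<Psi> j) = bell_state n g h i 0)" if j: "j < N" for j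
  proof -
    obtain i c where i: "i < n" and c: "cmod c = 1" and eq: "U j * (U 0)\<^sup>\<dagger> = c \<cdot>\<^sub>m (X * clock n i * X\<^sup>\<dagger>)"
      using clocks[OF j] by blast
    have carrier: "(V \<otimes>\<^sub>m W) *\<^sub>v \<Psi> j \<in> carrier_vec (n * n)"
      using VD WD by (intro carrier_vecI) simp
    have "state_op n ((V \<otimes>\<^sub>m W) *\<^sub>v \<Psi> j) = V * U j * W\<^sup>T"
      unfolding U_def by (rule state_op_apply[OF VD(1) WD(1) \<Psi>[OF j]])
    also have "\<dots> = Yg * (X\<^sup>\<dagger> * ((U j * (U 0)\<^sup>\<dagger>) * (X * Yh)))"
      using XD(1-3) YgD YhD by (simp add: V_def W_def mult_assoc_dim)
    also have "\<dots> = c \<cdot>\<^sub>m (Yg * clock n i * Yh)"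
      unfolding eq using XD(1-3) YgD YhD by (simp add: mat_simps unitary_cancel[OF X])
    finally have op: "state_op n ((V \<otimes>\<^sub>m W) *\<^sub>v \<Psi> j) = c \<cdot>\<^sub>m (Yg * clock n i * Yh)" .
    have "cnj c * c = 1"
      using c by (simp add: mult.commute flip: complex_norm_square)
    then have "state_op n (cnj c \<cdot>\<^sub>v ((V \<otimes>\<^sub>m W) *\<^sub>v \<Psi> j)) = Yg * clock n i * Yh"
      unfolding state_op_smult[OF carrier] op by (simp only: smult_smult_mat one_smult_mat)
    also have "\<dots> = state_op n (bell_state n g h i 0)"
      unfolding bell_state_op[OF n g h] Yg_def Yh_def by (simp add: shift_0)
    finally have "cnj c \<cdot>\<^sub>v ((V \<otimes>\<^sub>m W) *\<^sub>v \<Psi> j) = bell_state n g h i 0"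
      using carrier vmat_bell_state(1)[OF g h] by (intro state_op_eqD[OF n]) auto
    with i c show ?thesis by (metis complex_mod_cnj)
  qed
  then show ?thesis using V W by metis
qed

text \<open>Powers of \<open>Z\<close> are diagonal in \<open>g\<close>, so the Schmidt coefficients
  are the entries of the clock matrix over \<open>sqrt n\<close>.\<close>

lemma sim_schmidt_decomposable_bell:
  assumes "n > 0" and g: "onb n g" and h: "onb n h"
    and S: "\<And>\<psi>. \<psi> \<in> S \<Longrightarrow> \<exists>i. \<psi> = bell_state n g h i 0"
  shows "sim_schmidt_decomposable n S"
proof -
  have "\<exists>b. \<psi> = vec_sum (n * n) (\<lambda>k. b k \<cdot>\<^sub>v (g k \<otimes>\<^sub>v h k)) {..<n}" if "\<psi> \<in> S" for \<psi>
  proof -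
  obtain i where \<psi>: "\<psi> = bell_state n g h i 0" using S[OF \<open>\<psi> \<in> S\<close>] by blast
  define b where "b = (\<lambda>k. complex_of_real (1 / sqrt (real n)) * root_unity n ^ (i * k))"
  have "vmat n n \<psi> = onb_mat n g * (complex_of_real (1 / sqrt (real n)) \<cdot>\<^sub>m clock n i) * (onb_mat n h)\<^sup>T"
    unfolding \<psi> vmat_bell_state(2)[OF g h] by (simp add: shift_0 mat_simps)
  also have "\<dots> = vmat n n (vec_sum (n * n) (\<lambda>k. b k \<cdot>\<^sub>v (g k \<otimes>\<^sub>v h k)) {..<n})"
    unfolding vmat_schmidt(2)[OF g h] clock_def dmat_smult b_def ..
  finally have "\<psi> = vec_sum (n * n) (\<lambda>k. b k \<cdot>\<^sub>v (g k \<otimes>\<^sub>v h k)) {..<n}"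
    using vmat_bell_state(1)[OF g h] unfolding \<psi> by (rule vmat_eqD) (rule vmat_schmidt(1)[OF g h])
  then show ?thesis
    by (rule exI[of _ b])
  qed
  with g h show ?thesis
    unfolding sim_schmidt_decomposable_def by blast
qed

text \<open>The permutation \<open>|k\<rangle> \<otimes> |l\<rangle> \<mapsto> |k - l\<rangle> \<otimes> |l\<rangle>\<close>, a controlled shift.\<close>

definition copy_mat :: "nat \<Rightarrow> complex mat" where
  "copy_mat n = permutation_mat (n * n) (\<lambda>r. ((r div n + r mod n) mod n) * n + r mod n)"

lemma copy_mat_index_less:
  fixes r n :: nat
  assumes "r < n * n"
  shows "((r div n + r mod n) mod n) * n + r mod n < n * n"
  using div_mod_less[OF assms] by (intro digits_less) auto

lemma unitary_copy_mat: "unitary (n * n) (copy_mat n)"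
  unfolding copy_mat_def
proof (rule unitary_permutation_mat)
  let ?s = "\<lambda>r. ((r div n + r mod n) mod n) * n + r mod n"
  show "?s r < n * n" if "r < n * n" for r
    using copy_mat_index_less[OF that] .
  show "inj_on ?s {..<n * n}"
  proof (rule inj_onI)
    fix r r' assume rr: "r \<in> {..<n * n}" "r' \<in> {..<n * n}" "?s r = ?s r'"
    then have less: "r div n < n" "r mod n < n" "r' div n < n" "r' mod n < n"
      using div_mod_less[of r n n] div_mod_less[of r' n n] by auto
    have mod_eq: "r mod n = r' mod n"
      using arg_cong[OF rr(3), of "\<lambda>x. x mod n"] by simp
    have "(r div n + r mod n) mod n * n = (r' div n + r mod n) mod n * n"
      using rr(3) mod_eq by simp
    then have "(r div n + r mod n) mod n = (r' div n + r mod n) mod n"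
      using less by simp
    then have "[r div n + r mod n = r' div n + r mod n] (mod n)"
      by (simp add: cong_def)
    then have "[r div n = r' div n] (mod n)"
      by (simp only: cong_add_rcancel_nat)
    then have "r div n = r' div n"
      using less by (simp add: cong_def)
    with mod_eq show "r = r'"
      by (metis div_mult_mod_eq)
  qed
qed

lemma dmat_tensor: "dmat n a \<otimes>\<^sub>m dmat m b = dmat (n * m) (\<lambda>i. a (i div m) * b (i mod m))"
proof (intro eq_matI)
  fix i j
  assume "i < dim_row (dmat (n * m) (\<lambda>i. a (i div m) * b (i mod m)))"
    and "j < dim_col (dmat (n * m) (\<lambda>i. a (i div m) * b (i mod m)))"
  then have ij: "i < n * m" "j < n * m" by auto
  have "i = j \<longleftrightarrow> i div m = j div m \<and> i mod m = j mod m"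
    by (metis div_mult_mod_eq)
  then show "(dmat n a \<otimes>\<^sub>m dmat m b) $$ (i, j) = dmat (n * m) (\<lambda>i. a (i div m) * b (i mod m)) $$ (i, j)"
    using ij div_mod_less[OF ij(1)] div_mod_less[OF ij(2)] by (auto simp: dmat_def)
qed auto

text \<open>Row \<open>(k, l)\<close> of \<open>copy_mat\<close> reads row
  \<open>(k + l, l)\<close>. Moving a clock phase \<open>w^(i k)\<close> across it produces
  \<open>w^(i (k + l))\<close>, the product of the phases of both factors; so one clock becomes
  two.\<close>

lemma copy_mat_clock:
  assumes "n > 0"
  shows "copy_mat n * (clock n i \<otimes>\<^sub>m 1\<^sub>m n) = (clock n i \<otimes>\<^sub>m clock n i) * copy_mat n"
proof -
  let ?w = "root_unity n" and ?s = "\<lambda>r. ((r div n + r mod n) mod n) * n + r mod n"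
  have one: "clock n i \<otimes>\<^sub>m 1\<^sub>m n = dmat (n * n) (\<lambda>r. ?w ^ (i * (r div n)))"
    using dmat_tensor[of n "\<lambda>k. ?w ^ (i * k)" n "\<lambda>_. 1"]
    by (simp add: clock_def dmat_const one_smult_mat)
  have two: "clock n i \<otimes>\<^sub>m clock n i = dmat (n * n) (\<lambda>r. ?w ^ (i * (r div n)) * ?w ^ (i * (r mod n)))"
    unfolding clock_def by (rule dmat_tensor)
  show ?thesis
    unfolding one two
  proof (intro eq_matI)
    let ?A = "dmat (n * n) (\<lambda>r. ?w ^ (i * (r div n)) * ?w ^ (i * (r mod n))) * copy_mat n"
    fix r c assume "r < dim_row ?A" "c < dim_col ?A"
    then have rc: "r < n * n" "c < n * n" by (auto simp: copy_mat_def)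
    have "?w ^ (i * (?s r div n)) = ?w ^ (i * (r div n)) * ?w ^ (i * (r mod n))"
    proof -
      have "?s r div n = (r div n + r mod n) mod n"
        using assms by simp
      moreover have "[i * ((r div n + r mod n) mod n) = i * (r div n + r mod n)] (mod n)"
        by (intro cong_mult cong_refl) (simp add: cong_def)
      ultimately show ?thesis
        using root_unity_power_eq_iff[OF assms]
        by (simp only: cong_def add_mult_distrib2 flip: power_add)
    qed
    then show "(copy_mat n * dmat (n * n) (\<lambda>r. ?w ^ (i * (r div n)))) $$ (r, c) = ?A $$ (r, c)"
      using rc by (simp add: index_mult_dmat index_dmat_mult copy_mat_def del: index_mult_mat(1))
        (simp add: permutation_mat_def)
  qed (auto simp: copy_mat_def)
qed

lemma ketbra_phase:
  assumes "cmod c = 1"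
  shows "ketbra (c \<cdot>\<^sub>v v) (c \<cdot>\<^sub>v v) = ketbra v v"
proof -
  have "c * cnj c = 1"
    using assms by (simp flip: complex_norm_square)
  then have "c * x * (cnj c * y) = x * y" for x y
    by (metis mult.assoc mult.left_commute mult_1)
  then show ?thesis
    by (intro eq_matI) (auto simp: ketbra_def)
qed

text \<open>The blank state is \<open>\<Psi> 0\<close>, and local unitaries suffice.
  \<open>A\<close> copies the relative operators \<open>U j * (U 0)\<^sup>\<dagger>\<close>, while
  \<open>B\<close> keeps the pair \<open>U 0 \<otimes>\<^sub>m U 0\<close> fixed.\<close>

lemma clock_form_imp_locally_copiable:
  assumes prime: "prime n" and N: "0 < N" and me: "\<forall>j<N. max_entangled n (\<Psi> j)"
    and "clock_form n N \<Psi>"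
  shows "locally_copiable n N \<Psi>"
proof -
  have n: "n > 0" using prime by (rule prime_gt_0_nat)
  define U where "U j = state_op n (\<Psi> j)" for j
  have U: "unitary n (U j)" and \<Psi>: "\<Psi> j \<in> carrier_vec (n * n)" if "j < N" for j
    using max_entangled_state_op[OF n me[rule_format, OF that]] by (auto simp: U_def)
  have U_dim [simp]: "dim_row (U j) = n" "dim_col (U j) = n" for j
    by (simp_all add: U_def)
  obtain X where X: "unitary n X" and clocks: "\<And>j. j < N \<Longrightarrow> \<exists>i<n. \<exists>c. cmod c = 1 \<and>
    U j * (U 0)\<^sup>\<dagger> = c \<cdot>\<^sub>m (X * clock n i * X\<^sup>\<dagger>)"
    using assms(4) unfolding clock_form_def U_def by blast
  note XD = unitaryD[OF X]
  define P where "P = copy_mat n"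
  have P: "unitary (n * n) P" unfolding P_def by (rule unitary_copy_mat)
  note XX = unitary_tensor[OF X X] and UU = unitary_tensor[OF U[OF N] U[OF N]]
  \<comment> \<open>The controlled shift of two factors, taken in the common eigenbasis of the
    relative operators.\<close>
  define A where "A = (X \<otimes>\<^sub>m X) * P * (X \<otimes>\<^sub>m X)\<^sup>\<dagger>"
  \<comment> \<open>Solved from \<open>A * (U 0 \<otimes>\<^sub>m U 0) * B\<^sup>T = U 0
    \<otimes>\<^sub>m U 0\<close>: Bob undoes the action of \<open>A\<close> on the pair of
    reference states.\<close>
  define B where "B = ((U 0 \<otimes>\<^sub>m U 0)\<^sup>\<dagger> * A\<^sup>\<dagger> * (U 0 \<otimes>\<^sub>m U 0))\<^sup>T"
  have A: "unitary (n * n) A"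
    unfolding A_def by (intro unitary_mult unitary_adjoint XX P)
  have B: "unitary (n * n) B"
    unfolding B_def by (intro unitary_mult unitary_adjoint unitary_transpose UU A)
  note AD = unitaryD[OF A] and BD = unitaryD[OF B] and PD = unitaryD(2,3)[OF P] and XXD = unitaryD(2,3)[OF XX]
  have transform: "\<exists>c. cmod c = 1 \<and> A * (U j \<otimes>\<^sub>m U 0) * B\<^sup>T = c \<cdot>\<^sub>m (U j \<otimes>\<^sub>m U j)" if j: "j < N" for j
  proof -
    obtain i c where c: "cmod c = 1" and eq: "U j * (U 0)\<^sup>\<dagger> = c \<cdot>\<^sub>m (X * clock n i * X\<^sup>\<dagger>)"
      using clocks[OF j] by blast
    let ?W = "U j * (U 0)\<^sup>\<dagger>"
    have WU: "?W * U 0 = U j"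
      using unitaryD[OF U[OF N]] by (simp add: mult_assoc_dim)
    have W1: "?W \<otimes>\<^sub>m 1\<^sub>m n = c \<cdot>\<^sub>m ((X \<otimes>\<^sub>m X) * (clock n i \<otimes>\<^sub>m 1\<^sub>m n) * (X \<otimes>\<^sub>m X)\<^sup>\<dagger>)"
      unfolding eq using XD by (simp add: tensor_smult_left tensor_adjoint tensor_mult)
    have WW: "(X \<otimes>\<^sub>m X) * (clock n i \<otimes>\<^sub>m clock n i) * (X \<otimes>\<^sub>m X)\<^sup>\<dagger> = (cnj c * cnj c) \<cdot>\<^sub>m (?W \<otimes>\<^sub>m ?W)"
    proof -
      have "cnj c * cnj c * (c * c) = 1"
        using c by (metis (no_types) complex_norm_square mult.assoc mult.commute mult_1 of_real_1 power_one)
      then show ?thesis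
        unfolding eq using XD
        by (simp add: tensor_smult_left tensor_smult_right tensor_adjoint tensor_mult smult_smult_mat
            one_smult_mat mult_ac)
    qed
    have "A * (?W \<otimes>\<^sub>m 1\<^sub>m n) = c \<cdot>\<^sub>m ((X \<otimes>\<^sub>m X) * ((P * (clock n i \<otimes>\<^sub>m 1\<^sub>m n)) * (X \<otimes>\<^sub>m X)\<^sup>\<dagger>))"
      unfolding A_def W1 using XD(2,3) PD by (simp add: mat_simps unitary_cancel[OF XX])
    also have "P * (clock n i \<otimes>\<^sub>m 1\<^sub>m n) = (clock n i \<otimes>\<^sub>m clock n i) * P"
      unfolding P_def by (rule copy_mat_clock[OF n])
    also have "c \<cdot>\<^sub>m ((X \<otimes>\<^sub>m X) * ((clock n i \<otimes>\<^sub>m clock n i) * P * (X \<otimes>\<^sub>m X)\<^sup>\<dagger>))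
        = c \<cdot>\<^sub>m ((X \<otimes>\<^sub>m X) * (clock n i \<otimes>\<^sub>m clock n i) * (X \<otimes>\<^sub>m X)\<^sup>\<dagger> * A)"
      unfolding A_def using XD(2,3) PD by (simp add: mat_simps unitary_cancel[OF XX])
    also have "\<dots> = (c * (cnj c * cnj c)) \<cdot>\<^sub>m ((?W \<otimes>\<^sub>m ?W) * A)"
      unfolding WW using AD by (simp add: mat_simps)
    finally have AW: "A * (?W \<otimes>\<^sub>m 1\<^sub>m n) = (c * (cnj c * cnj c)) \<cdot>\<^sub>m ((?W \<otimes>\<^sub>m ?W) * A)" .
    have "A * (U j \<otimes>\<^sub>m U 0) = A * ((?W \<otimes>\<^sub>m 1\<^sub>m n) * (U 0 \<otimes>\<^sub>m U 0))"
      using WU by (simp add: tensor_mult del: assoc_mult_mat)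
    also have "\<dots> = A * (?W \<otimes>\<^sub>m 1\<^sub>m n) * (U 0 \<otimes>\<^sub>m U 0)"
      using AD by (intro mult_assoc_dim[symmetric]) auto
    also have "\<dots> = (c * (cnj c * cnj c)) \<cdot>\<^sub>m ((?W \<otimes>\<^sub>m ?W) * (A * (U 0 \<otimes>\<^sub>m U 0)))"
      unfolding AW using AD by (simp add: mat_simps)
    finally have "A * (U j \<otimes>\<^sub>m U 0) * B\<^sup>T
        = (c * (cnj c * cnj c)) \<cdot>\<^sub>m ((?W \<otimes>\<^sub>m ?W) * (A * ((U 0 \<otimes>\<^sub>m U 0) * B\<^sup>T)))"
      using AD(2,3) BD(2,3) by (simp add: mat_simps)
    also have "A * ((U 0 \<otimes>\<^sub>m U 0) * B\<^sup>T) = U 0 \<otimes>\<^sub>m U 0"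
      unfolding B_def using AD(2,3)
      by (simp add: mult_assoc_dim unitary_cancel[OF UU] unitary_cancel[OF A])
    also have "(?W \<otimes>\<^sub>m ?W) * (U 0 \<otimes>\<^sub>m U 0) = U j \<otimes>\<^sub>m U j"
      using WU by (simp add: tensor_mult del: assoc_mult_mat)
    finally show ?thesis
      \<comment> \<open>One phase \<open>c\<close> comes from the single relative operator and two
        inverse phases from the pair. The total is a global phase, which \<open>ketbra\<close> does
        not see.\<close>
      using c by (intro exI[of _ "c * (cnj c * cnj c)"]) (simp add: norm_mult)
  qed
  obtain \<Lambda> where locc: "locc (n * n) (n * n) (n * n) (n * n) \<Lambda>"
    and \<Lambda>: "\<And>v. v \<in> carrier_vec ((n * n) * (n * n)) \<Longrightarrow>
      \<Lambda> (ketbra v v) = ketbra ((A \<otimes>\<^sub>m B) *\<^sub>v v) ((A \<otimes>\<^sub>m B) *\<^sub>v v)"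
    using locc_local_unitary[OF A B] by blast
  have "\<Lambda> (regroup n (ketbra (\<Psi> j) (\<Psi> j) \<otimes>\<^sub>m ketbra (\<Psi> 0) (\<Psi> 0))) =
      regroup n (ketbra (\<Psi> j) (\<Psi> j) \<otimes>\<^sub>m ketbra (\<Psi> j) (\<Psi> j))" if j: "j < N" for j
  proof -
    define s where "s = complex_of_real (1 / sqrt (real n))"
    have vmat: "vmat n n (\<Psi> j) = s \<cdot>\<^sub>m U j" for j
      unfolding s_def U_def by (rule vmat_eq_state_op[OF n])
    let ?v = "regroup_vec n (\<Psi> j \<otimes>\<^sub>v \<Psi> 0)" and ?u = "regroup_vec n (\<Psi> j \<otimes>\<^sub>v \<Psi> j)"
    obtain c where c: "cmod c = 1" "A * (U j \<otimes>\<^sub>m U 0) * B\<^sup>T = c \<cdot>\<^sub>m (U j \<otimes>\<^sub>m U j)"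
      using transform[OF j] by blast
    have "vmat (n * n) (n * n) ((A \<otimes>\<^sub>m B) *\<^sub>v ?v) = A * (vmat n n (\<Psi> j) \<otimes>\<^sub>m vmat n n (\<Psi> 0)) * B\<^sup>T"
      unfolding vmat_regroup_vec[OF \<Psi>[OF j] \<Psi>[OF N], symmetric]
      by (rule vmat_tensor_apply[OF AD(1) BD(1)]) simp
    also have "\<dots> = (s * s) \<cdot>\<^sub>m (A * (U j \<otimes>\<^sub>m U 0) * B\<^sup>T)"
      unfolding vmat using AD(2,3) BD(2,3) by (simp add: tensor_smult_left tensor_smult_right mat_simps)
    also have "\<dots> = c \<cdot>\<^sub>m (vmat n n (\<Psi> j) \<otimes>\<^sub>m vmat n n (\<Psi> j))"
      unfolding vmat c(2) by (simp add: tensor_smult_left tensor_smult_right smult_smult_mat mult.commute)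
    also have "\<dots> = vmat (n * n) (n * n) (c \<cdot>\<^sub>v ?u)"
      by (simp add: vmat_smult vmat_regroup_vec[OF \<Psi>[OF j] \<Psi>[OF j]])
    finally have "(A \<otimes>\<^sub>m B) *\<^sub>v ?v = c \<cdot>\<^sub>v ?u"
      by (rule vmat_eqD) (use AD(2) BD(2) in \<open>auto intro!: carrier_vecI simp: regroup_vec_def\<close>)
    then show ?thesis
      unfolding regroup_ketbra[OF \<Psi>[OF j] \<Psi>[OF N]] regroup_ketbra[OF \<Psi>[OF j] \<Psi>[OF j]]
      using c(1) by (simp add: \<Lambda> ketbra_phase)
  qed
  moreover have "unit_state (n * n) (\<Psi> 0)"
    using me[rule_format, OF N] by (simp add: max_entangled_def)
  ultimately show ?thesis
    unfolding locally_copiable_def using locc by blast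
qed

lemma locally_copiable_empty:
  assumes "n > 0"
  shows "locally_copiable n 0 \<Psi>"
proof -
  have "unit_state (n * n) (unit_vec (n * n) 0)"
    using assms by (simp add: unit_state_def)
  then show ?thesis
    unfolding locally_copiable_def using locc.finish by blast
qed

theorem theorem6:
  fixes D N :: nat
    and g h :: "nat \<Rightarrow> complex vec"
    and \<Psi> :: "nat \<Rightarrow> complex vec"
  assumes "prime D"
    and "onb D g" and "onb D h"
    and "\<forall>j<N. max_entangled D (\<Psi> j)"
    and "\<forall>i<N. \<forall>j<N. i \<noteq> j \<longrightarrow> \<Psi> i \<bullet>c \<Psi> j = 0"
  shows "locally_copiable D N \<Psi> \<longleftrightarrow>
    (\<exists>V W. unitary D V \<and> unitary D W \<and>
      (\<exists>c :: nat \<Rightarrow> complex. (\<forall>j<N. cmod (c j) = 1) \<and>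
        (let S = {c j \<cdot>\<^sub>v ((V \<otimes>\<^sub>m W) *\<^sub>v \<Psi> j) | j. j < N} in
          S \<subseteq> {bell_state D g h n m | n m. n < D \<and> m < D} \<and>
          sim_schmidt_decomposable D S)))"
    (is "_ \<longleftrightarrow> ?bell")
proof (cases "N = 0")
  \<comment> \<open>Clock form is relative to \<open>\<Psi> 0\<close>, so the empty family is
    treated separately.\<close>
  case True
  have D: "D > 0" using \<open>prime D\<close> by (rule prime_gt_0_nat)
  have "sim_schmidt_decomposable D {}"
    using assms(2,3) by (auto simp: sim_schmidt_decomposable_def)
  then have ?bell
    using True unitary_one[of D] by (intro exI[of _ "1\<^sub>m D"]) auto
  with locally_copiable_empty[OF D] True show ?thesis by blast
next
  case False
  then have N: "0 < N" by simp
  have D: "D > 0" using \<open>prime D\<close> by (rule prime_gt_0_nat)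
  note me = assms(4)
  show ?thesis
  proof
    assume "locally_copiable D N \<Psi>"
    then have "clock_form D N \<Psi>"
      by (rule locally_copiable_imp_clock_form[OF \<open>prime D\<close> N me])
    then obtain V W c where V: "unitary D V" and W: "unitary D W"
      and c: "\<forall>j<N. cmod (c j) = 1 \<and>
        (\<exists>i<D. c j \<cdot>\<^sub>v ((V \<otimes>\<^sub>m W) *\<^sub>v \<Psi> j) = bell_state D g h i 0)"
      using clock_form_imp_bell[OF \<open>prime D\<close> N me assms(2,3)] by blast
    let ?S = "{c j \<cdot>\<^sub>v ((V \<otimes>\<^sub>m W) *\<^sub>v \<Psi> j) | j. j < N}"
    have S: "\<exists>i<D. \<psi> = bell_state D g h i 0" if "\<psi> \<in> ?S" for \<psi>
      using that c by blast
    then have "?S \<subseteq> {bell_state D g h n m | n m. n < D \<and> m < D}"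
      using D by blast
    moreover have "sim_schmidt_decomposable D ?S"
      using S by (intro sim_schmidt_decomposable_bell[OF D assms(2,3)]) blast
    ultimately show ?bell
      using V W c unfolding Let_def by blast
  next
    assume ?bell
    then obtain V W c where V: "unitary D V" and W: "unitary D W"
      and c: "\<forall>j<N. cmod (c j) = 1"
      and bell: "{c j \<cdot>\<^sub>v ((V \<otimes>\<^sub>m W) *\<^sub>v \<Psi> j) | j. j < N} \<subseteq> {bell_state D g h n m | n m. n < D \<and> m < D}"
      and schmidt: "sim_schmidt_decomposable D {c j \<cdot>\<^sub>v ((V \<otimes>\<^sub>m W) *\<^sub>v \<Psi> j) | j. j < N}"
      unfolding Let_def by blast
    have "\<forall>j<N. \<exists>k m. c j \<cdot>\<^sub>v ((V \<otimes>\<^sub>m W) *\<^sub>v \<Psi> j) = bell_state D g h k m"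
      using bell by blast
    then have "clock_form D N \<Psi>"
      by (rule bell_imp_clock_form[OF \<open>prime D\<close> N me assms(2,3) V W c _ schmidt])
    then show "locally_copiable D N \<Psi>"
      by (rule clock_form_imp_locally_copiable[OF \<open>prime D\<close> N me])
  qed
qed

end
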